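(* Let $\mathbb{K}$ be a field and $n\ge1$. The resolvents of the functions $x\mapsto -\overline{\dim}(x)+\frac{1}{8n}d(\mathbf{0},x)^2$ on $K(\mathcal{L})$ and $y\mapsto -\overline{\dim}(y)+\frac{1}{8n}d(\mathbf{0},y)^2$ on $K(\mathcal{M})$ can be computed in polynomial time. That is, there is a polynomial time algorithm which, given a point $x^0$ of $K(\mathcal{L})$ (resp. $y^0$ of $K(\mathcal{M})$) and $\lambda>0$, outputs the unique minimizer over $x\in K(\mathcal{L})$ of $-\overline{\dim}(x)+\frac{1}{8n}d(\mathbf{0},x)^2+\frac{1}{2\lambda}d(x,x^0)^2$ (resp. the unique minimizer over $y\in K(\mathcal{M})$ of $-\overline{\dim}(y)+\frac{1}{8n}d(\mathbf{0},y)^2+\frac{1}{2\lambda}d(y,y^0)^2$).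
   Context: Lattices: $\mathcal{L}$ is the lattice of all vector subspaces of $\mathbb{K}^n$ ordered by inclusion, and $\mathcal{M}$ is the lattice of all vector subspaces of $\mathbb{K}^n$ ordered by reverse inclusion. Both are modular lattices of rank $n$; the minimum element $\mathbf{0}$ is $\{0\}$ in $\mathcal{L}$ and $\mathbb{K}^n$ in $\mathcal{M}$. Orthoscheme complex: for a modular lattice $\mathcal{N}$ of finite rank $N$, $K(\mathcal{N})$ is the set of formal convex combinations $\sum_{p}\lambda(p)p$ of elements of $\mathcal{N}$ whose support $\{p:\lambda(p)\ne 0\}$ is a (finite) chain. A simplex is the set of points whose support lies in a given chain. For a maximal chain $p_0\prec p_1\prec\cdots\prec p_N$, the corresponding maximal simplex $\sigma$ gets the metric $d_\sigma(x,y)=\|\varphi_\sigma(x)-\varphi_\sigma(y)\|_2$, where $\varphi_\sigma(\sum_{i=0}^N\lambda_ip_i)=\sum_{i=1}^N\lambda_i 1_{[i]}\in\mathbb{R}^N$ and $1_{[i]}$ is the 0/1 indicator vector of $\{1,\dots,i\}$. The distance $d$ on $K(\mathcal{N})$ is the induced length metric: the infimum of lengths of connecting paths, where path lengths are measured by summing $d_\sigma$ over subdivisions whose pieces lie in simplices. It is known that $K(\mathcal{N})$ is a complete CAT(0) space. Lovász extension: for $f:\mathcal{N}\to\mathbb{R}$, $\overline f:K(\mathcal{N})\to\mathbb{R}$ is $\overline f(\sum_i\lambda_ip_i):=\sum_i\lambda_if(p_i)$; $\overline{\dim}$ is the Lovász extension of the vector space dimension. Resolvent: for a continuous convex $f$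 on a complete CAT(0) space $K$ and $\lambda>0$, $J^f_\lambda(x)$ is the unique minimizer over $y\in K$ of $f(y)+\frac{1}{2\lambda}d(x,y)^2$. Computational conventions: a point is given by (rational) coefficients together with a chain of subspaces, each given by a matrix over $\mathbb{K}$ whose image (or kernel) is the subspace; "polynomial time" means a number of arithmetic operations and comparisons (in $\mathbb{K}$ and on coefficients) polynomial in $n$. *)

theory Defs
  imports
    "Jordan_Normal_Form.VS_Connect"
    "Jordan_Normal_Form.Matrix_Kernel"
    "HOL-Algebra.Complete_Lattice"
    "HOL-Analysis.L2_Norm"
    "HOL-Library.Extended_Real"
begin

section \<open>Lattices of subspaces\<close>

definition subspace_lattice :: "nat \<Rightarrow> 'k::field vec set gorder" where
  "subspace_lattice n =
     \<lparr> carrier = {W. VectorSpace.subspace class_ring W (module_vec TYPE('k) n)},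
       eq = (=), le = (\<subseteq>) \<rparr>"

definition subspace_lattice_rev :: "nat \<Rightarrow> 'k::field vec set gorder" where
  "subspace_lattice_rev n = inv_gorder (subspace_lattice n)"

definition subspace_dim :: "nat \<Rightarrow> 'k::field vec set \<Rightarrow> nat" where
  "subspace_dim n W = vectorspace.dim class_ring ((module_vec TYPE('k) n)\<lparr>carrier := W\<rparr>)"


section \<open>The orthoscheme complex of a lattice\<close>

text \<open>Formal convex combinations are coefficient functions on the type of lattice elements.\<close>

definition supp :: "('a \<Rightarrow> real) \<Rightarrow> 'a set" where
  "supp x = {p. x p \<noteq> 0}"

definition orthoscheme_complex :: "'a gorder \<Rightarrow> ('a \<Rightarrow> real) set" where
  "orthoscheme_complex N =
     {x. (\<forall>p. 0 \<le> x p) \<and> finite (supp x) \<and> supp x \<subseteq> carrier N \<and>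
         (\<forall>p\<in>supp x. \<forall>q\<in>supp x. p \<sqsubseteq>\<^bsub>N\<^esub> q \<or> q \<sqsubseteq>\<^bsub>N\<^esub> p) \<and>
         (\<Sum>p\<in>supp x. x p) = 1}"

definition vertex :: "'a \<Rightarrow> 'a \<Rightarrow> real" where
  "vertex p = (\<lambda>q. if q = p then 1 else 0)"

text \<open>Finite chains are given as strictly increasing lists.\<close>

definition lattice_chain :: "'a gorder \<Rightarrow> 'a list \<Rightarrow> bool" where
  "lattice_chain N ps \<longleftrightarrow> set ps \<subseteq> carrier N \<and> sorted_wrt (\<lambda>p q. p \<sqsubset>\<^bsub>N\<^esub> q) ps"

definition maximal_chain :: "'a gorder \<Rightarrow> 'a list \<Rightarrow> bool" where
  "maximal_chain N ps \<longleftrightarrow> lattice_chain N ps \<and>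
     (\<forall>qs. lattice_chain N qs \<and> set ps \<subseteq> set qs \<longrightarrow> set qs = set ps)"

definition simplex :: "'a gorder \<Rightarrow> 'a list \<Rightarrow> ('a \<Rightarrow> real) set" where
  "simplex N ps = {x \<in> orthoscheme_complex N. supp x \<subseteq> set ps}"

text \<open>For a maximal chain \<open>ps = [p\<^sub>0, \<dots>, p\<^sub>N]\<close>, \<open>chart ps x j\<close> is the \<open>j\<close>-th coordinate
  (\<open>1 \<le> j \<le> N\<close>) of the vector \<open>\<Sum>i = 1..N. x p\<^sub>i * 1\<^bsub>[i]\<^esub>\<close>.\<close>

definition chart :: "'a list \<Rightarrow> ('a \<Rightarrow> real) \<Rightarrow> nat \<Rightarrow> real" where
  "chart ps x j = (\<Sum>i = 1..length ps - 1. x (ps ! i) * of_bool (j \<in> {1..i}))"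

definition simplex_dist :: "'a list \<Rightarrow> ('a \<Rightarrow> real) \<Rightarrow> ('a \<Rightarrow> real) \<Rightarrow> real" where
  "simplex_dist ps x y = L2_set (\<lambda>j. chart ps x j - chart ps y j) {1..length ps - 1}"

text \<open>\<open>subdivides N \<gamma> m t \<sigma>\<close>: \<open>0 = t 0 < \<dots> < t m = 1\<close>, and for each \<open>i < m\<close> the map \<open>\<gamma>\<close> sends
  \<open>{t i..t (Suc i)}\<close> into the simplex of the maximal chain \<open>\<sigma> i\<close>, continuously with respect
  to the metric of that simplex.\<close>

definition subdivides ::
  "'a gorder \<Rightarrow> (real \<Rightarrow> 'a \<Rightarrow> real) \<Rightarrow> nat \<Rightarrow> (nat \<Rightarrow> real) \<Rightarrow> (nat \<Rightarrow> 'a list) \<Rightarrow> bool" where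
  "subdivides N \<gamma> m t \<sigma> \<longleftrightarrow> t 0 = 0 \<and> t m = 1 \<and>
     (\<forall>i<m. t i < t (Suc i) \<and> maximal_chain N (\<sigma> i) \<and>
        \<gamma> ` {t i..t (Suc i)} \<subseteq> simplex N (\<sigma> i) \<and>
        (\<forall>j\<in>{1..length (\<sigma> i) - 1}.
           continuous_on {t i..t (Suc i)} (\<lambda>s. chart (\<sigma> i) (\<gamma> s) j)))"

definition paths :: "'a gorder \<Rightarrow> ('a \<Rightarrow> real) \<Rightarrow> ('a \<Rightarrow> real) \<Rightarrow> (real \<Rightarrow> 'a \<Rightarrow> real) set" where
  "paths N x y = {\<gamma>. \<gamma> 0 = x \<and> \<gamma> 1 = y \<and> (\<exists>m t \<sigma>. subdivides N \<gamma> m t \<sigma>)}"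

definition path_length :: "'a gorder \<Rightarrow> (real \<Rightarrow> 'a \<Rightarrow> real) \<Rightarrow> ereal" where
  "path_length N \<gamma> =
     (SUP (m, t, \<sigma>) \<in> {(m, t, \<sigma>). subdivides N \<gamma> m t \<sigma>}.
        ereal (\<Sum>i<m. simplex_dist (\<sigma> i) (\<gamma> (t i)) (\<gamma> (t (Suc i)))))"

definition oc_dist :: "'a gorder \<Rightarrow> ('a \<Rightarrow> real) \<Rightarrow> ('a \<Rightarrow> real) \<Rightarrow> real" where
  "oc_dist N x y = real_of_ereal (INF \<gamma>\<in>paths N x y. path_length N \<gamma>)"

definition lovasz_extension :: "('a \<Rightarrow> real) \<Rightarrow> ('a \<Rightarrow> real) \<Rightarrow> real" where
  "lovasz_extension f x = (\<Sum>p\<in>supp x. x p * f p)"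


section \<open>Resolvents\<close>

definition proximal_minimizer ::
  "'a gorder \<Rightarrow> (('a \<Rightarrow> real) \<Rightarrow> real) \<Rightarrow> real \<Rightarrow> ('a \<Rightarrow> real) \<Rightarrow> ('a \<Rightarrow> real) \<Rightarrow> bool" where
  "proximal_minimizer N f \<mu> x =
     is_arg_min (\<lambda>y. f y + 1 / (2 * \<mu>) * (oc_dist N x y)\<^sup>2) (\<lambda>y. y \<in> orthoscheme_complex N)"

definition resolvent ::
  "'a gorder \<Rightarrow> (('a \<Rightarrow> real) \<Rightarrow> real) \<Rightarrow> real \<Rightarrow> ('a \<Rightarrow> real) \<Rightarrow> 'a \<Rightarrow> real" where
  "resolvent N f \<mu> x = (THE z. proximal_minimizer N f \<mu> x z)"


section \<open>Programs over a field and the coefficients\<close>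

text \<open>
  A random access machine with index registers holding natural numbers, arrays of coefficients,
  and arrays of elements of the field. An array is named by a literal and indexed by the current
  contents of registers: \<open>(a, r)\<close> denotes entry \<open>reg s r\<close> of coefficient array \<open>a\<close>, and
  \<open>(a, r\<^sub>1, r\<^sub>2, r\<^sub>3)\<close> denotes entry \<open>(reg s r\<^sub>1, reg s r\<^sub>2, reg s r\<^sub>3)\<close> of field array \<open>a\<close>. Registers
  have no multiplication, so that they cannot be used to do arithmetic on exponentially long
  numbers. Division by zero yields zero.

  The program text contains no elements of the field and is the same for all dimensions.
  Coefficients are reals, accessed only through natural number constants, field operations and
  comparisons; hence a computation on rational coefficients stays within the rationals
  (\<open>exec_Rats\<close> below).
\<close>

record 'k state =
  reg :: "nat \<Rightarrow> nat"
  cf :: "nat \<Rightarrow> nat \<Rightarrow> real"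
  fld :: "nat \<Rightarrow> nat \<Rightarrow> nat \<Rightarrow> nat \<Rightarrow> 'k"

type_synonym cf_cell = "nat \<times> nat"
type_synonym fld_cell = "nat \<times> nat \<times> nat \<times> nat"

datatype arith = Plus | Minus | Times | Divide

datatype instr =
    RConst nat nat
  | RAdd nat nat nat
  | RSub nat nat nat
  | CConst cf_cell nat
  | COp arith cf_cell cf_cell cf_cell
  | FConst fld_cell nat
  | FOp arith fld_cell fld_cell fld_cell

datatype test =
    RLess nat nat
  | CLess cf_cell cf_cell
  | FEq fld_cell fld_cell

datatype program =
    Skip
  | Do instr
  | Seq program program
  | Branch test program program
  | While test program

fun arith_op :: "arith \<Rightarrow> 'a::field \<Rightarrow> 'a \<Rightarrow> 'a" where
  "arith_op Plus x y = x + y"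
| "arith_op Minus x y = x - y"
| "arith_op Times x y = x * y"
| "arith_op Divide x y = x / y"

fun get_cf :: "'k state \<Rightarrow> cf_cell \<Rightarrow> real" where
  "get_cf s (a, r) = cf s a (reg s r)"

fun put_cf :: "cf_cell \<Rightarrow> real \<Rightarrow> 'k state \<Rightarrow> 'k state" where
  "put_cf (a, r) v s = s\<lparr>cf := (cf s)(a := (cf s a)(reg s r := v))\<rparr>"

fun get_fld :: "'k state \<Rightarrow> fld_cell \<Rightarrow> 'k" where
  "get_fld s (a, r1, r2, r3) = fld s a (reg s r1) (reg s r2) (reg s r3)"

fun put_fld :: "fld_cell \<Rightarrow> 'k \<Rightarrow> 'k state \<Rightarrow> 'k state" where
  "put_fld (a, r1, r2, r3) v s =
     s\<lparr>fld := (\<lambda>b i j k. if (b, i, j, k) = (a, reg s r1, reg s r2, reg s r3) then v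
                          else fld s b i j k)\<rparr>"

fun step :: "instr \<Rightarrow> 'k::field state \<Rightarrow> 'k state" where
  "step (RConst r c) s = s\<lparr>reg := (reg s)(r := c)\<rparr>"
| "step (RAdd r r1 r2) s = s\<lparr>reg := (reg s)(r := reg s r1 + reg s r2)\<rparr>"
| "step (RSub r r1 r2) s = s\<lparr>reg := (reg s)(r := reg s r1 - reg s r2)\<rparr>"
| "step (CConst c m) s = put_cf c (of_nat m) s"
| "step (COp f c c1 c2) s = put_cf c (arith_op f (get_cf s c1) (get_cf s c2)) s"
| "step (FConst c m) s = put_fld c (of_nat m) s"
| "step (FOp f c c1 c2) s = put_fld c (arith_op f (get_fld s c1) (get_fld s c2)) s"

fun holds :: "test \<Rightarrow> 'k state \<Rightarrow> bool" where
  "holds (RLess r1 r2) s \<longleftrightarrow> reg s r1 < reg s r2"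
| "holds (CLess c1 c2) s \<longleftrightarrow> get_cf s c1 < get_cf s c2"
| "holds (FEq c1 c2) s \<longleftrightarrow> get_fld s c1 = get_fld s c2"

text \<open>\<open>exec P s t s'\<close>: program \<open>P\<close>, started in state \<open>s\<close>, halts in state \<open>s'\<close> after executing
  \<open>t\<close> instructions and tests in total (those on registers included).\<close>

inductive exec :: "program \<Rightarrow> 'k::field state \<Rightarrow> nat \<Rightarrow> 'k state \<Rightarrow> bool" where
  exec_Skip: "exec Skip s 0 s"
| exec_Do: "exec (Do i) s 1 (step i s)"
| exec_Seq: "exec P s t s' \<Longrightarrow> exec Q s' u s'' \<Longrightarrow> exec (Seq P Q) s (t + u) s''"
| exec_BranchTrue: "holds b s \<Longrightarrow> exec P s t s' \<Longrightarrow> exec (Branch b P Q) s (1 + t) s'"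
| exec_BranchFalse: "\<not> holds b s \<Longrightarrow> exec Q s t s' \<Longrightarrow> exec (Branch b P Q) s (1 + t) s'"
| exec_WhileFalse: "\<not> holds b s \<Longrightarrow> exec (While b P) s 1 s"
| exec_WhileTrue: "holds b s \<Longrightarrow> exec P s t s' \<Longrightarrow> exec (While b P) s' u s'' \<Longrightarrow>
    exec (While b P) s (1 + t + u) s''"

lemma exec_deterministic:
  "exec P s t s' \<Longrightarrow> exec P s u s'' \<Longrightarrow> u = t \<and> s'' = s'"
proof (induction arbitrary: u s'' rule: exec.induct)
  case (exec_Seq P s t s' Q v r)
  from exec_Seq.prems show ?case
    by cases (use exec_Seq.IH in blast)
next
  case (exec_WhileTrue b s P t s' v r)
  from exec_WhileTrue.prems show ?case
    by cases (use exec_WhileTrue in blast)+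
qed (erule exec.cases; fastforce)+

lemma exec_Rats:
  "exec P s t s' \<Longrightarrow> (\<forall>a i. cf s a i \<in> \<rat>) \<Longrightarrow> cf s' a i \<in> \<rat>"
proof (induction arbitrary: a i rule: exec.induct)
  case (exec_Do j s)
  have "arith_op f x y \<in> \<rat>" if "x \<in> \<rat>" "y \<in> \<rat>" for f and x y :: real
    using that by (cases f) auto
  moreover have "cf (put_fld c v s) = cf s" for c v
    by (cases c) simp
  ultimately show ?case
    using exec_Do by (cases j) auto
qed auto


section \<open>Representation of points and the computational problem\<close>

datatype representation = Image | Kernel

fun represented_subspace :: "representation \<Rightarrow> 'k::field mat \<Rightarrow> 'k vec set" where
  "represented_subspace Image A = (\<lambda>v. A *\<^sub>v v) ` carrier_vec (dim_col A)"
| "represented_subspace Kernel A = mat_kernel A"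

definition stored_chain :: "representation \<Rightarrow> 'k::field state \<Rightarrow> 'k vec set list" where
  "stored_chain rep s =
     map (\<lambda>i. represented_subspace rep (mat (reg s 0) (reg s 0) (\<lambda>(j, k). fld s 0 i j k)))
       [0..<reg s 1]"

text \<open>Register 0 holds the dimension \<open>n\<close>, register 1 the length of the chain; the \<open>i\<close>-th
  coefficient is entry \<open>i\<close> of coefficient array 0 and the \<open>i\<close>-th \<open>n \<times> n\<close> matrix is the slice
  \<open>i\<close> of field array 0. The chain is strictly increasing in the order of the lattice; zero
  coefficients are allowed. All other memory is unconstrained.\<close>

definition stores_point ::
  "representation \<Rightarrow> nat \<Rightarrow> 'k::field vec set gorder \<Rightarrow> 'k state \<Rightarrow> ('k vec set \<Rightarrow> real) \<Rightarrow> bool" where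
  "stores_point rep n N s x \<longleftrightarrow> reg s 0 = n \<and> lattice_chain N (stored_chain rep s) \<and>
     x = (\<lambda>p. \<Sum>i<reg s 1. cf s 0 i * vertex (stored_chain rep s ! i) p)"

text \<open>The parameter \<open>\<mu>\<close> of the resolvent is passed in entry 0 of coefficient array 1. The output
  overwrites the input. A single program and a single polynomial serve all dimensions.\<close>

definition resolvent_in_polynomial_time ::
  "representation \<Rightarrow> (nat \<Rightarrow> 'k::field vec set gorder) \<Rightarrow> (nat \<Rightarrow> ('k vec set \<Rightarrow> real) \<Rightarrow> real) \<Rightarrow> bool"
where
  "resolvent_in_polynomial_time rep N f \<longleftrightarrow>
     (\<exists>P :: program. \<exists>q :: nat poly. \<forall>n\<ge>1. \<forall>x\<in>orthoscheme_complex (N n). \<forall>\<mu>>0.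
        (\<exists>!z. proximal_minimizer (N n) (f n) \<mu> x z) \<and>
        (\<forall>s. stores_point rep n (N n) s x \<and> cf s 1 0 = \<mu> \<longrightarrow>
           (\<exists>t s'. exec P s t s' \<and> t \<le> poly q n \<and>
              stores_point rep n (N n) s' (resolvent (N n) (f n) \<mu> x))))"

end

(*
  For a point x and an index j let x_j be the total weight of x on elements of rank at least j; in
  every maximal simplex these are the chart coordinates. Hence x -> (x_1, ..., x_n) does not increase
  distances and is isometric on each simplex. More generally, fix an element Q and replace the rank
  of p by the pair (rk (p meet Q), rk p - rk (p meet Q)). By modularity exactly one component grows at
  each step of a maximal chain, so these coordinates are again isometric on simplices and bound the
  distance from below, and comparing Gram matrices (min(a,a') + min(b,b') <= min(a+b,a'+b')) this
  bound is strictly better than the first one if Q carries weight in x, and y charges another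
  element of the same rank.

  The objective is, up to a constant, separable in the coordinates of the argument, apart from
  d(x,y)^2. Replacing this distance by its coordinate bound and minimizing coordinatewise gives
  h(x_j) for a monotone function h (an affine function clamped to [0,1]). By monotonicity these
  numbers are the coordinates of a point supported on the chain of x, bottom and top, where the
  bound is attained; the strict bound gives uniqueness. In both lattices the only element that can
  be new with nonzero weight is K^n. So the algorithm consists of computing h at the tail sums of
  the coefficients, and of testing by elimination whether K^n is already in the chain.
*)
theory Submission
  imports Defs
begin

section \<open>Coordinates and distance bounds\<close>

text \<open>Off a common simplex the distance is only an infimum over paths; the proof works with
  its exact value for points on a common chain and with lower bounds otherwise. Strictness of the
  bound is essential: rank coordinates do not tell apart two elements of equal rank, so optimal
  coordinates alone would leave the minimizer ambiguous. That one function h serves all coordinates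
  shapes the algorithm: the values x_j are tail sums of the stored coefficients, so no dimensions of
  stored subspaces enter. The bottom receives the weight 1 - h(1) and the top h(0). Under inclusion
  the dimension term pushes coordinates up with slope 1, while the quadratic term pulls back with
  slope at most 1/(4n) on [0,1]; hence h(1) = 1. Under reverse inclusion the dimension is n minus
  the rank, both terms push down, and h(0) = 0. So {0} gains nothing from being an end, and the end
  that remains is K^n in both cases.\<close>

lemma sum_of_bool_le_min:
  fixes a b n :: nat
  assumes "a \<le> n"
  shows "(\<Sum>j = 1..n. of_bool (j \<le> a) * of_bool (j \<le> b)) = real (min a b)"
proof -
  have "(\<Sum>j = 1..n. of_bool (j \<le> a) * of_bool (j \<le> b)) = (\<Sum>j = 1..n. of_bool (j \<in> {1..min a b}) :: real)"
    by (rule sum.cong) auto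
  also have "\<dots> = real (card ({1..n} \<inter> {j. j \<in> {1..min a b}}))"
    by (simp only: sum_of_bool_eq finite_atLeastAtMost)
  also have "{1..n} \<inter> {j. j \<in> {1..min a b}} = {1..min a b}"
    using assms by auto
  finally show ?thesis
    by simp
qed

text \<open>\<open>coord f x j\<close> is the mass of \<open>x\<close> on the elements of \<open>f\<close>-value at least \<open>j\<close>; for the rank function
  and \<open>1 \<le> j \<le> n\<close> these are the chart coordinates.\<close>

definition coord :: "('a \<Rightarrow> nat) \<Rightarrow> ('a \<Rightarrow> real) \<Rightarrow> nat \<Rightarrow> real" where
  "coord f x j = (\<Sum>p\<in>supp x. x p * of_bool (j \<le> f p))"

definition gram :: "nat \<Rightarrow> ('a \<Rightarrow> nat) \<Rightarrow> ('a \<Rightarrow> real) \<Rightarrow> ('a \<Rightarrow> real) \<Rightarrow> real" where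
  "gram n f x y = (\<Sum>j = 1..n. coord f x j * coord f y j)"

lemma coord_superset:
  assumes "finite S" "supp x \<subseteq> S"
  shows "coord f x j = (\<Sum>p\<in>S. x p * of_bool (j \<le> f p))"
  unfolding coord_def
  by (rule sum.mono_neutral_left) (use assms in \<open>auto simp: supp_def\<close>)

text \<open>The indicator vectors of {1..a} and {1..b} have inner product min a b. In this form the
  Gram terms of different functions \<open>f\<close> can be compared pair by pair.\<close>

lemma gram_eq:
  assumes "finite (supp x)" "finite (supp y)" "\<And>p. p \<in> supp x \<Longrightarrow> f p \<le> n"
  shows "gram n f x y = (\<Sum>p\<in>supp x. \<Sum>q\<in>supp y. x p * y q * real (min (f p) (f q)))"
proof -
  have "gram n f x y = (\<Sum>j = 1..n. \<Sum>p\<in>supp x. \<Sum>q\<in>supp y.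
      x p * y q * (of_bool (j \<le> f p) * of_bool (j \<le> f q)))"
    unfolding gram_def coord_def sum_product by (simp add: algebra_simps)
  also have "\<dots> = (\<Sum>p\<in>supp x. \<Sum>q\<in>supp y. \<Sum>j = 1..n.
      x p * y q * (of_bool (j \<le> f p) * of_bool (j \<le> f q)))"
    by (subst sum.swap, intro sum.cong refl, rule sum.swap)
  also have "\<dots> = (\<Sum>p\<in>supp x. \<Sum>q\<in>supp y. x p * y q * real (min (f p) (f q)))"
    by (intro sum.cong refl) (simp only: sum_distrib_left [symmetric] sum_of_bool_le_min assms)
  finally show ?thesis .
qed

text \<open>Two coordinate vectors side by side, indexed by a disjoint sum, so that the triangle
  inequality for \<open>L2_set\<close> applies to the pair at once.\<close>

definition split_coord :: "('a \<Rightarrow> nat) \<Rightarrow> ('a \<Rightarrow> nat) \<Rightarrow> ('a \<Rightarrow> real) \<Rightarrow> nat + nat \<Rightarrow> real" where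
  "split_coord f g x = case_sum (coord f x) (coord g x)"

definition split_dist :: "nat \<Rightarrow> ('a \<Rightarrow> nat) \<Rightarrow> ('a \<Rightarrow> nat) \<Rightarrow> ('a \<Rightarrow> real) \<Rightarrow> ('a \<Rightarrow> real) \<Rightarrow> real" where
  "split_dist n f g x y =
     L2_set (\<lambda>i. split_coord f g x i - split_coord f g y i) ({1..n} <+> {1..n})"

definition coord_dist :: "nat \<Rightarrow> ('a \<Rightarrow> nat) \<Rightarrow> ('a \<Rightarrow> real) \<Rightarrow> ('a \<Rightarrow> real) \<Rightarrow> real" where
  "coord_dist n f x y = L2_set (\<lambda>j. coord f x j - coord f y j) {1..n}"

lemma coord_dist_square:
  "(coord_dist n f x y)\<^sup>2 = gram n f x x - 2 * gram n f x y + gram n f y y"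
proof -
  have "(coord_dist n f x y)\<^sup>2 = (\<Sum>j = 1..n. (coord f x j - coord f y j)\<^sup>2)"
    unfolding coord_dist_def L2_set_def by (simp add: sum_nonneg)
  also have "\<dots> = (\<Sum>j = 1..n. coord f x j * coord f x j - 2 * (coord f x j * coord f y j)
      + coord f y j * coord f y j)"
    by (intro sum.cong refl) (simp add: power2_eq_square algebra_simps)
  finally show ?thesis
    by (simp add: gram_def sum.distrib sum_subtractf sum_distrib_left)
qed

lemma coord_dist_nonneg: "0 \<le> coord_dist n f x y"
  by (simp add: coord_dist_def)

lemma split_dist_nonneg: "0 \<le> split_dist n f g x y"
  by (simp add: split_dist_def)

lemma split_dist_square:
  "(split_dist n f g x y)\<^sup>2 = (coord_dist n f x y)\<^sup>2 + (coord_dist n g x y)\<^sup>2"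
  unfolding split_dist_def coord_dist_def L2_set_def
  by (simp add: sum_nonneg sum.Plus split_coord_def)

lemma split_dist_triangle: "split_dist n f g x z \<le> split_dist n f g x y + split_dist n f g y z"
  using L2_set_triangle_ineq [of "\<lambda>i. split_coord f g x i - split_coord f g y i"
      "\<lambda>i. split_coord f g y i - split_coord f g z i" "{1..n} <+> {1..n}"]
  by (simp add: split_dist_def)

lemma coord_lin:
  assumes "finite S" "supp x \<subseteq> S" "supp y \<subseteq> S" "supp w \<subseteq> S" "\<And>p. w p = a * x p + b * y p"
  shows "coord f w j = a * coord f x j + b * coord f y j"
  unfolding coord_superset [OF assms(1,2)] coord_superset [OF assms(1,3)] coord_superset [OF assms(1,4)]
  by (simp add: assms(5) sum_distrib_left sum.distrib algebra_simps)

text \<open>An abstraction of a modular lattice of rank \<open>n\<close> that serves both orders on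
  subspaces: \<open>mr Q p\<close> plays the rank of the meet of p and Q, without mentioning meets.
  Modularity is condensed in \<open>mr_diff_mono\<close>; \<open>mr_less\<close> says that distinct
  elements of equal rank have a meet of smaller rank, which is the source of strictness.\<close>

locale ranked_order =
  fixes N :: "'a gorder" (structure) and n :: nat and rk :: "'a \<Rightarrow> nat" and mr :: "'a \<Rightarrow> 'a \<Rightarrow> nat"
    and bt tp :: 'a
  assumes le_refl: "p \<in> carrier N \<Longrightarrow> p \<sqsubseteq> p"
    and le_trans: "\<lbrakk>p \<in> carrier N; q \<in> carrier N; r \<in> carrier N; p \<sqsubseteq> q; q \<sqsubseteq> r\<rbrakk> \<Longrightarrow> p \<sqsubseteq> r"
    and eq_iff: "p .= q \<longleftrightarrow> p = q"
    and rk_mono: "\<lbrakk>p \<in> carrier N; q \<in> carrier N; p \<sqsubseteq> q\<rbrakk> \<Longrightarrow> rk p \<le> rk q"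
    and rk_eq: "\<lbrakk>p \<in> carrier N; q \<in> carrier N; p \<sqsubseteq> q; rk p = rk q\<rbrakk> \<Longrightarrow> p = q"
    and bt: "bt \<in> carrier N" "rk bt = 0" "\<And>p. p \<in> carrier N \<Longrightarrow> bt \<sqsubseteq> p"
    and tp: "tp \<in> carrier N" "rk tp = n" "\<And>p. p \<in> carrier N \<Longrightarrow> p \<sqsubseteq> tp"
    and between: "\<lbrakk>p \<in> carrier N; q \<in> carrier N; p \<sqsubseteq> q; rk p < rk q\<rbrakk> \<Longrightarrow>
      \<exists>r\<in>carrier N. p \<sqsubseteq> r \<and> r \<sqsubseteq> q \<and> rk r = Suc (rk p)"
    and mr_le: "\<lbrakk>Q \<in> carrier N; p \<in> carrier N\<rbrakk> \<Longrightarrow> mr Q p \<le> rk p"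
    and mr_mono: "\<lbrakk>Q \<in> carrier N; p \<in> carrier N; q \<in> carrier N; p \<sqsubseteq> q\<rbrakk> \<Longrightarrow> mr Q p \<le> mr Q q"
    and mr_diff_mono: "\<lbrakk>Q \<in> carrier N; p \<in> carrier N; q \<in> carrier N; p \<sqsubseteq> q\<rbrakk> \<Longrightarrow>
      rk p - mr Q p \<le> rk q - mr Q q"
    and mr_self: "Q \<in> carrier N \<Longrightarrow> mr Q Q = rk Q"
    and mr_less: "\<lbrakk>Q \<in> carrier N; p \<in> carrier N; rk p = rk Q; p \<noteq> Q\<rbrakk> \<Longrightarrow> mr Q p < rk Q"
begin

abbreviation "K \<equiv> orthoscheme_complex N"

lemma rk_le: "p \<in> carrier N \<Longrightarrow> rk p \<le> n"
  using rk_mono tp by metis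

lemma le_antisym: "\<lbrakk>p \<in> carrier N; q \<in> carrier N; p \<sqsubseteq> q; q \<sqsubseteq> p\<rbrakk> \<Longrightarrow> p = q"
  by (meson rk_eq rk_mono le_antisym)

lemma lless_iff: "p \<sqsubset> q \<longleftrightarrow> p \<sqsubseteq> q \<and> p \<noteq> q"
  by (simp add: lless_def eq_iff)

section \<open>Chains and maximal chains in a ranked order\<close>

definition is_chain :: "'a set \<Rightarrow> bool" where
  "is_chain S \<longleftrightarrow> S \<subseteq> carrier N \<and> (\<forall>p\<in>S. \<forall>q\<in>S. p \<sqsubseteq> q \<or> q \<sqsubseteq> p)"

lemma is_chain_subset: "is_chain S \<Longrightarrow> T \<subseteq> S \<Longrightarrow> is_chain T"
  by (auto simp: is_chain_def)

lemma is_chain_le: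
  assumes "is_chain S" "p \<in> S" "q \<in> S" "rk p \<le> rk q"
  shows "p \<sqsubseteq> q"
  using assms unfolding is_chain_def
  by (metis in_mono le_refl rk_eq rk_mono verit_la_disequality)

lemma is_chain_inj: "is_chain S \<Longrightarrow> inj_on rk S"
  unfolding is_chain_def inj_on_def by (metis in_mono rk_eq)

lemma is_chain_finite:
  assumes "is_chain S"
  shows "finite S" "card S \<le> Suc n"
proof -
  have "rk ` S \<subseteq> {..n}"
    using assms rk_le by (auto simp: is_chain_def)
  with is_chain_inj [OF assms] show "finite S" "card S \<le> Suc n"
    by (meson finite_atMost inj_on_finite)
      (metis \<open>rk ` S \<subseteq> {..n}\<close> is_chain_inj [OF assms] card_atMost card_image card_mono finite_atMost)
qed

lemma lattice_chain_set:
  assumes "lattice_chain N ps"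
  shows "is_chain (set ps)" "distinct ps" "sorted_wrt (\<lambda>p q. rk p < rk q) ps"
proof -
  have ps: "set ps \<subseteq> carrier N" "sorted_wrt (\<lambda>p q. p \<sqsubset> q) ps"
    using assms by (auto simp: lattice_chain_def)
  show srt: "sorted_wrt (\<lambda>p q. rk p < rk q) ps"
    by (rule sorted_wrt_mono_rel [OF _ ps(2)])
      (metis lless_iff nat_less_le ps(1) rk_eq rk_mono subsetD)
  then show "distinct ps"
    by (auto simp: distinct_conv_nth sorted_wrt_iff_nth_less)
      (metis less_irrefl_nat linorder_neqE_nat)
  have "p \<sqsubseteq> q \<or> q \<sqsubseteq> p" if "p \<in> set ps" "q \<in> set ps" for p q
  proof -
    from that obtain i j where ij: "i < length ps" "j < length ps" "p = ps ! i" "q = ps ! j"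
      by (auto simp: in_set_conv_nth)
    show ?thesis
      using ps ij that le_refl unfolding sorted_wrt_iff_nth_less lless_iff
      by (metis linorder_neqE_nat subsetD)
  qed
  with ps show "is_chain (set ps)"
    by (auto simp: is_chain_def)
qed

text \<open>The rank is injective on a chain, so sorting the ranks and inverting the rank function
  enumerates the chain in increasing order.\<close>

lemma obtain_list:
  assumes "is_chain S"
  obtains ps where "lattice_chain N ps" "set ps = S"
proof -
  let ?ps = "map (inv_into S rk) (sorted_list_of_set (rk ` S))"
  have fin: "finite (rk ` S)" and inj: "inj_on rk S"
    by (rule finite_imageI, rule is_chain_finite [OF assms], rule is_chain_inj [OF assms])
  have st: "set ?ps = S"
    using fin inj by (simp add: inv_into_image_cancel)
  have "map rk ?ps = sorted_list_of_set (rk ` S)"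
    unfolding map_map by (rule map_idI) (use fin in \<open>simp add: f_inv_into_f\<close>)
  then have "sorted_wrt (<) (map rk ?ps)"
    by (metis strict_sorted_list_of_set)
  then have srt: "sorted_wrt (\<lambda>p q. rk p < rk q) ?ps"
    by (simp only: sorted_wrt_map)
  have "sorted_wrt (\<lambda>p q. p \<sqsubset> q) ?ps"
    by (rule sorted_wrt_mono_rel [OF _ srt]) (use assms st is_chain_le in \<open>fastforce simp: lless_iff\<close>)
  with st assms have "lattice_chain N ?ps"
    by (simp add: lattice_chain_def is_chain_def)
  with st that show ?thesis
    by blast
qed

text \<open>Chains have at most n + 1 elements, so among those containing \<open>S\<close> there is
  one of greatest cardinality.\<close>

lemma obtain_maximal_chain:
  assumes "is_chain S"
  obtains ps where "maximal_chain N ps" "S \<subseteq> set ps"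
proof -
  define P where "P T \<longleftrightarrow> is_chain T \<and> S \<subseteq> T" for T
  have "P S" "\<And>T. P T \<Longrightarrow> card T < Suc (Suc n)"
    using assms is_chain_finite(2) by (auto simp: P_def less_Suc_eq_le)
  from ex_has_greatest_nat [of P S card "Suc (Suc n)"] this
  obtain T where T: "P T" "\<And>U. P U \<Longrightarrow> card U \<le> card T"
    by (metis less_imp_le)
  obtain ps where ps: "lattice_chain N ps" "set ps = T"
    using T(1) obtain_list P_def by metis
  have "maximal_chain N ps"
    unfolding maximal_chain_def
  proof (intro conjI allI impI ps(1))
    fix qs assume qs: "lattice_chain N qs \<and> set ps \<subseteq> set qs"
    then have "P (set qs)"
      using T(1) ps lattice_chain_set(1) by (auto simp: P_def)
    with T(2) qs ps show "set qs = set ps"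
      by (metis List.finite_set card_seteq)
  qed
  with ps T that show ?thesis
    by (auto simp: P_def)
qed

lemma maximal_chain_maximal:
  assumes "maximal_chain N ps" "is_chain (insert r (set ps))"
  shows "r \<in> set ps"
  using assms obtain_list [OF assms(2)] unfolding maximal_chain_def by (metis insertCI subset_insertI)

text \<open>No rank is skipped: if q is the next chain element above p, \<open>between\<close> gives
  r of rank \<open>Suc (rk p)\<close> with p below r below q. Everything in the chain lies above q
  or below p, hence is comparable to r, and maximality puts r into the chain.\<close>

lemma maximal_chain_rk:
  assumes "maximal_chain N ps"
  shows "map rk ps = [0..<Suc n]"
proof -
  have ch: "is_chain (set ps)" and srt: "sorted_wrt (\<lambda>p q. rk p < rk q) ps"
    using assms lattice_chain_set by (auto simp: maximal_chain_def)
  have sub: "set ps \<subseteq> carrier N"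
    using ch by (simp add: is_chain_def)
  have bt_in: "bt \<in> set ps"
    by (rule maximal_chain_maximal [OF assms]) (use ch bt le_refl in \<open>auto simp: is_chain_def\<close>)
  have tp_in: "tp \<in> set ps"
    by (rule maximal_chain_maximal [OF assms]) (use ch tp le_refl in \<open>auto simp: is_chain_def\<close>)
  have "\<exists>p\<in>set ps. rk p = i" if "i \<le> n" for i
    using that
  proof (induction i)
    case 0
    then show ?case
      using bt_in bt by auto
  next
    case (Suc i)
    then obtain p where p: "p \<in> set ps" "rk p = i"
      by auto
    have "\<exists>q. (q \<in> set ps \<and> i < rk q) \<and> (\<forall>r. r \<in> set ps \<and> i < rk r \<longrightarrow> rk q \<le> rk r)"
      by (rule ex_has_least_nat [of _ tp]) (use tp_in tp Suc in auto)
    then obtain q where q: "q \<in> set ps" "i < rk q" "\<And>r. r \<in> set ps \<Longrightarrow> i < rk r \<Longrightarrow> rk q \<le> rk r"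
      by blast
    have pq: "p \<sqsubseteq> q"
      using is_chain_le [OF ch p(1) q(1)] p q by simp
    obtain r where r: "r \<in> carrier N" "p \<sqsubseteq> r" "r \<sqsubseteq> q" "rk r = Suc i"
      using between [of p q] p q pq subsetD [OF sub] by blast
    have "r \<sqsubseteq> s \<or> s \<sqsubseteq> r" if "s \<in> set ps" for s
    proof (cases "i < rk s")
      case True
      then have "q \<sqsubseteq> s"
        using is_chain_le [OF ch q(1) that] q(3) that by simp
      then show ?thesis
        using le_trans r q that sub by blast
    next
      case False
      then have "s \<sqsubseteq> p"
        using is_chain_le [OF ch that p(1)] p by simp
      then show ?thesis
        using le_trans r p that sub by blast
    qed
    then have "is_chain (insert r (set ps))"
      using ch r le_refl by (auto simp: is_chain_def)
    then have "r \<in> set ps"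
      by (rule maximal_chain_maximal [OF assms])
    with r show ?case
      by auto
  qed
  then have "{..n} \<subseteq> rk ` set ps"
    by blast
  moreover have "rk ` set ps \<subseteq> {..n}"
    using sub by (intro image_subsetI) (simp add: rk_le subsetD)
  ultimately have "set (map rk ps) = set [0..<Suc n]"
    by (simp only: set_map set_upt atLeast0LessThan lessThan_Suc_atMost)
  moreover have "sorted_wrt (<) (map rk ps)" "sorted_wrt (<) [0..<Suc n]"
    using srt by (auto simp: sorted_wrt_map simp del: upt_Suc)
  ultimately show ?thesis
    using strict_sorted_equal by blast
qed

section \<open>Points of the complex and their chart coordinates\<close>

lemma K_D:
  assumes "x \<in> K"
  shows "0 \<le> x p" "finite (supp x)" "is_chain (supp x)" "supp x \<subseteq> carrier N" "(\<Sum>p\<in>supp x. x p) = 1"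
  using assms by (auto simp: orthoscheme_complex_def is_chain_def)

lemma K_I:
  assumes "\<And>p. 0 \<le> x p" "is_chain S" "supp x \<subseteq> S" "(\<Sum>p\<in>S. x p) = 1"
  shows "x \<in> K"
proof -
  have "(\<Sum>p\<in>supp x. x p) = (\<Sum>p\<in>S. x p)"
    by (rule sum.mono_neutral_left) (use assms is_chain_finite in \<open>auto simp: supp_def\<close>)
  moreover have "is_chain (supp x)"
    using assms is_chain_subset by blast
  ultimately show ?thesis
    using assms is_chain_finite by (auto simp: orthoscheme_complex_def is_chain_def)
qed

text \<open>Position i in a maximal chain has rank i. The chart omits position 0, which contributes
  nothing to \<open>coord\<close> because j is at least 1.\<close>

lemma chart_eq_coord:
  assumes "maximal_chain N ps" "x \<in> simplex N ps" "j \<in> {1..n}"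
  shows "chart ps x j = coord rk x j"
proof -
  have len: "length ps = Suc n" and rk: "\<And>i. i \<le> n \<Longrightarrow> rk (ps ! i) = i"
  proof -
    show "length ps = Suc n"
      using arg_cong [OF maximal_chain_rk [OF assms(1)], of length] by simp
    fix i assume "i \<le> n"
    with \<open>length ps = Suc n\<close> arg_cong [OF maximal_chain_rk [OF assms(1)], of "\<lambda>l. l ! i"]
    show "rk (ps ! i) = i"
      by (simp del: upt_Suc)
  qed
  have "distinct ps"
    using assms lattice_chain_set by (auto simp: maximal_chain_def)
  have "coord rk x j = (\<Sum>p\<in>set ps. x p * of_bool (j \<le> rk p))"
    by (rule coord_superset) (use assms in \<open>auto simp: simplex_def\<close>)
  also have "\<dots> = (\<Sum>i<Suc n. x (ps ! i) * of_bool (j \<le> rk (ps ! i)))"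
    by (rule sum.reindex_bij_betw [symmetric, OF bij_betw_nth]) (use \<open>distinct ps\<close> len in auto)
  also have "\<dots> = (\<Sum>i = 1..n. x (ps ! i) * of_bool (j \<le> rk (ps ! i)))"
    by (rule sum.mono_neutral_right) (use assms rk in \<open>auto simp: less_Suc_eq_le\<close>)
  also have "\<dots> = chart ps x j"
    unfolding chart_def len using assms rk by (intro sum.cong) auto
  finally show ?thesis ..
qed

lemma simplex_dist_eq:
  assumes "maximal_chain N ps" "x \<in> simplex N ps" "y \<in> simplex N ps"
  shows "simplex_dist ps x y = coord_dist n rk x y"
proof -
  have "length ps - 1 = n"
    using arg_cong [OF maximal_chain_rk [OF assms(1)], of length] by simp
  then show ?thesis
    unfolding simplex_dist_def coord_dist_def using assms
    by (auto intro!: L2_set_cong simp: chart_eq_coord)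
qed

section \<open>Splittings of the rank and the Gram comparison\<close>

definition rank_splitting :: "('a \<Rightarrow> nat) \<Rightarrow> ('a \<Rightarrow> nat) \<Rightarrow> bool" where
  "rank_splitting f g \<longleftrightarrow> (\<forall>p\<in>carrier N. f p + g p = rk p) \<and>
     (\<forall>p\<in>carrier N. \<forall>q\<in>carrier N. p \<sqsubseteq> q \<longrightarrow> f p \<le> f q \<and> g p \<le> g q)"

lemma rank_splitting_mr: "Q \<in> carrier N \<Longrightarrow> rank_splitting (mr Q) (\<lambda>p. rk p - mr Q p)"
  by (simp add: rank_splitting_def mr_le mr_mono mr_diff_mono)

text \<open>The trivial splitting makes the plain rank bound an instance of the split one, so the
  argument along paths is carried out only once.\<close>

lemma rank_splitting_rk: "rank_splitting rk (\<lambda>_. 0)"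
  by (simp add: rank_splitting_def rk_mono)

lemma rank_splitting_le:
  assumes "rank_splitting f g" "p \<in> carrier N"
  shows "f p \<le> n" "g p \<le> n"
  using assms rk_le [of p] unfolding rank_splitting_def by (metis add_leD1 add_leD2)+

lemma gram_K:
  assumes "x \<in> K" "y \<in> K" "\<And>p. p \<in> carrier N \<Longrightarrow> f p \<le> n"
  shows "gram n f x y = (\<Sum>p\<in>supp x. \<Sum>q\<in>supp y. x p * y q * real (min (f p) (f q)))"
  using K_D(2) [OF assms(1)] K_D(2) [OF assms(2)]
  by (rule gram_eq) (use K_D(4) [OF assms(1)] assms(3) in blast)

lemma gram_rk:
  assumes "x \<in> K" "y \<in> K"
  shows "gram n rk x y = (\<Sum>p\<in>supp x. \<Sum>q\<in>supp y. x p * y q * real (min (rk p) (rk q)))"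
  by (rule gram_K [OF assms]) (rule rk_le)

lemma gram_split:
  assumes "rank_splitting f g" "x \<in> K" "y \<in> K"
  shows "gram n f x y + gram n g x y = (\<Sum>p\<in>supp x. \<Sum>q\<in>supp y.
    x p * y q * real (min (f p) (f q)) + x p * y q * real (min (g p) (g q)))"
  by (simp only: gram_K [OF assms(2,3) rank_splitting_le(1) [OF assms(1)]]
      gram_K [OF assms(2,3) rank_splitting_le(2) [OF assms(1)]] sum.distrib)

lemma gram_split_less:
  assumes "x \<in> K" "y \<in> K" "Q \<in> supp x" "p \<in> supp y" "rk p = rk Q" "p \<noteq> Q"
  shows "gram n (mr Q) x y + gram n (\<lambda>p. rk p - mr Q p) x y < gram n rk x y"
proof -
  note x = K_D [OF assms(1)] and y = K_D [OF assms(2)]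
  have Qc: "Q \<in> carrier N" and pc: "p \<in> carrier N"
    using assms x y by auto
  define f where "f = mr Q"
  define g where "g = (\<lambda>p. rk p - mr Q p)"
  have split: "rank_splitting f g"
    unfolding f_def g_def by (rule rank_splitting_mr [OF Qc])
  define F where "F p q = x p * y q * real (min (f p) (f q)) + x p * y q * real (min (g p) (g q))" for p q
  define G where "G p q = x p * y q * real (min (rk p) (rk q))" for p q
  have le: "F p q \<le> G p q" if "p \<in> supp x" "q \<in> supp y" for p q
  proof -
    have "f p + g p = rk p" "f q + g q = rk q"
      using split that x y by (auto simp: rank_splitting_def)
    then have "min (f p) (f q) + min (g p) (g q) \<le> min (rk p) (rk q)"
      by linarith
    then have "real (min (f p) (f q)) + real (min (g p) (g q)) \<le> real (min (rk p) (rk q))"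
      by linarith
    then show ?thesis
      unfolding F_def G_def
      using mult_left_mono [of _ _ "x p * y q"] x(1) y(1) by (metis distrib_left mult_nonneg_nonneg)
  qed
  have less: "F Q p < G Q p"
  proof -
    \<comment> \<open>Since \<open>f Q = rk Q\<close> and \<open>g Q = 0\<close>, the left side is
      just \<open>mr Q p\<close>, which \<open>mr_less\<close> puts below the common rank.\<close>
    have "min (f Q) (f p) + min (g Q) (g p) < min (rk Q) (rk p)"
      using mr_self [OF Qc] mr_less [OF Qc pc assms(5,6)] assms(5) by (simp add: f_def g_def)
    then have "real (min (f Q) (f p)) + real (min (g Q) (g p)) < real (min (rk Q) (rk p))"
      by linarith
    moreover have "0 < x Q * y p"
      using assms x(1) [of Q] y(1) [of p] by (simp add: supp_def order_less_le)
    ultimately show ?thesis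
      unfolding F_def G_def by (metis distrib_left mult_strict_left_mono)
  qed
  have "(\<Sum>p\<in>supp x. \<Sum>q\<in>supp y. F p q) < (\<Sum>p\<in>supp x. \<Sum>q\<in>supp y. G p q)"
  proof (rule sum_strict_mono_ex1)
    show "\<exists>a\<in>supp x. sum (F a) (supp y) < sum (G a) (supp y)"
      by (rule bexI [of _ Q], rule sum_strict_mono_ex1) (use assms x y le less in auto)
  qed (use x y le in \<open>auto intro: sum_mono\<close>)
  then have "gram n f x y + gram n g x y < gram n rk x y"
    unfolding gram_split [OF split assms(1,2)] gram_rk [OF assms(1,2)] F_def G_def .
  then show ?thesis
    by (simp add: f_def g_def)
qed

text \<open>For comparable elements both components are ordered in the same direction, so both
  minima are attained at the same element and add up to the smaller rank.\<close>

lemma gram_split_eq: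
  assumes "rank_splitting f g" "x \<in> K" "y \<in> K" "is_chain (supp x \<union> supp y)"
  shows "gram n f x y + gram n g x y = gram n rk x y"
proof -
  note x = K_D [OF assms(2)] and y = K_D [OF assms(3)]
  have "x p * y q * real (min (f p) (f q)) + x p * y q * real (min (g p) (g q))
      = x p * y q * real (min (rk p) (rk q))" if "p \<in> supp x" "q \<in> supp y" for p q
  proof -
    have "f p + g p = rk p" "f q + g q = rk q"
      "f p \<le> f q \<and> g p \<le> g q \<or> f q \<le> f p \<and> g q \<le> g p"
      using assms(1,4) that x y unfolding rank_splitting_def is_chain_def by blast+
    then have "min (f p) (f q) + min (g p) (g q) = min (rk p) (rk q)"
      by linarith
    then have "real (min (f p) (f q)) + real (min (g p) (g q)) = real (min (rk p) (rk q))"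
      by linarith
    then show ?thesis
      by (metis distrib_left)
  qed
  then show ?thesis
    unfolding gram_split [OF assms(1-3)] gram_rk [OF assms(2,3)] by (intro sum.cong refl)
qed

lemma split_dist_eq:
  assumes "rank_splitting f g" "x \<in> K" "y \<in> K" "is_chain (supp x \<union> supp y)"
  shows "split_dist n f g x y = coord_dist n rk x y"
proof -
  have "is_chain (supp x)" "is_chain (supp y)"
    using assms K_D by auto
  with assms have "(split_dist n f g x y)\<^sup>2 = (coord_dist n rk x y)\<^sup>2"
    unfolding split_dist_square coord_dist_square
    using gram_split_eq [OF assms] gram_split_eq [OF assms(1,2,2)] gram_split_eq [OF assms(1,3,3)]
    by simp
  then show ?thesis
    by (simp add: coord_dist_nonneg split_dist_nonneg)
qed

text \<open>Each piece of a subdivision has its end points in one simplex, where the split distance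
  equals the simplex distance; the triangle inequality joins the pieces.\<close>

lemma split_dist_le_sum:
  assumes "rank_splitting f g" "subdivides N \<gamma> m t \<sigma>" "k \<le> m"
  shows "split_dist n f g (\<gamma> 0) (\<gamma> (t k)) \<le> (\<Sum>i<k. simplex_dist (\<sigma> i) (\<gamma> (t i)) (\<gamma> (t (Suc i))))"
  using assms(3)
proof (induction k)
  case 0
  then show ?case
    using assms(2) by (simp add: subdivides_def split_dist_def L2_set_def)
next
  case (Suc k)
  have k: "maximal_chain N (\<sigma> k)" "t k < t (Suc k)" "\<gamma> ` {t k..t (Suc k)} \<subseteq> simplex N (\<sigma> k)"
    using assms(2) Suc.prems by (auto simp: subdivides_def)
  then have s: "\<gamma> (t k) \<in> simplex N (\<sigma> k)" "\<gamma> (t (Suc k)) \<in> simplex N (\<sigma> k)"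
    by auto
  have "is_chain (set (\<sigma> k))"
    using k(1) lattice_chain_set by (auto simp: maximal_chain_def)
  then have "is_chain (supp (\<gamma> (t k)) \<union> supp (\<gamma> (t (Suc k))))"
    by (rule is_chain_subset) (use s in \<open>auto simp: simplex_def\<close>)
  then have "split_dist n f g (\<gamma> (t k)) (\<gamma> (t (Suc k))) = simplex_dist (\<sigma> k) (\<gamma> (t k)) (\<gamma> (t (Suc k)))"
    using s by (simp add: simplex_dist_eq [OF k(1)] split_dist_eq [OF assms(1)] simplex_def)
  then show ?case
    using split_dist_triangle [of n f g "\<gamma> 0" "\<gamma> (t (Suc k))" "\<gamma> (t k)"] Suc by simp
qed

lemma split_dist_le_path_length:
  assumes "rank_splitting f g" "\<gamma> \<in> paths N x y"
  shows "ereal (split_dist n f g x y) \<le> path_length N \<gamma>"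
proof -
  have \<gamma>: "\<gamma> 0 = x" "\<gamma> 1 = y" "\<exists>m t \<sigma>. subdivides N \<gamma> m t \<sigma>"
    using assms(2) by (simp_all add: paths_def)
  then obtain m t \<sigma> where sub: "subdivides N \<gamma> m t \<sigma>"
    by blast
  then have "t m = 1"
    by (simp add: subdivides_def)
  have "split_dist n f g x y \<le> (\<Sum>i<m. simplex_dist (\<sigma> i) (\<gamma> (t i)) (\<gamma> (t (Suc i))))"
    using split_dist_le_sum [OF assms(1) sub order_refl] \<gamma> \<open>t m = 1\<close> by simp
  then have "ereal (split_dist n f g x y) \<le> ereal (\<Sum>i<m. simplex_dist (\<sigma> i) (\<gamma> (t i)) (\<gamma> (t (Suc i))))"
    by simp
  also have "\<dots> \<le> path_length N \<gamma>"
    unfolding path_length_def by (rule SUP_upper2 [of "(m, t, \<sigma>)"]) (use sub in auto)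
  finally show ?thesis .
qed

text \<open>Since the length is a supremum over all subdivisions, with any choice of simplices, an
  upper bound must handle all of them at once. A Lipschitz bound does: the parameter increments
  telescope to 1.\<close>

lemma path_length_le:
  assumes "\<gamma> \<in> paths N x y"
    and lip: "\<And>s s'. \<lbrakk>0 \<le> s; s \<le> s'; s' \<le> 1\<rbrakk> \<Longrightarrow> coord_dist n rk (\<gamma> s) (\<gamma> s') \<le> L * (s' - s)"
  shows "path_length N \<gamma> \<le> ereal L"
  unfolding path_length_def
proof (rule SUP_least)
  fix a assume "a \<in> {(m, t, \<sigma>). subdivides N \<gamma> m t \<sigma>}"
  then obtain m t \<sigma> where a: "a = (m, t, \<sigma>)" and sub: "subdivides N \<gamma> m t \<sigma>"
    by auto
  have t: "t 0 = 0" "t m = 1" "\<And>i. i < m \<Longrightarrow> t i < t (Suc i)"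
    using sub by (auto simp: subdivides_def)
  have range: "0 \<le> t k" if "k \<le> m" for k
    using that by (induction k) (use t in \<open>force simp: Suc_le_eq\<close>)+
  have range': "t k \<le> 1" if "k \<le> m" for k
    using that by (induction rule: inc_induct) (use t in \<open>force simp: Suc_le_eq\<close>)+
  have "(\<Sum>i<m. simplex_dist (\<sigma> i) (\<gamma> (t i)) (\<gamma> (t (Suc i)))) \<le> (\<Sum>i<m. L * (t (Suc i) - t i))"
  proof (rule sum_mono)
    fix i assume "i \<in> {..<m}"
    then have i: "i < m"
      by simp
    then have k: "maximal_chain N (\<sigma> i)" "\<gamma> ` {t i..t (Suc i)} \<subseteq> simplex N (\<sigma> i)"
      using sub by (auto simp: subdivides_def)
    then have "simplex_dist (\<sigma> i) (\<gamma> (t i)) (\<gamma> (t (Suc i))) = coord_dist n rk (\<gamma> (t i)) (\<gamma> (t (Suc i)))"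
      using t(3) [OF i] by (auto intro!: simplex_dist_eq)
    also have "\<dots> \<le> L * (t (Suc i) - t i)"
      using lip [of "t i" "t (Suc i)"] range [of i] range' [of "Suc i"] t(3) [OF i] i by simp
    finally show "simplex_dist (\<sigma> i) (\<gamma> (t i)) (\<gamma> (t (Suc i))) \<le> L * (t (Suc i) - t i)" .
  qed
  also have "\<dots> = L"
    by (simp add: sum_distrib_left [symmetric] sum_lessThan_telescope t)
  finally show "(case a of (m, t, \<sigma>) \<Rightarrow>
      ereal (\<Sum>i<m. simplex_dist (\<sigma> i) (\<gamma> (t i)) (\<gamma> (t (Suc i))))) \<le> ereal L"
    by (simp add: a)
qed

section \<open>Exact distances on a common chain and lower bounds in general\<close>

lemma convex_in_K:
  assumes "x \<in> K" "y \<in> K" "is_chain (supp x \<union> supp y)" "0 \<le> a" "0 \<le> b" "a + b = 1"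
  shows "(\<lambda>p. a * x p + b * y p) \<in> K"
proof (rule K_I [OF _ assms(3)])
  let ?S = "supp x \<union> supp y"
  have "(\<Sum>p\<in>?S. x p) = (\<Sum>p\<in>supp x. x p)" "(\<Sum>p\<in>?S. y p) = (\<Sum>p\<in>supp y. y p)"
    using K_D(2) [OF assms(1)] K_D(2) [OF assms(2)]
    by (auto intro!: sum.mono_neutral_right simp: supp_def)
  with K_D(5) [OF assms(1)] K_D(5) [OF assms(2)] assms(6)
  show "(\<Sum>p\<in>?S. a * x p + b * y p) = 1"
    by (simp add: sum.distrib sum_distrib_left [symmetric])
qed (use assms K_D(1) in \<open>auto simp: supp_def\<close>)

text \<open>Along the straight segment the coordinates are affine in the parameter, with Lipschitz
  constant \<open>coord_dist n rk x y\<close>; this is the upper bound. The lower bound is the one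
  from the trivial splitting.\<close>

lemma oc_dist_same_simplex:
  assumes "x \<in> K" "y \<in> K" "is_chain (supp x \<union> supp y)"
  shows "oc_dist N x y = coord_dist n rk x y"
proof -
  obtain ps where ps: "maximal_chain N ps" "supp x \<union> supp y \<subseteq> set ps"
    using obtain_maximal_chain [OF assms(3)] .
  define \<gamma> where "\<gamma> s = (\<lambda>p. (1 - s) * x p + s * y p)" for s :: real
  have supp_\<gamma>: "supp (\<gamma> s) \<subseteq> supp x \<union> supp y" for s
    by (auto simp: supp_def \<gamma>_def)
  have simp: "\<gamma> s \<in> simplex N ps" if "0 \<le> s" "s \<le> 1" for s
    using convex_in_K [OF assms, of "1 - s" s] supp_\<gamma> [of s] ps that by (auto simp: simplex_def \<gamma>_def)
  have "subdivides N \<gamma> 1 real (\<lambda>_. ps)"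
    unfolding subdivides_def chart_def \<gamma>_def
    using ps(1) simp by (auto intro!: continuous_intros simp: \<gamma>_def)
  moreover have "\<gamma> 0 = x" "\<gamma> 1 = y"
    by (auto simp: \<gamma>_def)
  ultimately have path: "\<gamma> \<in> paths N x y"
    by (auto simp: paths_def)
  have fin: "finite (supp x \<union> supp y)"
    using assms K_D by blast
  have co: "coord rk (\<gamma> s) j = (1 - s) * coord rk x j + s * coord rk y j" for s j
    by (rule coord_lin [OF fin]) (use supp_\<gamma> in \<open>auto simp: \<gamma>_def\<close>)
  have "coord_dist n rk (\<gamma> s) (\<gamma> s') \<le> coord_dist n rk x y * (s' - s)" if "s \<le> s'" for s s'
  proof -
    have "coord_dist n rk (\<gamma> s) (\<gamma> s') = L2_set (\<lambda>j. (s' - s) * (coord rk x j - coord rk y j)) {1..n}"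
      unfolding coord_dist_def co by (simp add: algebra_simps)
    also have "\<dots> = (s' - s) * coord_dist n rk x y"
      unfolding coord_dist_def using that by (subst L2_set_right_distrib) auto
    finally show ?thesis
      by simp
  qed
  then have "path_length N \<gamma> \<le> ereal (coord_dist n rk x y)"
    by (intro path_length_le [OF path])
  then have "(INF \<gamma>\<in>paths N x y. path_length N \<gamma>) \<le> ereal (coord_dist n rk x y)"
    by (rule INF_lower2 [OF path])
  moreover have "ereal (coord_dist n rk x y) \<le> (INF \<gamma>\<in>paths N x y. path_length N \<gamma>)"
    unfolding split_dist_eq [OF rank_splitting_rk assms, symmetric]
    by (intro INF_greatest split_dist_le_path_length rank_splitting_rk)
  ultimately have "(INF \<gamma>\<in>paths N x y. path_length N \<gamma>) = ereal (coord_dist n rk x y)"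
    by (rule antisym)
  then show ?thesis
    by (simp add: oc_dist_def)
qed

lemma vertex_in_K: "p \<in> carrier N \<Longrightarrow> vertex p \<in> K" "supp (vertex p) = {p}"
proof -
  show s: "supp (vertex p) = {p}"
    by (auto simp: supp_def vertex_def)
  show "p \<in> carrier N \<Longrightarrow> vertex p \<in> K"
    using s by (intro K_I [of _ "{p}"]) (auto simp: vertex_def is_chain_def le_refl)
qed

lemma is_chain_insert:
  assumes "is_chain S"
  shows "is_chain (insert bt S)" "is_chain (insert tp S)"
  using assms bt tp le_refl by (auto simp: is_chain_def)

text \<open>\<open>oc_dist\<close> applies \<open>real_of_ereal\<close> to an infimum, and an
  infinite infimum would be read as 0, which would spoil every lower bound. A path through the top
  vertex, whose element is comparable to all others, excludes this.\<close>

lemma finite_length_path: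
  assumes "x \<in> K" "y \<in> K"
  shows "\<exists>\<gamma>\<in>paths N x y. path_length N \<gamma> < \<infinity>"
proof -
  note x = K_D [OF assms(1)] and y = K_D [OF assms(2)]
  \<comment> \<open>One closed formula for two segments: from x to the top vertex for s up to 1/2,
    then from there to y.\<close>
  define \<gamma> where "\<gamma> s = (\<lambda>p. max 0 (1 - 2 * s) * x p + max 0 (2 * s - 1) * y p
    + (1 - \<bar>1 - 2 * s\<bar>) * vertex tp p)" for s :: real
  have ch: "is_chain (supp x \<union> supp (vertex tp))" "is_chain (supp (vertex tp) \<union> supp y)"
    using is_chain_insert(2) x(3) y(3) vertex_in_K(2) by (simp_all add: Un_commute)
  obtain ps qs where ps: "maximal_chain N ps" "supp x \<union> supp (vertex tp) \<subseteq> set ps"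
    and qs: "maximal_chain N qs" "supp (vertex tp) \<union> supp y \<subseteq> set qs"
    using obtain_maximal_chain ch by metis
  have tpK: "vertex tp \<in> K"
    using vertex_in_K tp by simp
  have g1: "\<gamma> s = (\<lambda>p. (1 - 2 * s) * x p + (2 * s) * vertex tp p)" if "s \<le> 1/2" for s
    using that by (auto simp: \<gamma>_def fun_eq_iff)
  have g2: "\<gamma> s = (\<lambda>p. (2 - 2 * s) * vertex tp p + (2 * s - 1) * y p)" if "1/2 \<le> s" for s
    using that by (auto simp: \<gamma>_def fun_eq_iff)
  have s1: "\<gamma> s \<in> simplex N ps" if "0 \<le> s" "s \<le> 1/2" for s
  proof -
    have "supp (\<gamma> s) \<subseteq> supp x \<union> supp (vertex tp)"
      unfolding g1 [OF that(2)] by (auto simp: supp_def)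
    with ps(2) have "supp (\<gamma> s) \<subseteq> set ps"
      by blast
    then show ?thesis
      using convex_in_K [OF assms(1) tpK ch(1), of "1 - 2 * s" "2 * s"] that g1 [OF that(2)]
      by (simp add: simplex_def)
  qed
  have s2: "\<gamma> s \<in> simplex N qs" if "1/2 \<le> s" "s \<le> 1" for s
  proof -
    have "supp (\<gamma> s) \<subseteq> supp (vertex tp) \<union> supp y"
      unfolding g2 [OF that(1)] by (auto simp: supp_def)
    with qs(2) have "supp (\<gamma> s) \<subseteq> set qs"
      by blast
    then show ?thesis
      using convex_in_K [OF tpK assms(2) ch(2), of "2 - 2 * s" "2 * s - 1"] that g2 [OF that(1)]
      by (simp add: simplex_def)
  qed
  have "subdivides N \<gamma> 2 (\<lambda>i. real i / 2) (\<lambda>i. if i = 0 then ps else qs)"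
    unfolding subdivides_def less_2_cases_iff
    using ps(1) qs(1) s1 s2 unfolding chart_def \<gamma>_def
    by (auto intro!: continuous_intros simp: \<gamma>_def)
  moreover have "\<gamma> 0 = x" "\<gamma> 1 = y"
    by (auto simp: \<gamma>_def)
  ultimately have path: "\<gamma> \<in> paths N x y"
    by (auto simp: paths_def)
  define S where "S = supp x \<union> supp y \<union> {tp}"
  have S: "finite S" "supp x \<subseteq> S" "supp y \<subseteq> S" "supp (vertex tp) \<subseteq> S"
    using x y vertex_in_K by (auto simp: S_def)
  have supp_\<gamma>: "supp (\<gamma> s) \<subseteq> S" for s
    by (auto simp: S_def supp_def \<gamma>_def vertex_def)
  have co: "coord rk (\<gamma> s) j = max 0 (1 - 2 * s) * coord rk x j + max 0 (2 * s - 1) * coord rk y j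
      + (1 - \<bar>1 - 2 * s\<bar>) * coord rk (vertex tp) j" for s j
    unfolding coord_superset [OF S(1,2)] coord_superset [OF S(1,3)] coord_superset [OF S(1,4)]
      coord_superset [OF S(1) supp_\<gamma>]
    unfolding sum_distrib_left sum.distrib [symmetric]
    by (intro sum.cong refl) (simp add: \<gamma>_def algebra_simps)
  have bound: "\<bar>coord rk w j\<bar> \<le> 1" if "w \<in> K" for w j
  proof -
    have "0 \<le> coord rk w j"
      unfolding coord_def by (intro sum_nonneg) (use K_D(1) [OF that] in auto)
    moreover have "coord rk w j \<le> (\<Sum>p\<in>supp w. w p)"
      unfolding coord_def by (intro sum_mono) (use K_D(1) [OF that] in auto)
    ultimately show ?thesis
      using K_D(5) [OF that] by simp
  qed
  \<comment> \<open>Three coefficient functions with Lipschitz constant 2, multiplied by coordinates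
    in [0,1], give 6 per coordinate. Only finiteness of the bound matters.\<close>
  have "coord_dist n rk (\<gamma> s) (\<gamma> s') \<le> (real n * 6) * (s' - s)" if "s \<le> s'" for s s'
  proof -
    have "\<bar>coord rk (\<gamma> s) j - coord rk (\<gamma> s') j\<bar> \<le> 6 * (s' - s)" for j
    proof -
      have "coord rk (\<gamma> s) j - coord rk (\<gamma> s') j
          = (max 0 (1 - 2 * s) - max 0 (1 - 2 * s')) * coord rk x j
          + (max 0 (2 * s - 1) - max 0 (2 * s' - 1)) * coord rk y j
          + (\<bar>1 - 2 * s'\<bar> - \<bar>1 - 2 * s\<bar>) * coord rk (vertex tp) j"
        unfolding co by (simp add: algebra_simps)
      also have "\<bar>\<dots>\<bar> \<le> \<bar>max 0 (1 - 2 * s) - max 0 (1 - 2 * s')\<bar> * \<bar>coord rk x j\<bar>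
          + \<bar>max 0 (2 * s - 1) - max 0 (2 * s' - 1)\<bar> * \<bar>coord rk y j\<bar>
          + \<bar>\<bar>1 - 2 * s'\<bar> - \<bar>1 - 2 * s\<bar>\<bar> * \<bar>coord rk (vertex tp) j\<bar>"
        unfolding abs_mult [symmetric] by linarith
      also have "\<dots> \<le> 2 * (s' - s) * 1 + 2 * (s' - s) * 1 + 2 * (s' - s) * 1"
        using that bound [OF assms(1), of j] bound [OF assms(2), of j] bound [OF tpK, of j]
        by (intro add_mono mult_mono) (auto simp: max_def)
      finally show ?thesis
        by simp
    qed
    then have "(\<Sum>j = 1..n. \<bar>coord rk (\<gamma> s) j - coord rk (\<gamma> s') j\<bar>) \<le> (\<Sum>j = 1..n. 6 * (s' - s))"
      by (intro sum_mono)
    moreover have "coord_dist n rk (\<gamma> s) (\<gamma> s') \<le> (\<Sum>j = 1..n. \<bar>coord rk (\<gamma> s) j - coord rk (\<gamma> s') j\<bar>)"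
      unfolding coord_dist_def by (rule L2_set_le_sum_abs)
    ultimately show ?thesis
      by (simp add: algebra_simps)
  qed
  then have "path_length N \<gamma> \<le> ereal (real n * 6)"
    by (intro path_length_le [OF path])
  then have "path_length N \<gamma> < \<infinity>"
    by auto
  with path show ?thesis
    by blast
qed

lemma split_dist_le_oc_dist:
  assumes "rank_splitting f g" "x \<in> K" "y \<in> K"
  shows "split_dist n f g x y \<le> oc_dist N x y"
proof -
  let ?I = "INF \<gamma>\<in>paths N x y. path_length N \<gamma>"
  have "ereal (split_dist n f g x y) \<le> ?I"
    using split_dist_le_path_length [OF assms(1)] by (auto intro!: INF_greatest)
  moreover have "?I < \<infinity>"
    using finite_length_path [OF assms(2,3)] by (meson INF_lower le_less_trans)
  ultimately show ?thesis
    unfolding oc_dist_def by (cases ?I) auto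
qed

lemma oc_dist_ge:
  assumes "x \<in> K" "y \<in> K"
  shows "coord_dist n rk x y \<le> oc_dist N x y"
proof -
  have "coord_dist n (\<lambda>_. 0) x y = 0"
    by (simp add: coord_dist_def coord_def L2_set_def)
  then have "split_dist n rk (\<lambda>_. 0) x y = coord_dist n rk x y"
    using split_dist_square [of n rk "\<lambda>_. 0" x y]
    by (simp add: coord_dist_nonneg split_dist_nonneg)
  then show ?thesis
    using split_dist_le_oc_dist [OF rank_splitting_rk assms] by simp
qed

text \<open>Passing to the splitting at \<open>Q\<close> keeps the norms of x and y and strictly
  lowers their inner product, so the split distance exceeds the plain coordinate distance.\<close>

lemma oc_dist_greater:
  assumes "x \<in> K" "y \<in> K" "Q \<in> supp x" "p \<in> supp y" "rk p = rk Q" "p \<noteq> Q"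
  shows "coord_dist n rk x y < oc_dist N x y"
proof -
  have Q: "Q \<in> carrier N"
    using K_D(4) assms by blast
  note split = rank_splitting_mr [OF Q]
  have "(coord_dist n rk x y)\<^sup>2 < (split_dist n (mr Q) (\<lambda>p. rk p - mr Q p) x y)\<^sup>2"
    unfolding split_dist_square coord_dist_square
    using gram_split_less [OF assms] gram_split_eq [OF split assms(1,1)]
      gram_split_eq [OF split assms(2,2)] K_D(3) assms by simp
  then have "coord_dist n rk x y < split_dist n (mr Q) (\<lambda>p. rk p - mr Q p) x y"
    by (rule power2_less_imp_less) (rule split_dist_nonneg)
  then show ?thesis
    using split_dist_le_oc_dist [OF split assms(1,2)] by simp
qed

end


section \<open>The resolvent in coordinates\<close>

text \<open>The unique minimizer over \<open>{0..1}\<close> of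
  \<open>t \<mapsto> - \<epsilon> * t + t\<^sup>2 / (8 * n) + (t - s)\<^sup>2 / (2 * \<mu>)\<close>, a clamped stationary point.\<close>

definition prox :: "real \<Rightarrow> nat \<Rightarrow> real \<Rightarrow> real \<Rightarrow> real" where
  "prox \<epsilon> n \<mu> s = max 0 (min 1 ((s + \<epsilon> * \<mu>) / (1 + \<mu> / (4 * real n))))"

lemma prox_bounds: "0 \<le> prox \<epsilon> n \<mu> s" "prox \<epsilon> n \<mu> s \<le> 1"
  by (auto simp: prox_def)

lemma prox_mono:
  assumes "0 < \<mu>" "s \<le> s'"
  shows "prox \<epsilon> n \<mu> s \<le> prox \<epsilon> n \<mu> s'"
proof -
  have "(s + \<epsilon> * \<mu>) / (1 + \<mu> / (4 * real n)) \<le> (s' + \<epsilon> * \<mu>) / (1 + \<mu> / (4 * real n))"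
    using assms by (intro divide_right_mono) auto
  then show ?thesis
    unfolding prox_def by linarith
qed

text \<open>Strong convexity: the function is a parabola with leading coefficient \<open>a\<close>,
  and \<open>h\<close> is the projection of its vertex \<open>v\<close> to [0,1]. The surplus
  \<open>a * (t - h)\<^sup>2\<close> is what later forces the coordinates of any minimizer.\<close>

lemma prox_minimizes:
  fixes t s \<epsilon> \<mu> :: real
  assumes "0 < \<mu>" "1 \<le> n" "0 \<le> t" "t \<le> 1"
  defines "h \<equiv> prox \<epsilon> n \<mu> s" and "a \<equiv> 1 / (8 * real n) + 1 / (2 * \<mu>)"
  shows "- \<epsilon> * h + 1 / (8 * real n) * h\<^sup>2 + 1 / (2 * \<mu>) * (s - h)\<^sup>2 + a * (t - h)\<^sup>2
    \<le> - \<epsilon> * t + 1 / (8 * real n) * t\<^sup>2 + 1 / (2 * \<mu>) * (s - t)\<^sup>2"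
proof -
  define v where "v = (s + \<epsilon> * \<mu>) / (1 + \<mu> / (4 * real n))"
  have h: "h = max 0 (min 1 v)"
    by (simp add: h_def prox_def v_def)
  have a: "0 < a"
    using assms by (simp add: a_def add_pos_pos)
  have "1 + \<mu> / (4 * real n) = 2 * \<mu> * a"
    using assms by (simp add: a_def field_simps)
  moreover have "1 + \<mu> / (4 * real n) > 0"
    using assms by (simp add: add_pos_nonneg)
  ultimately have "v * (2 * \<mu> * a) = s + \<epsilon> * \<mu>"
    using a assms(1) by (auto simp: v_def)
  \<comment> \<open>The stationarity condition at \<open>v\<close>; it turns the objective into
    \<open>a * r\<^sup>2 - 2 * a * v * r\<close> plus a constant.\<close>
  then have v: "2 * a * v = s / \<mu> + \<epsilon>"
    using assms by (simp add: field_simps)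
  have quad: "- \<epsilon> * r + 1 / (8 * real n) * r\<^sup>2 + 1 / (2 * \<mu>) * (s - r)\<^sup>2
      = a * r\<^sup>2 - 2 * a * v * r + s\<^sup>2 / (2 * \<mu>)" for r
    unfolding v unfolding a_def power2_eq_square using assms(1,2) by (simp add: field_simps)
  \<comment> \<open>The variational inequality of the projection: seen from \<open>h\<close>, no
    point t of [0,1] lies strictly on the side of \<open>v\<close>.\<close>
  have "0 \<le> (t - h) * (h - v)"
    using assms(3,4) unfolding h by (cases "v < 0"; cases "v > 1") (auto simp: mult_nonneg_nonpos mult_nonpos_nonpos)
  then have "0 \<le> 2 * a * ((t - h) * (h - v))"
    using a by simp
  also have "\<dots> = (a * t\<^sup>2 - 2 * a * v * t) - (a * h\<^sup>2 - 2 * a * v * h) - a * (t - h)\<^sup>2"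
    by (simp add: power2_eq_square algebra_simps)
  finally show ?thesis
    unfolding quad by simp
qed

lemma monotone_predicate_threshold:
  fixes P :: "nat \<Rightarrow> bool"
  assumes "\<forall>i k. P i \<longrightarrow> i \<le> k \<longrightarrow> k < m \<longrightarrow> P k"
  shows "\<exists>i\<^sub>0\<le>m. \<forall>i<m. P i \<longleftrightarrow> i\<^sub>0 \<le> i"
proof (intro exI conjI allI impI)
  \<comment> \<open>Admitting m itself makes the least index exist, and equal to m if
    \<open>P\<close> holds nowhere below m.\<close>
  let ?i = "LEAST i. i = m \<or> P i"
  have "?i = m \<or> P ?i"
    by (rule LeastI [of _ m]) simp
  moreover show "?i \<le> m"
    by (rule Least_le) simp
  ultimately show "P i \<longleftrightarrow> ?i \<le> i" if "i < m" for i
    using assms that Least_le [of "\<lambda>i. i = m \<or> P i" i]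
    by (metis not_le)
qed

lemma sum_vertex:
  assumes "finite S" "q \<in> S"
  shows "(\<Sum>p\<in>S. vertex q p * F p) = (F q :: real)"
proof -
  have "(\<Sum>p\<in>S. vertex q p * F p) = (\<Sum>p\<in>S. if p = q then F q else 0)"
    by (rule sum.cong) (auto simp: vertex_def)
  with assms show ?thesis
    by simp
qed

text \<open>For coefficients listed along a chain these are the values of the rank coordinates:
  coordinate j is the tail sum from the first chain element of rank at least j.\<close>

definition tail_sum :: "nat \<Rightarrow> (nat \<Rightarrow> real) \<Rightarrow> nat \<Rightarrow> real" where
  "tail_sum m c i = sum c {i..<m}"

lemma tail_sum_simps:
  "tail_sum m c m = 0" "i < m \<Longrightarrow> tail_sum m c i = c i + tail_sum m c (Suc i)"
  by (simp_all add: tail_sum_def sum.atLeast_Suc_lessThan)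

lemma sum_differences:
  fixes g :: "nat \<Rightarrow> real"
  assumes "a \<le> b"
  shows "(\<Sum>i = a..<b. g i - g (Suc i)) = g a - g b"
  using sum_Suc_diff' [OF assms, of "\<lambda>i. - g i"] by simp

context ranked_order
begin

lemma coord_bounds:
  assumes "x \<in> K"
  shows "0 \<le> coord rk x j" "coord rk x j \<le> 1"
proof -
  show "0 \<le> coord rk x j"
    unfolding coord_def by (intro sum_nonneg) (simp add: K_D(1) [OF assms])
  have "coord rk x j \<le> (\<Sum>p\<in>supp x. x p)"
    unfolding coord_def by (intro sum_mono) (simp add: K_D(1) [OF assms])
  then show "coord rk x j \<le> 1"
    using K_D(5) [OF assms] by simp
qed

lemma coord_ends:
  assumes "x \<in> K"
  shows "coord rk x 0 = 1" "coord rk x (Suc n) = 0"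
proof -
  show "coord rk x 0 = 1"
    using K_D(5) [OF assms] by (simp add: coord_def)
  have "\<not> Suc n \<le> rk p" if "p \<in> supp x" for p
    using rk_le [OF subsetD [OF K_D(4) [OF assms] that]] by simp
  then show "coord rk x (Suc n) = 0"
    by (simp add: coord_def)
qed

lemma level_mass:
  "(\<Sum>p\<in>supp x. x p * of_bool (rk p = r)) = coord rk x r - coord rk x (Suc r)"
  unfolding coord_def sum_subtractf [symmetric] by (rule sum.cong) auto

text \<open>If y and z differ, some p weighs more in y than in z, because both have total mass 1.
  Equal coordinates mean equal mass at each rank, so z charges another element q of the rank of p.
  The ends are alone in their ranks, so q is not an end and lies in \<open>supp x\<close>; then the
  strict bound contradicts \<open>dist\<close>.\<close>

lemma K_eq_of_coord_eq:
  assumes x: "x \<in> K" and y: "y \<in> K" and z: "z \<in> K"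
    and coord: "\<And>j. j \<in> {1..n} \<Longrightarrow> coord rk y j = coord rk z j"
    and supp: "supp z \<subseteq> supp x \<union> {bt, tp}"
    and dist: "oc_dist N x y \<le> coord_dist n rk x y"
  shows "y = z"
proof (rule ccontr)
  assume "y \<noteq> z"
  have "\<exists>p. z p < y p"
  proof (rule ccontr)
    assume "\<nexists>p. z p < y p"
    then have le: "y p \<le> z p" for p
      by (simp add: not_less)
    let ?T = "supp y \<union> supp z"
    have fin: "finite ?T"
      using K_D(2) y z by blast
    have "sum y ?T = sum y (supp y)" "sum z ?T = sum z (supp z)"
      using fin by (auto intro!: sum.mono_neutral_right simp: supp_def)
    then have "(\<Sum>p\<in>?T. z p - y p) = 0"
      using K_D(5) [OF y] K_D(5) [OF z] by (simp add: sum_subtractf)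
    then have 0: "\<forall>p\<in>?T. z p - y p = 0"
      by (rule sum_nonneg_eq_0_iff [OF fin, THEN iffD1, rotated]) (simp add: le)
    have "y p = z p" for p
    proof (cases "p \<in> ?T")
      case True
      with 0 have "z p - y p = 0"
        by blast
      then show ?thesis
        by simp
    next
      case False
      then show ?thesis
        by (simp add: supp_def)
    qed
    with \<open>y \<noteq> z\<close> show False
      by blast
  qed
  then obtain p where p: "z p < y p"
    by blast
  then have py: "p \<in> supp y" and pc: "p \<in> carrier N"
    using K_D(1) [OF z, of p] K_D(4) [OF y] by (auto simp: supp_def)
  have "\<exists>q\<in>supp z. rk q = rk p \<and> q \<noteq> p"
  proof (rule ccontr)
    assume "\<not> (\<exists>q\<in>supp z. rk q = rk p \<and> q \<noteq> p)"
    then have "(\<Sum>q\<in>supp z. z q * of_bool (rk q = rk p)) = (\<Sum>q\<in>supp z. if q = p then z p else 0)"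
      by (intro sum.cong) auto
    also have "\<dots> \<le> z p"
      using K_D(1,2) [OF z] by simp
    also have "\<dots> < y p"
      by (rule p)
    also have "y p \<le> (\<Sum>q\<in>supp y. y q * of_bool (rk q = rk p))"
      using member_le_sum [OF py, of "\<lambda>q. y q * of_bool (rk q = rk p)"] K_D(1,2) [OF y] by simp
    finally have "coord rk z (rk p) - coord rk z (Suc (rk p)) < coord rk y (rk p) - coord rk y (Suc (rk p))"
      unfolding level_mass .
    \<comment> \<open>The mass at rank r is the difference of coordinates r and r + 1, and r may be
      0 or n; so the constant coordinates 0 and n + 1 have to be included.\<close>
    moreover have "coord rk z j = coord rk y j" if "j \<le> Suc n" for j
    proof (cases "j = 0 \<or> j = Suc n")
      case True
      then show ?thesis
        using coord_ends y z by auto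
    next
      case False
      with that show ?thesis
        using coord [of j] by simp
    qed
    ultimately show False
      using rk_le [OF pc] by simp
  qed
  then obtain q where q: "q \<in> supp z" "rk q = rk p" "q \<noteq> p"
    by blast
  have "q \<noteq> bt" "q \<noteq> tp"
    using q rk_eq [OF bt(1) pc bt(3) [OF pc]] rk_eq [OF pc tp(1) tp(3) [OF pc]] by auto
  then have "q \<in> supp x"
    using q supp by blast
  then have "coord_dist n rk x y < oc_dist N x y"
    using oc_dist_greater [OF x y _ py] q by metis
  with dist show False
    by simp
qed

lemma
  assumes ps: "lattice_chain N ps" and x: "x \<in> K"
    and x_eq: "x = (\<lambda>p. \<Sum>i<length ps. c i * vertex (ps ! i) p)"
  shows chain_coeff: "i < length ps \<Longrightarrow> x (ps ! i) = c i"
    and chain_supp: "supp x \<subseteq> set ps"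
    and chain_total: "tail_sum (length ps) c 0 = 1"
proof -
  have dist: "distinct ps"
    using lattice_chain_set ps by blast
  show coeff: "x (ps ! i) = c i" if "i < length ps" for i
  proof -
    have "x (ps ! i) = (\<Sum>k<length ps. if k = i then c i else 0)"
      unfolding x_eq by (rule sum.cong) (use dist that in \<open>auto simp: vertex_def nth_eq_iff_index_eq\<close>)
    with that show ?thesis
      by simp
  qed
  have "p \<in> set ps" if "x p \<noteq> 0" for p
  proof (rule ccontr)
    assume "p \<notin> set ps"
    then have "x p = (\<Sum>i<length ps. 0)"
      unfolding x_eq by (intro sum.cong) (auto simp: vertex_def)
    with that show False
      by simp
  qed
  then show sub: "supp x \<subseteq> set ps"
    by (auto simp: supp_def)
  have "1 = sum x (set ps)"
    unfolding K_D(5) [OF x, symmetric]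
    by (rule sum.mono_neutral_left) (use sub in \<open>auto simp: supp_def\<close>)
  also have "\<dots> = (\<Sum>i<length ps. x (ps ! i))"
    by (rule sum.reindex_bij_betw [symmetric, OF bij_betw_nth]) (use dist in auto)
  also have "\<dots> = tail_sum (length ps) c 0"
    unfolding tail_sum_def atLeast0LessThan by (rule sum.cong) (use coeff in auto)
  finally show "tail_sum (length ps) c 0 = 1" ..
qed

text \<open>To turn each coordinate s into \<open>h s\<close>, a chain element must carry the drop
  of \<open>h\<close> between the tail sums before and after it. What is missing from 1 at the start
  goes to the bottom, what is left after the last element to the top. Since weights on vertices are
  added, an end that already belongs to the chain needs no special treatment.\<close>

definition prox_point :: "(real \<Rightarrow> real) \<Rightarrow> (nat \<Rightarrow> real) \<Rightarrow> 'a list \<Rightarrow> 'a \<Rightarrow> real" where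
  "prox_point h c ps p = (1 - h 1) * vertex bt p
     + (\<Sum>i<length ps. (h (tail_sum (length ps) c i) - h (tail_sum (length ps) c (Suc i))) * vertex (ps ! i) p)
     + h 0 * vertex tp p"

lemma
  assumes ps: "lattice_chain N ps" and x: "x \<in> K"
    and x_eq: "x = (\<lambda>p. \<Sum>i<length ps. c i * vertex (ps ! i) p)"
    and mono: "\<And>s s'. s \<le> s' \<Longrightarrow> h s \<le> h s'" and range: "\<And>s. 0 \<le> h s \<and> h s \<le> (1 :: real)"
  shows prox_point_in_K: "prox_point h c ps \<in> K"
    and prox_point_chain: "is_chain (supp x \<union> supp (prox_point h c ps))"
    and prox_point_supp: "supp (prox_point h c ps) \<subseteq> supp x \<union> {bt, tp}"
    and coord_prox_point: "j \<in> {1..n} \<Longrightarrow> coord rk (prox_point h c ps) j = h (coord rk x j)"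
proof -
  let ?z = "prox_point h c ps" and ?m = "length ps"
  define S where "S = insert bt (insert tp (set ps))"
  have S: "finite S" "bt \<in> S" "tp \<in> S" "\<And>i. i < ?m \<Longrightarrow> ps ! i \<in> S" and chS: "is_chain S"
    using is_chain_insert lattice_chain_set(1) [OF ps] by (auto simp: S_def)
  note coeff = chain_coeff [OF ps x x_eq] and supp_x = chain_supp [OF ps x x_eq]
    and total = chain_total [OF ps x x_eq]
  define H where "H i = h (tail_sum ?m c i)" for i
  have H: "H 0 = h 1" "H ?m = h 0"
    by (simp_all add: H_def total tail_sum_simps)
  have zp: "?z p = (1 - h 1) * vertex bt p + (\<Sum>i<?m. (H i - H (Suc i)) * vertex (ps ! i) p) + h 0 * vertex tp p" for p
    by (simp add: prox_point_def H_def)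
  have c_nonneg: "0 \<le> c i" if "i < ?m" for i
    using coeff [OF that] K_D(1) [OF x] by metis
  have H_mono: "H (Suc i) \<le> H i" if "i < ?m" for i
    unfolding H_def by (rule mono) (use tail_sum_simps(2) [OF that] c_nonneg [OF that] in simp)
  have nonneg: "0 \<le> ?z p" for p
    unfolding zp using H_mono range by (intro add_nonneg_nonneg mult_nonneg_nonneg sum_nonneg) (auto simp: vertex_def)
  have supp_S: "supp ?z \<subseteq> S"
  proof
    fix p assume "p \<in> supp ?z"
    show "p \<in> S"
    proof (rule ccontr)
      assume "p \<notin> S"
      then have "?z p = 0"
        unfolding zp using S by (auto simp: vertex_def intro!: sum.neutral)
      with \<open>p \<in> supp ?z\<close> show False
        by (simp add: supp_def)
    qed
  qed
  have sum_z: "(\<Sum>p\<in>S. ?z p * F p)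
      = (1 - h 1) * F bt + (\<Sum>i<?m. (H i - H (Suc i)) * F (ps ! i)) + h 0 * F tp" for F :: "'a \<Rightarrow> real"
  proof -
    have "(\<Sum>p\<in>S. ?z p * F p) = (1 - h 1) * (\<Sum>p\<in>S. vertex bt p * F p)
        + (\<Sum>i<?m. (H i - H (Suc i)) * (\<Sum>p\<in>S. vertex (ps ! i) p * F p)) + h 0 * (\<Sum>p\<in>S. vertex tp p * F p)"
      unfolding zp distrib_right sum.distrib sum_distrib_left sum_distrib_right
      by (subst sum.swap) (simp add: mult.assoc)
    also have "(\<Sum>i<?m. (H i - H (Suc i)) * (\<Sum>p\<in>S. vertex (ps ! i) p * F p))
        = (\<Sum>i<?m. (H i - H (Suc i)) * F (ps ! i))"
      by (rule sum.cong [OF refl]) (simp only: lessThan_iff sum_vertex [OF S(1) S(4)])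
    finally show ?thesis
      using S by (simp only: sum_vertex)
  qed
  show zK: "?z \<in> K"
  proof (rule K_I [OF nonneg chS supp_S])
    show "sum ?z S = 1"
      using sum_z [of "\<lambda>_. 1"] sum_differences [of 0 ?m H] H by (simp add: atLeast0LessThan)
  qed
  show "is_chain (supp x \<union> supp ?z)"
    by (rule is_chain_subset [OF chS]) (use supp_x supp_S in \<open>auto simp: S_def\<close>)
  show "supp ?z \<subseteq> supp x \<union> {bt, tp}"
  proof
    fix p assume p: "p \<in> supp ?z"
    show "p \<in> supp x \<union> {bt, tp}"
    proof (rule ccontr)
      assume p': "p \<notin> supp x \<union> {bt, tp}"
      \<comment> \<open>A listed element outside \<open>supp x\<close> has coefficient 0; its two
        tail sums coincide and it gets no weight.\<close>
      have "(H i - H (Suc i)) * vertex (ps ! i) p = 0" if "i < ?m" for i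
      proof (cases "ps ! i = p")
        case True
        then have "c i = 0"
          using coeff [OF that] p' by (simp add: supp_def)
        then show ?thesis
          by (simp add: H_def tail_sum_simps(2) [OF that])
      qed (simp add: vertex_def)
      then have "(\<Sum>i<?m. (H i - H (Suc i)) * vertex (ps ! i) p) = 0"
        by (intro sum.neutral ballI) (simp only: lessThan_iff)
      then have "?z p = 0"
        unfolding zp using p' by (simp add: vertex_def)
      with p show False
        by (simp add: supp_def)
    qed
  qed
  show "coord rk ?z j = h (coord rk x j)" if j: "j \<in> {1..n}"
  proof -
    have mono_rk: "j \<le> rk (ps ! k)" if "j \<le> rk (ps ! i)" "i \<le> k" "k < ?m" for i k
    proof (cases "i = k")
      case False
      with that have "rk (ps ! i) < rk (ps ! k)"
        by (intro sorted_wrt_nth_less [OF lattice_chain_set(3) [OF ps]]) auto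
      with that show ?thesis
        by simp
    qed (use that in simp)
    \<comment> \<open>Ranks increase along the list, so the elements of rank at least j form a final
      segment, and the coordinates of x and of the new point are sums over the same segment.\<close>
    obtain i\<^sub>0 where i: "i\<^sub>0 \<le> ?m" "\<And>i. i < ?m \<Longrightarrow> j \<le> rk (ps ! i) \<longleftrightarrow> i\<^sub>0 \<le> i"
      using monotone_predicate_threshold [of "\<lambda>i. j \<le> rk (ps ! i)" ?m] mono_rk by blast
    have restrict: "(\<Sum>i<?m. G i * of_bool (j \<le> rk (ps ! i))) = sum G {i\<^sub>0..<?m}" for G :: "nat \<Rightarrow> real"
    proof -
      have "sum G {i\<^sub>0..<?m} = (\<Sum>i = i\<^sub>0..<?m. G i * of_bool (j \<le> rk (ps ! i)))"
        by (rule sum.cong) (use i in auto)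
      also have "\<dots> = (\<Sum>i<?m. G i * of_bool (j \<le> rk (ps ! i)))"
        by (rule sum.mono_neutral_left) (use i in auto)
      finally show ?thesis ..
    qed
    have "coord rk x j = (\<Sum>p\<in>set ps. x p * of_bool (j \<le> rk p))"
      by (rule coord_superset) (use supp_x in auto)
    also have "\<dots> = (\<Sum>i<?m. x (ps ! i) * of_bool (j \<le> rk (ps ! i)))"
      by (rule sum.reindex_bij_betw [symmetric, OF bij_betw_nth]) (use lattice_chain_set(2) [OF ps] in auto)
    also have "\<dots> = (\<Sum>i<?m. c i * of_bool (j \<le> rk (ps ! i)))"
      by (rule sum.cong) (use coeff in auto)
    finally have cx: "coord rk x j = tail_sum ?m c i\<^sub>0"
      unfolding restrict tail_sum_def .
    \<comment> \<open>The bottom drops out because j is at least 1. The sum telescopes to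
      \<open>H i\<^sub>0 - H ?m\<close>, and the top supplies exactly the missing
      \<open>h 0\<close>.\<close>
    have "coord rk ?z j = (\<Sum>i<?m. (H i - H (Suc i)) * of_bool (j \<le> rk (ps ! i))) + h 0"
      unfolding coord_superset [OF S(1) supp_S] sum_z using j bt tp by simp
    also have "\<dots> = H i\<^sub>0"
      unfolding restrict using sum_differences [OF i(1), of H] H by simp
    finally show ?thesis
      by (simp add: cx H_def)
  qed
qed

lemma coord_dist_sum: "(coord_dist n rk x y)\<^sup>2 = (\<Sum>j = 1..n. (coord rk x j - coord rk y j)\<^sup>2)"
  by (simp add: coord_dist_def L2_set_def sum_nonneg)

text \<open>The objective is a separable function of the coordinates plus a multiple of
  \<open>gap\<close>, the nonnegative excess of the squared distance over its coordinate bound. The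
  gap vanishes at z, which shares a chain with x, and z is optimal in each coordinate. Equality
  forces equal coordinates and zero gap, hence y = z. \<open>C\<close> and \<open>\<epsilon>\<close>
  account for the two orders, in which the dimension is the rank or n minus the rank.\<close>

lemma prox_point_minimizer:
  assumes n: "1 \<le> n" and \<mu>: "0 < \<mu>"
    and f: "\<And>y. y \<in> K \<Longrightarrow> f y = C - \<epsilon> * (\<Sum>j = 1..n. coord rk y j)
      + 1 / (8 * real n) * (oc_dist N (vertex bt) y)\<^sup>2"
    and ps: "lattice_chain N ps" and x: "x \<in> K"
    and x_eq: "x = (\<lambda>p. \<Sum>i<length ps. c i * vertex (ps ! i) p)"
  shows "proximal_minimizer N f \<mu> x y \<longleftrightarrow> y = prox_point (prox \<epsilon> n \<mu>) c ps"
proof -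
  let ?h = "prox \<epsilon> n \<mu>"
  define z where "z = prox_point ?h c ps"
  have h: "\<And>s s'. s \<le> s' \<Longrightarrow> ?h s \<le> ?h s'" "\<And>s. 0 \<le> ?h s \<and> ?h s \<le> 1"
    using prox_mono [OF \<mu>] prox_bounds by auto
  have z: "z \<in> K" "is_chain (supp x \<union> supp z)" "supp z \<subseteq> supp x \<union> {bt, tp}"
    and coord_z: "\<And>j. j \<in> {1..n} \<Longrightarrow> coord rk z j = ?h (coord rk x j)"
    unfolding z_def
    using prox_point_in_K [where h = ?h, OF ps x x_eq h] prox_point_chain [where h = ?h, OF ps x x_eq h]
      prox_point_supp [where h = ?h, OF ps x x_eq h] coord_prox_point [where h = ?h, OF ps x x_eq h]
    by blast+
  define \<Phi> where "\<Phi> y = f y + 1 / (2 * \<mu>) * (oc_dist N x y)\<^sup>2" for y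
  define gap where "gap y = (oc_dist N x y)\<^sup>2 - (coord_dist n rk x y)\<^sup>2" for y
  define a where "a = 1 / (8 * real n) + 1 / (2 * \<mu>)"
  have a: "0 < a"
    using n \<mu> by (simp add: a_def add_pos_pos)
  define g where "g j t = - \<epsilon> * t + 1 / (8 * real n) * t\<^sup>2 + 1 / (2 * \<mu>) * (coord rk x j - t)\<^sup>2" for j t
  have \<Phi>_eq: "\<Phi> y = C + (\<Sum>j = 1..n. g j (coord rk y j)) + 1 / (2 * \<mu>) * gap y" if y: "y \<in> K" for y
  proof -
    \<comment> \<open>The bottom is comparable to everything, so the distance from it is always the
      coordinate distance and its square is separable.\<close>
    have "is_chain (supp (vertex bt) \<union> supp y)"
      using is_chain_insert(1) [OF K_D(3) [OF y]] by (simp add: vertex_in_K(2))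
    then have "oc_dist N (vertex bt) y = coord_dist n rk (vertex bt) y"
      by (rule oc_dist_same_simplex [OF vertex_in_K(1) [OF bt(1)] y])
    moreover have "coord rk (vertex bt) j = 0" if "j \<in> {1..n}" for j
      using that bt by (simp add: coord_def vertex_in_K(2))
    ultimately have "(oc_dist N (vertex bt) y)\<^sup>2 = (\<Sum>j = 1..n. (coord rk y j)\<^sup>2)"
      by (simp add: coord_dist_sum del: One_nat_def)
    then have "\<Phi> y = C - \<epsilon> * (\<Sum>j = 1..n. coord rk y j) + 1 / (8 * real n) * (\<Sum>j = 1..n. (coord rk y j)\<^sup>2)
        + 1 / (2 * \<mu>) * (\<Sum>j = 1..n. (coord rk x j - coord rk y j)\<^sup>2) + 1 / (2 * \<mu>) * gap y"
      unfolding \<Phi>_def gap_def f [OF y] coord_dist_sum by (simp add: algebra_simps diff_divide_distrib)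
    then show ?thesis
      unfolding g_def sum.distrib sum_distrib_left by (simp add: sum_negf)
  qed
  have gap_nonneg: "0 \<le> gap y" if "y \<in> K" for y
    using power_mono [OF oc_dist_ge [OF x that] coord_dist_nonneg, of 2] by (simp add: gap_def)
  have \<Phi>_z: "\<Phi> z = C + (\<Sum>j = 1..n. g j (coord rk z j))"
    unfolding \<Phi>_eq [OF z(1)] by (simp add: gap_def oc_dist_same_simplex [OF x z(1,2)])
  have key: "\<Phi> z + a * (coord_dist n rk y z)\<^sup>2 + 1 / (2 * \<mu>) * gap y \<le> \<Phi> y" if y: "y \<in> K" for y
  proof -
    have "(\<Sum>j = 1..n. g j (coord rk z j) + a * (coord rk y j - coord rk z j)\<^sup>2) \<le> (\<Sum>j = 1..n. g j (coord rk y j))"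
      by (rule sum_mono) (use prox_minimizes [OF \<mu> n coord_bounds [OF y]] coord_z in \<open>simp add: g_def a_def\<close>)
    then show ?thesis
      unfolding \<Phi>_eq [OF y] \<Phi>_z coord_dist_sum sum.distrib sum_distrib_left [symmetric] by simp
  qed
  have min_z: "\<Phi> z \<le> \<Phi> y" if "y \<in> K" for y
  proof -
    have "0 \<le> a * (coord_dist n rk y z)\<^sup>2" "0 \<le> 1 / (2 * \<mu>) * gap y"
      using a \<mu> gap_nonneg [OF that] by auto
    with key [OF that] show ?thesis
      by linarith
  qed
  have unique: "y = z" if y: "y \<in> K" and le: "\<Phi> y \<le> \<Phi> z" for y
  proof -
    have nn: "0 \<le> a * (coord_dist n rk y z)\<^sup>2" "0 \<le> 1 / (2 * \<mu>) * gap y"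
      using a \<mu> gap_nonneg [OF y] by auto
    with key [OF y] le have "a * (coord_dist n rk y z)\<^sup>2 = 0" "1 / (2 * \<mu>) * gap y = 0"
      by linarith+
    then have 0: "coord_dist n rk y z = 0" "gap y = 0"
      using a \<mu> by auto
    show ?thesis
    proof (rule K_eq_of_coord_eq [OF x y z(1) _ z(3)])
      show "coord rk y j = coord rk z j" if "j \<in> {1..n}" for j
        using 0(1) that by (simp add: coord_dist_def L2_set_eq_0_iff)
      show "oc_dist N x y \<le> coord_dist n rk x y"
        by (rule power2_le_imp_le) (use 0(2) in \<open>simp add: gap_def\<close>, rule coord_dist_nonneg)
    qed
  qed
  have "proximal_minimizer N f \<mu> x y \<longleftrightarrow> y \<in> K \<and> (\<forall>w\<in>K. \<Phi> y \<le> \<Phi> w)"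
    unfolding proximal_minimizer_def is_arg_min_def \<Phi>_def by (auto simp: not_less)
  also have "\<dots> \<longleftrightarrow> y = z"
    using min_z unique z(1) by blast
  finally show ?thesis
    by (simp add: z_def)
qed

end


section \<open>Ranks in the lattices of subspaces\<close>

context vec_space
begin

abbreviation "sub W \<equiv> VectorSpace.subspace class_ring W V"

lemma sub_iff:
  "sub W \<longleftrightarrow> W \<subseteq> carrier_vec n \<and> 0\<^sub>v n \<in> W \<and> (\<forall>u\<in>W. \<forall>v\<in>W. u + v \<in> W) \<and> (\<forall>c. \<forall>v\<in>W. c \<cdot>\<^sub>v v \<in> W)"
proof -
  have "Module.module class_ring V"
    by (rule vec_module)
  moreover have "vectorspace class_ring V"
    by (rule vec_vs)
  ultimately show ?thesis
    unfolding VectorSpace.subspace_def submodule_def by (auto simp: module_vec_simps class_ring_simps)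
qed

lemma sub_submodule: "sub W \<Longrightarrow> submodule class_ring W V"
  by (simp add: VectorSpace.subspace_def)

lemma sub_Int: "sub W \<Longrightarrow> sub Q \<Longrightarrow> sub (W \<inter> Q)"
  unfolding sub_iff by blast

lemma sub_carrier: "sub (carrier_vec n)"
  unfolding sub_iff by auto

lemma sub_zero: "sub {0\<^sub>v n}"
  unfolding sub_iff by auto

section \<open>Bases of subspaces and the modular inequality for dimensions\<close>

definition basis_of :: "'a vec set \<Rightarrow> 'a vec set \<Rightarrow> bool" where
  "basis_of W B \<longleftrightarrow> B \<subseteq> W \<and> lin_indpt B \<and> finite B \<and> span B = W"

text \<open>Span and linear dependence computed inside W agree with those in the ambient space, so
  all later arguments can use ambient bases.\<close>

lemma subspace_dim_basis_of:
  assumes W: "sub W" and B: "basis_of W B"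
  shows "subspace_dim n W = card B"
proof -
  interpret w: vectorspace class_ring "V\<lparr>carrier := W\<rparr>"
    using W by (rule subspace_is_vs)
  have B': "B \<subseteq> W" "lin_indpt B" "finite B" "span B = W"
    using B by (auto simp: basis_of_def)
  have "LinearCombinations.module.span class_ring (V\<lparr>carrier := W\<rparr>) B = span B"
    "LinearCombinations.module.lin_dep class_ring (V\<lparr>carrier := W\<rparr>) B = lin_dep B"
    using span_li_not_depend [OF B'(1) sub_submodule [OF W]] by auto
  with B' have "w.basis B"
    unfolding w.basis_def by simp
  then have "w.dim = card B"
    using w.dim_basis B'(3) by blast
  then show ?thesis
    by (simp add: subspace_dim_def)
qed

text \<open>An independent set between A and W of greatest cardinality spans W: a vector of W
  outside its span could be added.\<close>

lemma basis_of_extend: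
  assumes W: "sub W" and A: "A \<subseteq> W" "lin_indpt A"
  shows "\<exists>B. A \<subseteq> B \<and> basis_of W B"
proof -
  have Wc: "W \<subseteq> carrier_vec n"
    using W by (simp add: sub_iff)
  define P where "P B \<longleftrightarrow> A \<subseteq> B \<and> B \<subseteq> W \<and> lin_indpt B" for B
  have "P A"
    using A by (simp add: P_def)
  moreover have bound: "finite B \<and> card B \<le> dim" if "P B" for B
    using li_le_dim [OF fin_dim, of B] that Wc by (auto simp: P_def)
  ultimately obtain B where B: "P B" "\<And>C. P C \<Longrightarrow> card C \<le> card B"
    using ex_has_greatest_nat [of P A card "Suc dim"] by (metis less_Suc_eq_le)
  then have B': "A \<subseteq> B" "B \<subseteq> W" "lin_indpt B" and fin: "finite B"
    using bound by (auto simp: P_def)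
  have "w \<in> span B" if "w \<in> W" for w
  proof (rule ccontr)
    assume w: "w \<notin> span B"
    then have "w \<notin> B"
      using in_own_span [of B] B' Wc by blast
    then have "lin_indpt (B \<union> {w})"
      using lin_dep_iff_in_span [of B w] w B' Wc that by blast
    then have "P (B \<union> {w})"
      using B' that by (auto simp: P_def)
    from B(2) [OF this] fin \<open>w \<notin> B\<close> show False
      by simp
  qed
  moreover have "span B \<subseteq> W"
    using span_is_subset [OF B'(2) sub_submodule [OF W]] .
  ultimately have "basis_of W B"
    using B' fin by (auto simp: basis_of_def)
  with B' show ?thesis
    by blast
qed

lemma obtain_basis_of:
  assumes "sub W"
  obtains B where "basis_of W B"
proof -
  have "lin_indpt {}"
    by (simp add: lin_dep_def)
  then show ?thesis
    using basis_of_extend [OF assms, of "{}"] that by blast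
qed

lemma subspace_dim_mono:
  assumes "sub W" "sub W'" "W \<subseteq> W'"
  shows "subspace_dim n W \<le> subspace_dim n W'"
    and "subspace_dim n W = subspace_dim n W' \<Longrightarrow> W = W'"
proof -
  obtain B where B: "basis_of W B"
    using obtain_basis_of [OF assms(1)] .
  then obtain B' where B': "B \<subseteq> B'" "basis_of W' B'"
    using basis_of_extend [OF assms(2), of B] assms(3) unfolding basis_of_def [of W] by blast
  have dims: "subspace_dim n W = card B" "subspace_dim n W' = card B'"
    using subspace_dim_basis_of assms B B' by auto
  have "finite B'"
    using B' by (simp add: basis_of_def)
  then show "subspace_dim n W \<le> subspace_dim n W'"
    unfolding dims using B'(1) by (rule card_mono)
  assume "subspace_dim n W = subspace_dim n W'"
  then have "B = B'"
    using card_subset_eq [OF \<open>finite B'\<close> B'(1)] dims by simp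
  then show "W = W'"
    using B B'(2) by (simp add: basis_of_def)
qed

lemma subspace_dim_zero: "subspace_dim n {0\<^sub>v n :: 'a vec} = 0"
proof -
  obtain B where B: "basis_of {0\<^sub>v n} B"
    using obtain_basis_of [OF sub_zero] .
  have "(1 :: 'a) \<noteq> 0"
    by simp
  then have "(UNIV :: 'a set) \<noteq> {0}"
    by blast
  then have "0\<^sub>v n \<notin> B"
    using B zero_nin_lin_indpt [of B] sub_zero by (auto simp: basis_of_def)
  then have "B = {}"
    using B by (auto simp: basis_of_def)
  then show ?thesis
    using subspace_dim_basis_of [OF sub_zero B] by simp
qed

lemma subspace_dim_carrier: "subspace_dim n (carrier_vec n :: 'a vec set) = n"
proof -
  have "basis_of (carrier_vec n) (set (unit_vecs n))"
    using unit_vecs_basis by (simp add: basis_of_def basis_def)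
  then show ?thesis
    using subspace_dim_basis_of [OF sub_carrier] distinct_card [OF unit_vecs_distinct]
    by (metis unit_vecs_length)
qed

lemma obtain_intermediate:
  assumes "sub W" "sub W'" "W \<subseteq> W'" "subspace_dim n W < subspace_dim n W'"
  obtains U where "sub U" "W \<subseteq> U" "U \<subseteq> W'" "subspace_dim n U = Suc (subspace_dim n W)"
proof -
  obtain B where B: "basis_of W B"
    using obtain_basis_of [OF assms(1)] .
  then obtain B' where B': "B \<subseteq> B'" "basis_of W' B'"
    using basis_of_extend [OF assms(2), of B] assms(3) unfolding basis_of_def [of W] by blast
  have "B \<noteq> B'"
    using subspace_dim_basis_of [OF assms(1) B] subspace_dim_basis_of [OF assms(2) B'(2)] assms(4) by auto
  then obtain b where b: "b \<in> B'" "b \<notin> B"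
    using B' by blast
  have W'c: "W' \<subseteq> carrier_vec n"
    using assms(2) by (simp add: sub_iff)
  have sub': "insert b B \<subseteq> B'" "B' \<subseteq> carrier_vec n"
    using b B' W'c by (auto simp: basis_of_def)
  define U where "U = span (insert b B)"
  have U: "sub U"
    unfolding U_def by (rule span_is_subspace) (use sub' in auto)
  have bU: "basis_of U (insert b B)"
    using in_own_span [of "insert b B"] subset_li_is_li [of B' "insert b B"] sub' B B'
    by (auto simp: basis_of_def U_def)
  have "W \<subseteq> U"
    using span_is_monotone [of B "insert b B"] B sub' by (auto simp: basis_of_def U_def)
  moreover have "U \<subseteq> W'"
    using span_is_monotone [of "insert b B" B'] B' sub' by (auto simp: basis_of_def U_def)
  moreover have "subspace_dim n U = Suc (subspace_dim n W)"
    using subspace_dim_basis_of [OF U bU] subspace_dim_basis_of [OF assms(1) B] B b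
    by (simp add: basis_of_def)
  ultimately show ?thesis
    using that U by blast
qed

lemma in_span_insert:
  assumes "finite B" "B \<subseteq> carrier_vec n" "v \<in> carrier_vec n" "v \<notin> B" "u \<in> span (insert v B)"
  shows "\<exists>c. \<exists>w\<in>span B. u = c \<cdot>\<^sub>v v + w"
proof -
  obtain a where "lincomb a (B \<union> {v}) = u"
    using finite_in_span [of "B \<union> {v}" u] assms by auto
  moreover have "lincomb a (B \<union> {v}) = a v \<cdot>\<^sub>v v + lincomb a B"
    using lincomb_insert [where S = B and a = a and v = v] assms by simp
  moreover have "lincomb a B \<in> span B"
    using assms(1) unfolding span_def by auto
  ultimately show ?thesis
    by metis
qed

text \<open>If W' \<inter> Q contains some v outside W, then W' is W plus the line of v. Subtracting
  a multiple of v from an element of W' \<inter> Q leads into W and stays in Q, so W' \<inter> Q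
  lies in W \<inter> Q plus that line.\<close>

lemma subspace_dim_modular_step:
  assumes W: "sub W" "sub W'" and sub: "W \<subseteq> W'" and dim: "subspace_dim n W' = Suc (subspace_dim n W)"
    and Q: "sub Q"
  shows "subspace_dim n (W' \<inter> Q) \<le> Suc (subspace_dim n (W \<inter> Q))"
proof (cases "W' \<inter> Q \<subseteq> W")
  case True
  then have "W' \<inter> Q = W \<inter> Q"
    using sub by blast
  then show ?thesis
    by simp
next
  case False
  then obtain v where v: "v \<in> W'" "v \<in> Q" "v \<notin> W"
    by blast
  obtain B where B: "basis_of W B"
    using obtain_basis_of [OF W(1)] .
  obtain D where D: "basis_of (W \<inter> Q) D"
    using obtain_basis_of [OF sub_Int [OF W(1) Q]] .
  have c: "W \<subseteq> carrier_vec n" "W' \<subseteq> carrier_vec n" "B \<subseteq> carrier_vec n" "D \<subseteq> carrier_vec n" "v \<in> carrier_vec n"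
    using W B D v by (auto simp: sub_iff basis_of_def)
  have vB: "v \<notin> B" "v \<notin> D"
    using B D v by (auto simp: basis_of_def)
  have indep: "lin_indpt (insert v B)"
    using lin_dep_iff_in_span [of B v] B c vB v by (auto simp: basis_of_def)
  have "insert v B \<subseteq> W'"
    using v B sub by (auto simp: basis_of_def)
  then obtain B' where B': "insert v B \<subseteq> B'" "basis_of W' B'"
    using basis_of_extend [OF W(2) _ indep] by blast
  have "card B' = card (insert v B)"
    using subspace_dim_basis_of [OF W(1) B] subspace_dim_basis_of [OF W(2) B'(2)] dim vB B
    by (simp add: basis_of_def)
  then have "B' = insert v B"
    using B' card_subset_eq by (metis basis_of_def)
  then have W'_span: "W' = span (insert v B)"
    using B' by (simp add: basis_of_def)
  define U where "U = span (insert v D)"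
  have U: "sub U"
    unfolding U_def by (rule span_is_subspace) (use c in auto)
  have "lin_indpt (insert v D)"
    using lin_dep_iff_in_span [of D v] D c vB v by (auto simp: basis_of_def)
  then have bU: "basis_of U (insert v D)"
    using in_own_span [of "insert v D"] c D by (auto simp: basis_of_def U_def)
  then have dimU: "subspace_dim n U = Suc (subspace_dim n (W \<inter> Q))"
    using subspace_dim_basis_of [OF U bU] subspace_dim_basis_of [OF sub_Int [OF W(1) Q] D] vB D
    by (simp add: basis_of_def)
  have "W' \<inter> Q \<subseteq> U"
  proof
    fix u assume u: "u \<in> W' \<inter> Q"
    then obtain a w where w: "w \<in> span B" "u = a \<cdot>\<^sub>v v + w"
      using in_span_insert [OF _ c(3,5) vB(1), of u] B W'_span unfolding basis_of_def by blast
    then have wW: "w \<in> W"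
      using B by (simp add: basis_of_def)
    have "u + (- a) \<cdot>\<^sub>v v \<in> Q"
      using u v Q unfolding sub_iff by blast
    moreover have "u + (- a) \<cdot>\<^sub>v v = w"
      unfolding w using wW c by (intro eq_vecI) auto
    ultimately have "w \<in> span D"
      using wW D by (simp add: basis_of_def)
    then have "w \<in> U"
      using span_is_monotone [of D "insert v D"] c by (auto simp: U_def)
    moreover have "v \<in> U"
      using in_own_span [of "insert v D"] c by (auto simp: U_def)
    ultimately show "u \<in> U"
      unfolding w using U unfolding sub_iff by blast
  qed
  then show ?thesis
    using subspace_dim_mono(1) [OF sub_Int [OF W(2) Q] U] dimU by simp
qed

text \<open>Going from W to W' by one dimension at a time, the intersection with Q grows by at most
  one in each step. With W' the whole space this is the bound from below for the dimension of an
  intersection.\<close>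

lemma subspace_dim_modular:
  assumes "sub W" "sub W'" "W \<subseteq> W'" "sub Q"
  shows "subspace_dim n (W' \<inter> Q) + subspace_dim n W \<le> subspace_dim n W' + subspace_dim n (W \<inter> Q)"
  using assms
proof (induction "subspace_dim n W' - subspace_dim n W" arbitrary: W)
  case 0
  then have "W = W'"
    using subspace_dim_mono [of W W'] by simp
  then show ?case
    by simp
next
  case (Suc d)
  then have "subspace_dim n W < subspace_dim n W'"
    by simp
  then obtain U where U: "sub U" "W \<subseteq> U" "U \<subseteq> W'" "subspace_dim n U = Suc (subspace_dim n W)"
    using obtain_intermediate Suc.prems by blast
  have "subspace_dim n (W' \<inter> Q) + subspace_dim n U \<le> subspace_dim n W' + subspace_dim n (U \<inter> Q)"
    using Suc.hyps(1) [of U] Suc.hyps(2) Suc.prems U by simp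
  moreover have "subspace_dim n (U \<inter> Q) \<le> Suc (subspace_dim n (W \<inter> Q))"
    using subspace_dim_modular_step [OF Suc.prems(1) U(1,2,4) Suc.prems(4)] .
  ultimately show ?case
    using U(4) by simp
qed

section \<open>The two orders as ranked orders\<close>

lemma subspace_lattice_simps [simp]:
  "carrier (subspace_lattice n :: 'a vec set gorder) = {W. sub W}"
  "le (subspace_lattice n :: 'a vec set gorder) = (\<subseteq>)"
  "eq (subspace_lattice n :: 'a vec set gorder) = (=)"
  "carrier (subspace_lattice_rev n :: 'a vec set gorder) = {W. sub W}"
  "le (subspace_lattice_rev n :: 'a vec set gorder) = (\<lambda>U W. W \<subseteq> U)"
  "eq (subspace_lattice_rev n :: 'a vec set gorder) = (=)"
  by (simp_all add: subspace_lattice_def subspace_lattice_rev_def)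

lemma sub_bounds: "sub W \<Longrightarrow> W \<subseteq> carrier_vec n" "sub W \<Longrightarrow> 0\<^sub>v n \<in> W"
  by (auto simp: sub_iff)

lemma subspace_dim_le: "sub W \<Longrightarrow> subspace_dim n W \<le> n"
  using subspace_dim_mono(1) [OF _ sub_carrier sub_bounds(1)] subspace_dim_carrier by metis

lemma subspace_dim_Int_less:
  assumes "sub W" "sub Q" "subspace_dim n W = subspace_dim n Q" "W \<noteq> Q"
  shows "subspace_dim n (W \<inter> Q) < subspace_dim n Q"
proof -
  have "subspace_dim n (W \<inter> Q) \<le> subspace_dim n Q"
    by (rule subspace_dim_mono) (use assms sub_Int in auto)
  moreover have "subspace_dim n (W \<inter> Q) \<noteq> subspace_dim n Q"
  proof
    assume "subspace_dim n (W \<inter> Q) = subspace_dim n Q"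
    then have "W \<inter> Q = Q"
      using subspace_dim_mono(2) [of "W \<inter> Q" Q] assms sub_Int by blast
    then have "Q = W"
      using subspace_dim_mono(2) [of Q W] assms by auto
    with assms(4) show False
      by simp
  qed
  ultimately show ?thesis
    by simp
qed

lemma ranked_order_subspace_lattice:
  "ranked_order (subspace_lattice n :: 'a vec set gorder) n (subspace_dim n)
     (\<lambda>Q W. subspace_dim n (W \<inter> Q)) {0\<^sub>v n} (carrier_vec n)"
proof (unfold_locales; (unfold subspace_lattice_simps mem_Collect_eq)?)
  fix Q p q :: "'a vec set" assume "sub Q" "sub p" "sub q" "p \<subseteq> q"
  then show "subspace_dim n (p \<inter> Q) \<le> subspace_dim n (q \<inter> Q)"
    by (intro subspace_dim_mono) (auto intro: sub_Int)
  show "subspace_dim n p - subspace_dim n (p \<inter> Q) \<le> subspace_dim n q - subspace_dim n (q \<inter> Q)"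
    using subspace_dim_modular [OF \<open>sub p\<close> \<open>sub q\<close> \<open>p \<subseteq> q\<close> \<open>sub Q\<close>] by simp
next
  fix p q :: "'a vec set" assume "sub p" "sub q" "p \<subseteq> q" "subspace_dim n p < subspace_dim n q"
  then show "\<exists>r\<in>{W. sub W}. p \<subseteq> r \<and> r \<subseteq> q \<and> subspace_dim n r = Suc (subspace_dim n p)"
    using obtain_intermediate by (metis mem_Collect_eq)
next
  fix Q p :: "'a vec set" assume "sub Q" "sub p"
  then show "subspace_dim n (p \<inter> Q) \<le> subspace_dim n p"
    by (intro subspace_dim_mono) (auto intro: sub_Int)
qed (auto simp: sub_bounds sub_zero sub_carrier subspace_dim_zero subspace_dim_carrier
    intro: subspace_dim_mono subspace_dim_Int_less dest: subspace_dim_mono(2))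

text \<open>The meet in the reverse order is the sum of subspaces; by the dimension formula its rank
  n - dim (W + Q) is \<open>n + subspace_dim n (W \<inter> Q) - subspace_dim n W - subspace_dim n
  Q\<close>. Thus everything is expressed through intersections, and \<open>mod\<close> shows that
  the subtraction of natural numbers is not truncated.\<close>

lemma ranked_order_subspace_lattice_rev:
  "ranked_order (subspace_lattice_rev n :: 'a vec set gorder) n (\<lambda>W. n - subspace_dim n W)
     (\<lambda>Q W. n + subspace_dim n (W \<inter> Q) - subspace_dim n W - subspace_dim n Q) (carrier_vec n) {0\<^sub>v n}"
proof (unfold_locales; (unfold subspace_lattice_simps mem_Collect_eq)?)
  have mod: "subspace_dim n p + subspace_dim n Q \<le> n + subspace_dim n (p \<inter> Q)"
    if "sub p" "sub Q" for p Q :: "'a vec set"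
    using subspace_dim_modular [OF that(1) sub_carrier _ that(2)] sub_bounds(1) that
    by (simp add: Int_absorb1 subspace_dim_carrier)
  have Int_le: "subspace_dim n (p \<inter> Q) \<le> subspace_dim n p" "subspace_dim n (p \<inter> Q) \<le> subspace_dim n Q"
    if "sub p" "sub Q" for p Q :: "'a vec set"
    using that by (auto intro!: subspace_dim_mono sub_Int)
  {
    fix Q p q :: "'a vec set" assume s: "sub Q" "sub p" "sub q" "q \<subseteq> p"
    show "n + subspace_dim n (p \<inter> Q) - subspace_dim n p - subspace_dim n Q
        \<le> n + subspace_dim n (q \<inter> Q) - subspace_dim n q - subspace_dim n Q"
      using subspace_dim_modular [OF s(3,2,4,1)] by simp
    \<comment> \<open>The complementary component equals dim Q - dim (p \<inter> Q), so here its
      monotonicity is that of intersections, while the monotonicity of \<open>mr\<close> is the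
      modular inequality; under inclusion the roles are exchanged.\<close>
    have "subspace_dim n (q \<inter> Q) \<le> subspace_dim n (p \<inter> Q)"
      using s by (intro subspace_dim_mono) (auto intro: sub_Int)
    then show "n - subspace_dim n p - (n + subspace_dim n (p \<inter> Q) - subspace_dim n p - subspace_dim n Q)
        \<le> n - subspace_dim n q - (n + subspace_dim n (q \<inter> Q) - subspace_dim n q - subspace_dim n Q)"
      using mod [OF s(2,1)] mod [OF s(3,1)] subspace_dim_le [OF s(2)] subspace_dim_le [OF s(3)]
        Int_le [OF s(2,1)] Int_le [OF s(3,1)]
      by linarith
  next
    fix p q :: "'a vec set" assume s: "sub p" "sub q" "q \<subseteq> p"
    show "n - subspace_dim n p \<le> n - subspace_dim n q"
      using subspace_dim_mono(1) [OF s(2,1,3)] by simp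
    {
      assume "n - subspace_dim n p = n - subspace_dim n q"
      then have "subspace_dim n q = subspace_dim n p"
        using subspace_dim_le [OF s(1)] subspace_dim_le [OF s(2)] by simp
      then show "p = q"
        using subspace_dim_mono(2) [OF s(2,1,3)] by simp
    next
      assume l: "n - subspace_dim n p < n - subspace_dim n q"
      \<comment> \<open>Now a subspace of codimension 1 in p that contains q is needed, whereas
        \<open>obtain_intermediate\<close> adds one dimension to the smaller space. A maximal chain
        for inclusion through q and p passes through every dimension.\<close>
      interpret L: ranked_order "subspace_lattice n :: 'a vec set gorder" n "subspace_dim n"
        "\<lambda>Q W. subspace_dim n (W \<inter> Q)" "{0\<^sub>v n}" "carrier_vec n"
        by (rule ranked_order_subspace_lattice)
      have "\<exists>r. sub r \<and> q \<subseteq> r \<and> r \<subseteq> p \<and> Suc (subspace_dim n r) = subspace_dim n p"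
      proof -
        obtain ps where ps: "maximal_chain (subspace_lattice n :: 'a vec set gorder) ps" "{q, p} \<subseteq> set ps"
          using L.obtain_maximal_chain [of "{q, p}"] s by (auto simp: L.is_chain_def)
        have ch: "L.is_chain (set ps)"
          using ps L.lattice_chain_set by (auto simp: maximal_chain_def)
        have "subspace_dim n p - 1 \<in> set (map (subspace_dim n) ps)"
          unfolding L.maximal_chain_rk [OF ps(1)] using subspace_dim_le [OF s(1)] by (simp del: upt_Suc)
        then obtain r where r: "r \<in> set ps" "subspace_dim n r = subspace_dim n p - 1"
          by auto
        then show ?thesis
          using L.is_chain_le [OF ch, of q r] L.is_chain_le [OF ch, of r p] ps(2) l ch
          by (intro exI [of _ r]) (auto simp: L.is_chain_def)
      qed
      then show "\<exists>r\<in>{W. sub W}. r \<subseteq> p \<and> q \<subseteq> r \<and> n - subspace_dim n r = Suc (n - subspace_dim n p)"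
        using subspace_dim_le [OF s(1)] by (auto intro!: bexI)
    }
  next
    fix Q p :: "'a vec set" assume s: "sub Q" "sub p"
    show "n + subspace_dim n (p \<inter> Q) - subspace_dim n p - subspace_dim n Q \<le> n - subspace_dim n p"
      using Int_le [OF s(2,1)] by simp
    {
      assume "n - subspace_dim n p = n - subspace_dim n Q" "p \<noteq> Q"
      then have "subspace_dim n p = subspace_dim n Q"
        using subspace_dim_le [OF s(1)] subspace_dim_le [OF s(2)] by simp
      with subspace_dim_Int_less [OF s(2,1) this \<open>p \<noteq> Q\<close>] mod [OF s(2,1)] subspace_dim_le [OF s(1)]
      show "n + subspace_dim n (p \<inter> Q) - subspace_dim n p - subspace_dim n Q < n - subspace_dim n Q"
        by linarith
    }
  next
    fix Q :: "'a vec set" assume "sub Q"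
    then show "n + subspace_dim n (Q \<inter> Q) - subspace_dim n Q - subspace_dim n Q = n - subspace_dim n Q"
      by simp
  }
qed (auto simp: sub_bounds sub_zero sub_carrier subspace_dim_zero subspace_dim_carrier)

lemma bottom_subspace_lattice: "\<bottom>\<^bsub>subspace_lattice n\<^esub> = ({0\<^sub>v n} :: 'a vec set)"
proof -
  have least: "least (subspace_lattice n :: 'a vec set gorder) x (carrier (subspace_lattice n))
      \<longleftrightarrow> sub x \<and> (\<forall>W. sub W \<longrightarrow> x \<subseteq> W)" for x
    unfolding least_def subspace_lattice_simps by blast
  show ?thesis
    unfolding bottom_def least using sub_bounds(2) sub_zero by (intro some_equality) blast+
qed

lemma bottom_subspace_lattice_rev: "\<bottom>\<^bsub>subspace_lattice_rev n\<^esub> = (carrier_vec n :: 'a vec set)"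
proof -
  have least: "least (subspace_lattice_rev n :: 'a vec set gorder) x (carrier (subspace_lattice_rev n))
      \<longleftrightarrow> sub x \<and> (\<forall>W. sub W \<longrightarrow> W \<subseteq> x)" for x
    unfolding least_def subspace_lattice_simps by blast
  show ?thesis
    unfolding bottom_def least using sub_bounds(1) sub_carrier by (intro some_equality) blast+
qed

end


section \<open>Matrices representing the whole space\<close>

abbreviation matrix_of :: "nat \<Rightarrow> (nat \<Rightarrow> nat \<Rightarrow> 'a) \<Rightarrow> 'a mat" where
  "matrix_of n A \<equiv> mat n n (\<lambda>(i, j). A i j)"

section \<open>Triangulation by row additions\<close>

definition add_row :: "'a::field \<Rightarrow> nat \<Rightarrow> nat \<Rightarrow> (nat \<Rightarrow> nat \<Rightarrow> 'a) \<Rightarrow> nat \<Rightarrow> nat \<Rightarrow> 'a" where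
  "add_row a k l A = (\<lambda>i j. if i = k then A i j + a * A l j else A i j)"

lemma det_add_row:
  assumes "k < n" "l < n" "k \<noteq> l"
  shows "det (matrix_of n (add_row a k l A)) = det (matrix_of n A)"
proof -
  have "matrix_of n (add_row a k l A) = addrow a k l (matrix_of n A)"
    by (rule eq_matI) (use assms in \<open>auto simp: add_row_def\<close>)
  then show ?thesis
    using det_addrow [OF assms(2,3), of "matrix_of n A"] by simp
qed

text \<open>If the pivot \<open>A c c\<close> vanishes, row \<open>r\<close> is first added to row \<open>c\<close>. Should the pivot still vanish,
  then so does \<open>A r c\<close>, and the subsequent step is void because \<open>x / 0 = 0\<close>. So a determinant-preserving
  triangulation needs no search for a pivot.\<close>

definition make_pivot :: "nat \<Rightarrow> nat \<Rightarrow> (nat \<Rightarrow> nat \<Rightarrow> 'a::field) \<Rightarrow> nat \<Rightarrow> nat \<Rightarrow> 'a" where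
  "make_pivot c r A = (if A c c = 0 then add_row 1 c r A else A)"

definition clear_step :: "nat \<Rightarrow> nat \<Rightarrow> (nat \<Rightarrow> nat \<Rightarrow> 'a::field) \<Rightarrow> nat \<Rightarrow> nat \<Rightarrow> 'a" where
  "clear_step c r A = (if c < r then add_row (- (make_pivot c r A r c / make_pivot c r A c c)) r c (make_pivot c r A) else A)"

lemma det_clear_step:
  assumes "c < n" "r < n"
  shows "det (matrix_of n (clear_step c r A)) = det (matrix_of n A)"
  using assms by (simp add: clear_step_def make_pivot_def det_add_row)

definition cleared :: "nat \<Rightarrow> nat \<Rightarrow> nat \<Rightarrow> (nat \<Rightarrow> nat \<Rightarrow> 'a::field) \<Rightarrow> bool" where
  "cleared n c r A \<longleftrightarrow> (\<forall>i<n. \<forall>j<i. j < c \<or> j = c \<and> i < r \<longrightarrow> A i j = 0)"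

lemma cleared_step:
  assumes "cleared n c r A" "c < n" "r < n"
  shows "cleared n c (Suc r) (clear_step c r A)"
proof (cases "c < r")
  case True
  have A: "A i j = 0" if "i < n" "j < i" "j < c \<or> j = c \<and> i < r" for i j
    using assms(1) that by (auto simp: cleared_def)
  let ?B = "make_pivot c r A"
  \<comment> \<open>Making the pivot adds row r to row c, and both rows vanish to the left of column
    c.\<close>
  have B: "?B i j = 0" if "i < n" "j < i" "j < c \<or> j = c \<and> i < r" for i j
  proof (cases "i = c")
    case c: True
    then have "j < c"
      using that by auto
    then show ?thesis
      using A [of c j] A [of r j] c assms True by (auto simp: make_pivot_def add_row_def)
  next
    case False
    then show ?thesis
      using A [OF that] by (auto simp: make_pivot_def add_row_def)
  qed
  have pivot: "?B c c = 0 \<Longrightarrow> ?B r c = 0"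
    using True by (auto simp: make_pivot_def add_row_def split: if_splits)
  have "clear_step c r A i j = 0" if ij: "i < n" "j < i" "j < c \<or> j = c \<and> i < Suc r" for i j
  proof (cases "i = r")
    case i: True
    show ?thesis
    proof (cases "j = c")
      case True
      then show ?thesis
        using pivot i \<open>c < r\<close> by (cases "?B c c = 0") (auto simp: clear_step_def add_row_def)
    next
      case False
      then have "?B r j = 0" "?B c j = 0"
        using ij i B [of r j] B [of c j] assms True by auto
      then show ?thesis
        using i True by (simp add: clear_step_def add_row_def)
    qed
  next
    case False
    then show ?thesis
      using B [of i j] ij True by (auto simp: clear_step_def add_row_def)
  qed
  then show ?thesis
    by (auto simp: cleared_def)
next
  case False
  then show ?thesis
    using assms by (auto simp: cleared_def clear_step_def)
qed

lemma cleared_next_column: "cleared n c n A \<Longrightarrow> cleared n (Suc c) 0 A"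
  by (auto simp: cleared_def less_Suc_eq)

lemma det_cleared:
  assumes "cleared n n r A"
  shows "det (matrix_of n A) \<noteq> 0 \<longleftrightarrow> (\<forall>i<n. A i i \<noteq> 0)"
proof -
  have "upper_triangular (matrix_of n A)"
    using assms by (auto simp: upper_triangular_def cleared_def)
  then have "det (matrix_of n A) = prod_list (diag_mat (matrix_of n A))"
    by (rule det_upper_triangular [of _ n]) simp
  then show ?thesis
    by (auto simp: diag_mat_def prod_list_zero_iff)
qed

text \<open>For a singular A some nonzero v is annihilated by the transpose, hence orthogonal to the
  image of A. If that image contained all unit vectors, every entry of v would be 0.\<close>

lemma represented_Image_full:
  fixes A :: "'a::field mat"
  assumes A: "A \<in> carrier_mat n n"
  shows "represented_subspace Image A = carrier_vec n \<longleftrightarrow> det A \<noteq> 0"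
proof
  assume "det A \<noteq> 0"
  from det_non_zero_imp_unit [OF A this, of "()"]
  obtain B where B: "B \<in> carrier_mat n n" "A * B = 1\<^sub>m n"
    unfolding Units_def ring_mat_def by auto
  have "v \<in> (\<lambda>v. A *\<^sub>v v) ` carrier_vec n" if v: "v \<in> carrier_vec n" for v
  proof
    show "v = A *\<^sub>v (B *\<^sub>v v)"
      using assoc_mult_mat_vec [OF A B(1) v] B(2) v by simp
    show "B *\<^sub>v v \<in> carrier_vec n"
      using B(1) v by simp
  qed
  moreover have "A *\<^sub>v v \<in> carrier_vec n" if "v \<in> carrier_vec n" for v
    using A that by simp
  ultimately show "represented_subspace Image A = carrier_vec n"
    using A by auto
next
  assume full: "represented_subspace Image A = carrier_vec n"
  show "det A \<noteq> 0"
  proof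
    assume "det A = 0"
    then have "det (transpose_mat A) = 0"
      using det_transpose [OF A] by simp
    then obtain v where v: "v \<in> carrier_vec n" "v \<noteq> 0\<^sub>v n" "transpose_mat A *\<^sub>v v = 0\<^sub>v n"
      using det_0_iff_vec_prod_zero_field [of "transpose_mat A" n] A by auto
    have "v $ i = 0" if i: "i < n" for i
    proof -
      have "unit_vec n i \<in> represented_subspace Image A"
        unfolding full by simp
      then obtain u where u: "u \<in> carrier_vec n" "unit_vec n i = A *\<^sub>v u"
        using A by auto
      have "v $ i = v \<bullet> (A *\<^sub>v u)"
        using v(1) i by (simp add: u(2) [symmetric])
      also have "\<dots> = (transpose_mat A *\<^sub>v v) \<bullet> u"
        by (rule transpose_vec_mult_scalar [OF A u(1) v(1), symmetric])
      also have "\<dots> = 0"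
        using u(1) by (simp add: v(3))
      finally show ?thesis .
    qed
    then have "v = 0\<^sub>v n"
      using v(1) by (intro eq_vecI) auto
    with v(2) show False
      by simp
  qed
qed

lemma represented_Kernel_full:
  fixes A :: "'a::field mat"
  assumes A: "A \<in> carrier_mat n n"
  shows "represented_subspace Kernel A = carrier_vec n \<longleftrightarrow> (\<forall>i<n. \<forall>j<n. A $$ (i, j) = 0)"
proof
  assume full: "represented_subspace Kernel A = carrier_vec n"
  show "\<forall>i<n. \<forall>j<n. A $$ (i, j) = 0"
  proof (intro allI impI)
    fix i j assume ij: "i < n" "j < n"
    have "unit_vec n j \<in> mat_kernel A"
      using full by simp
    then have "A *\<^sub>v unit_vec n j = 0\<^sub>v n"
      using mat_kernelD [OF A] by blast
    then have "(A *\<^sub>v unit_vec n j) $ i = 0"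
      using ij by simp
    then show "A $$ (i, j) = 0"
      using A ij by simp
  qed
next
  assume "\<forall>i<n. \<forall>j<n. A $$ (i, j) = 0"
  then have "A = 0\<^sub>m n n"
    using A by (intro eq_matI) auto
  then show "represented_subspace Kernel A = carrier_vec n"
    by (auto simp: mat_kernel [of "0\<^sub>m n n" n n] intro!: eq_vecI)
qed

text \<open>The identity matrix as generator of an image, the zero matrix as system of equations of
  a kernel.\<close>

definition full_entry :: "representation \<Rightarrow> nat \<Rightarrow> nat \<Rightarrow> 'a::field" where
  "full_entry rep i j = (if rep = Image \<and> i = j then 1 else 0)"

lemma represented_full_entry:
  "represented_subspace rep (matrix_of n (full_entry rep :: nat \<Rightarrow> nat \<Rightarrow> 'a::field)) = carrier_vec n"
proof (cases rep)
  case Image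
  have "matrix_of n (full_entry Image :: nat \<Rightarrow> nat \<Rightarrow> 'a) = 1\<^sub>m n"
    by (rule eq_matI) (auto simp: full_entry_def)
  then show ?thesis
    using represented_Image_full [of "1\<^sub>m n :: 'a mat" n] Image by simp
next
  case Kernel
  then show ?thesis
    by (subst Kernel, subst represented_Kernel_full) (auto simp: full_entry_def)
qed


section \<open>Running times of structured programs\<close>

text \<open>A total correctness triple with an upper bound on time; bounds, unlike exact counts, do
  not depend on the branches taken.\<close>

definition runs :: "program \<Rightarrow> 'k::field state \<Rightarrow> nat \<Rightarrow> ('k state \<Rightarrow> bool) \<Rightarrow> bool" where
  "runs P s T Q \<longleftrightarrow> (\<exists>t s'. exec P s t s' \<and> t \<le> T \<and> Q s')"

lemma runs_Seq:
  assumes "runs P s T R" "\<And>s'. R s' \<Longrightarrow> runs P' s' T' Q" "T + T' \<le> U"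
  shows "runs (Seq P P') s U Q"
  using assms unfolding runs_def by (meson add_mono exec_Seq order_trans)

lemma runs_Branch:
  assumes "holds b s \<Longrightarrow> runs P s T Q" "\<not> holds b s \<Longrightarrow> runs P' s T Q" "Suc T \<le> U"
  shows "runs (Branch b P P') s U Q"
proof (cases "holds b s")
  case True
  then obtain t s' where "exec P s t s'" "t \<le> T" "Q s'"
    using assms(1) unfolding runs_def by blast
  then show ?thesis
    using exec_BranchTrue [OF True, of P t s' P'] assms(3) unfolding runs_def by force
next
  case False
  then obtain t s' where "exec P' s t s'" "t \<le> T" "Q s'"
    using assms(2) unfolding runs_def by blast
  then show ?thesis
    using exec_BranchFalse [OF False, of P' t s' P] assms(3) unfolding runs_def by force
qed

primrec block :: "instr list \<Rightarrow> program" where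
  "block [] = Skip"
| "block (i # is) = Seq (Do i) (block is)"

lemma exec_block: "exec (block is) s (length is) (fold step is s)"
proof (induction "is" arbitrary: s)
  case (Cons i "is")
  show ?case
    using exec_Seq [OF exec_Do [of i s] Cons.IH [of "step i s"]] by simp
qed (simp add: exec_Skip)

lemma runs_block:
  assumes "Q (fold step is s)" "length is \<le> T"
  shows "runs (block is) s T Q"
  using assms exec_block unfolding runs_def by blast

text \<open>\<open>For r b P\<close> needs the constant 1 in register 2.\<close>

definition For :: "nat \<Rightarrow> nat \<Rightarrow> program \<Rightarrow> program" where
  "For r b P = Seq (Do (RConst r 0)) (While (RLess r b) (Seq P (Do (RAdd r r 2))))"

text \<open>The body has to establish the invariant with the counter already set to its next value,
  so invariants may speak of the counter register. A round costs 2 beyond the body, for test and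
  increment; the initial 2 pays for setting the counter and for the failing test.\<close>

lemma runs_For:
  assumes r: "r \<noteq> 2" "r \<noteq> b" and s: "reg s 2 = 1" "reg s b = M"
    and init: "I 0 (s\<lparr>reg := (reg s)(r := 0)\<rparr>)"
    and body: "\<And>k s'. \<lbrakk>k < M; I k s'; reg s' r = k; reg s' 2 = 1; reg s' b = M\<rbrakk> \<Longrightarrow>
      runs P s' T (\<lambda>s''. reg s'' r = k \<and> reg s'' 2 = 1 \<and> reg s'' b = M \<and>
        I (Suc k) (s''\<lparr>reg := (reg s'')(r := Suc k)\<rparr>))"
    and final: "\<And>s'. \<lbrakk>I M s'; reg s' r = M; reg s' 2 = 1; reg s' b = M\<rbrakk> \<Longrightarrow> Q s'"
    and time: "2 + M * (T + 2) \<le> U"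
  shows "runs (For r b P) s U Q"
proof -
  let ?W = "While (RLess r b) (Seq P (Do (RAdd r r 2)))"
  have loop: "\<exists>t s''. exec ?W s' t s'' \<and> t \<le> 1 + d * (T + 2) \<and> Q s''"
    if "M = k + d" "I k s'" "reg s' r = k" "reg s' 2 = 1" "reg s' b = M" for d k s'
    using that
  proof (induction d arbitrary: k s')
    case 0
    then have "exec ?W s' 1 s'" "Q s'"
      using exec_WhileFalse [of "RLess r b" s'] final by auto
    then show ?case
      by auto
  next
    case (Suc d)
    then obtain t s1 where P: "exec P s' t s1" "t \<le> T"
      and s1: "reg s1 r = k" "reg s1 2 = 1" "reg s1 b = M" "I (Suc k) (s1\<lparr>reg := (reg s1)(r := Suc k)\<rparr>)"
      using body [of k s'] unfolding runs_def by auto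
    let ?s2 = "s1\<lparr>reg := (reg s1)(r := Suc k)\<rparr>"
    have "exec (Seq P (Do (RAdd r r 2))) s' (t + 1) ?s2"
      using exec_Seq [OF P(1) exec_Do [of "RAdd r r 2" s1]] s1 by simp
    moreover obtain u s3 where "exec ?W ?s2 u s3" "u \<le> 1 + d * (T + 2)" "Q s3"
      using Suc.IH [of "Suc k" ?s2] Suc.prems(1) s1 r by auto
    moreover have "holds (RLess r b) s'"
      using Suc.prems by simp
    ultimately have "exec ?W s' (1 + (t + 1) + u) s3" "Q s3" "u \<le> 1 + d * (T + 2)"
      by (blast intro: exec_WhileTrue)+
    then show ?case
      using P(2) by (intro exI [of _ "1 + (t + 1) + u"] exI [of _ s3]) auto
  qed
  obtain t s'' where "exec ?W (s\<lparr>reg := (reg s)(r := 0)\<rparr>) t s''" "t \<le> 1 + M * (T + 2)" "Q s''"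
    using loop [of 0 M "s\<lparr>reg := (reg s)(r := 0)\<rparr>"] init r s by auto
  moreover have "exec (Do (RConst r 0)) s 1 (s\<lparr>reg := (reg s)(r := 0)\<rparr>)"
    using exec_Do [of "RConst r 0" s] by simp
  ultimately show ?thesis
    using time exec_Seq unfolding runs_def For_def
    by (intro exI [of _ "1 + t"] exI [of _ s'']) fastforce
qed

text \<open>One rule for copying, shifting and zeroing a matrix. While slice \<open>reg s r\<close>
  of array \<open>a\<close> is being written, all other slices and arrays are known to be unchanged,
  and \<open>G\<close> may be read from them.\<close>

lemma runs_fill:
  assumes xy: "x \<noteq> 0" "x \<noteq> 2" "y \<noteq> 0" "y \<noteq> 2" "x \<noteq> y" "r \<noteq> x" "r \<noteq> y"
    and s: "reg s 2 = 1" "reg s 0 = n"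
    and ins: "\<And>s' i j. \<lbrakk>i < n; j < n; \<And>q. q \<noteq> x \<Longrightarrow> q \<noteq> y \<Longrightarrow> reg s' q = reg s q; reg s' x = i; reg s' y = j;
      cf s' = cf s; \<And>b p i' j'. b \<noteq> a \<or> p \<noteq> reg s r \<Longrightarrow> fld s' b p i' j' = fld s b p i' j'\<rbrakk> \<Longrightarrow>
      step ins s' = put_fld (a, r, x, y) (G i j) s'"
    and final: "\<And>s'. \<lbrakk>\<And>q. q \<noteq> x \<Longrightarrow> q \<noteq> y \<Longrightarrow> reg s' q = reg s q; cf s' = cf s;
      \<And>b p i j. fld s' b p i j = (if b = a \<and> p = reg s r \<and> i < n \<and> j < n then G i j else fld s b p i j)\<rbrakk> \<Longrightarrow> Q s'"
    and time: "2 + n * (2 + n * 3 + 2) \<le> U"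
  shows "runs (For x 0 (For y 0 (block [ins]))) s U Q"
proof -
  define I where "I k l s' \<longleftrightarrow> (\<forall>q. q \<noteq> x \<longrightarrow> q \<noteq> y \<longrightarrow> reg s' q = reg s q) \<and> cf s' = cf s \<and>
    (\<forall>b p i j. fld s' b p i j = (if b = a \<and> p = reg s r \<and> j < n \<and> (i < k \<or> i = k \<and> j < l) then G i j
       else fld s b p i j))" for k l and s' :: "'a state"
  show ?thesis
  proof (rule runs_For [where I = "\<lambda>k. I k 0" and M = n and T = "2 + n * 3"])
    fix k s' assume k: "k < n" "I k 0 s'" "reg s' x = k" "reg s' 2 = 1" "reg s' 0 = n"
    show "runs (For y 0 (block [ins])) s' (2 + n * 3) (\<lambda>s''. reg s'' x = k \<and> reg s'' 2 = 1 \<and> reg s'' 0 = n \<and>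
        I (Suc k) 0 (s''\<lparr>reg := (reg s'')(x := Suc k)\<rparr>))"
    proof (rule runs_For [where I = "\<lambda>l s''. I k l s'' \<and> reg s'' x = k" and M = n and T = 1])
      fix l s'' assume l: "l < n" "I k l s'' \<and> reg s'' x = k" "reg s'' y = l" "reg s'' 2 = 1" "reg s'' 0 = n"
      have "step ins s'' = put_fld (a, r, x, y) (G k l) s''"
        by (rule ins) (use k l in \<open>auto simp: I_def\<close>)
      then show "runs (block [ins]) s'' 1 (\<lambda>s3. reg s3 y = l \<and> reg s3 2 = 1 \<and> reg s3 0 = n \<and>
          I k (Suc l) (s3\<lparr>reg := (reg s3)(y := Suc l)\<rparr>) \<and> reg (s3\<lparr>reg := (reg s3)(y := Suc l)\<rparr>) x = k)"
        using l xy by (intro runs_block) (auto simp: I_def less_Suc_eq)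
    next
      fix s'' assume "I k n s'' \<and> reg s'' x = k" "reg s'' y = n" "reg s'' 2 = 1" "reg s'' 0 = n"
      then show "reg s'' x = k \<and> reg s'' 2 = 1 \<and> reg s'' 0 = n \<and> I (Suc k) 0 (s''\<lparr>reg := (reg s'')(x := Suc k)\<rparr>)"
        by (auto simp: I_def less_Suc_eq)
    qed (use k xy in \<open>auto simp: I_def\<close>)
  next
    fix s' assume "I n 0 s'"
    then show "Q s'"
      by (intro final) (auto simp: I_def)
  qed (use s xy time in \<open>auto simp: I_def\<close>)
qed

text \<open>The instruction that forms \<open>s + \<epsilon> * \<mu>\<close> doubles as the code for
  the order: \<open>Plus\<close> yields \<epsilon> = 1, \<open>Minus\<close> yields \<epsilon> = -
  1.\<close>

definition sgn_of :: "arith \<Rightarrow> real" where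
  "sgn_of f = (if f = Plus then 1 else - 1)"

text \<open>Entry 0 of the arrays 1, 2, 4 and 5 is expected to hold \<mu>, the denominator of
  \<open>prox\<close>, and the clamping bounds 1 and 0.\<close>

definition clamp_prog :: "arith \<Rightarrow> nat \<Rightarrow> nat \<Rightarrow> program" where
  "clamp_prog f d c = Seq (block [COp f (d, 3) (c, 3) (1, 3), COp Divide (d, 3) (d, 3) (2, 3)])
     (Seq (Branch (CLess (d, 3) (5, 3)) (block [CConst (d, 3) 0]) (block []))
        (Branch (CLess (4, 3) (d, 3)) (block [CConst (d, 3) 1]) (block [])))"

lemma runs_clamp_prog:
  assumes f: "f = Plus \<or> f = Minus" and d: "d \<notin> {1, 2, 4, 5}"
    and s: "reg s 3 = 0" "cf s 1 0 = \<mu>" "cf s 2 0 = 1 + \<mu> / (4 * real n)" "cf s 4 0 = 1" "cf s 5 0 = 0"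
    and final: "Q (s\<lparr>cf := (cf s)(d := (cf s d)(0 := prox (sgn_of f) n \<mu> (cf s c 0)))\<rparr>)"
    and time: "6 \<le> U"
  shows "runs (clamp_prog f d c) s U Q"
proof -
  define v where "v = (cf s c 0 + sgn_of f * \<mu>) / (1 + \<mu> / (4 * real n))"
  define S where "S w = s\<lparr>cf := (cf s)(d := (cf s d)(0 := w))\<rparr>" for w
  have S: "reg (S w) = reg s" "cf (S w) a i = (if a = d \<and> i = 0 then w else cf s a i)"
    "S w\<lparr>cf := (cf (S w))(d := (cf (S w) d)(0 := w'))\<rparr> = S w'" for w w' a i
    by (simp_all add: S_def)
  show ?thesis
    unfolding clamp_prog_def
  proof (rule runs_Seq [where R = "\<lambda>s'. s' = S v" and T = 2 and T' = 4])
    show "runs (block [COp f (d, 3) (c, 3) (1, 3), COp Divide (d, 3) (d, 3) (2, 3)]) s 2 (\<lambda>s'. s' = S v)"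
      using f d s by (intro runs_block) (auto simp: S_def v_def sgn_of_def)
    fix s' assume "s' = S v"
    then show "runs (Seq (Branch (CLess (d, 3) (5, 3)) (block [CConst (d, 3) 0]) (block []))
        (Branch (CLess (4, 3) (d, 3)) (block [CConst (d, 3) 1]) (block []))) s' 4 Q"
    proof (intro runs_Seq [where R = "\<lambda>s'. s' = S (max 0 v)" and T = 2 and T' = 2])
      show "runs (Branch (CLess (d, 3) (5, 3)) (block [CConst (d, 3) 0]) (block [])) s' 2 (\<lambda>s'. s' = S (max 0 v))"
        by (intro runs_Branch [where T = 1] runs_block)
          (use \<open>s' = S v\<close> s d in \<open>auto simp: S max_def\<close>)
      define w where "w = max 0 v"
      fix s'' assume "s'' = S (max 0 v)"
      then have s'': "s'' = S w"
        by (simp add: w_def)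
      have "prox (sgn_of f) n \<mu> (cf s c 0) = (if 1 < w then 1 else w)"
        unfolding prox_def v_def [symmetric] w_def by auto
      then have "1 < w \<Longrightarrow> Q (S 1)" "\<not> 1 < w \<Longrightarrow> Q (S w)"
        using final [folded S_def] by auto
      then show "runs (Branch (CLess (4, 3) (d, 3)) (block [CConst (d, 3) 1]) (block [])) s'' 2 Q"
        by (intro runs_Branch [where T = 1] runs_block) (use s'' s d in \<open>auto simp: S\<close>)
    qed simp
  qed (use time in simp)
qed

text \<open>Registers 2 and 3 hold 1 and 0, registers 7 and 8 the slot to be tested for \<open>K\<^sup>n\<close> and the slot where
  \<open>K\<^sup>n\<close> would be inserted, register 9 the number of slots to be shifted, register 10 the outcome of the
  test. Coefficient arrays from 2 on are scalars, stored in entry 0: array 2 is the denominator of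
  \<open>prox\<close>, array 6 the current tail sum, 7 and 9 are values of \<open>prox\<close>, 8 is the weight to be added on
  \<open>K\<^sup>n\<close>.\<close>

definition init_prog :: program where
  "init_prog = Seq (block [RConst 2 1, RConst 3 0, CConst (2, 3) 0, CConst (3, 3) 4, CConst (4, 3) 1,
       CConst (5, 3) 0, CConst (6, 3) 1, FConst (2, 3, 3, 3) 0])
     (Seq (For 4 0 (block [COp Plus (2, 3) (2, 3) (3, 3)]))
        (block [COp Divide (2, 3) (1, 3) (2, 3), COp Plus (2, 3) (4, 3) (2, 3)]))"

definition prepared :: "nat \<Rightarrow> real \<Rightarrow> 'k::field state \<Rightarrow> 'k state \<Rightarrow> bool" where
  "prepared n \<mu> s s' \<longleftrightarrow> reg s' 0 = n \<and> reg s' 1 = reg s 1 \<and> reg s' 2 = 1 \<and> reg s' 3 = 0 \<and> cf s' 1 0 = \<mu> \<and>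
     cf s' 2 0 = 1 + \<mu> / (4 * real n) \<and> cf s' 4 0 = 1 \<and> cf s' 5 0 = 0 \<and> fld s' 0 = fld s 0 \<and> fld s' 2 0 0 0 = 0"

text \<open>No instruction converts a register into a coefficient, so 4n arises by adding the
  constant 4 in a loop of n rounds.\<close>

lemma runs_init_prog:
  assumes "reg s 0 = n" "cf s 1 0 = \<mu>"
  shows "runs init_prog s (12 + 3 * n) (\<lambda>s'. prepared n \<mu> s s' \<and> cf s' 0 = cf s 0 \<and> cf s' 6 0 = 1)"
  unfolding init_prog_def
proof (rule runs_Seq [where T = 8 and T' = "4 + 3 * n"])
  define I where "I k s' \<longleftrightarrow> reg s' 0 = n \<and> reg s' 1 = reg s 1 \<and> reg s' 2 = 1 \<and> reg s' 3 = 0 \<and> cf s' 1 0 = \<mu> \<and>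
     cf s' 2 0 = 4 * real k \<and> cf s' 3 0 = 4 \<and> cf s' 4 0 = 1 \<and> cf s' 5 0 = 0 \<and> cf s' 6 0 = 1 \<and> cf s' 0 = cf s 0 \<and>
     fld s' 0 = fld s 0 \<and> fld s' 2 0 0 0 = 0" for k and s' :: "'a state"
  show "runs (block [RConst 2 1, RConst 3 0, CConst (2, 3) 0, CConst (3, 3) 4, CConst (4, 3) 1,
       CConst (5, 3) 0, CConst (6, 3) 1, FConst (2, 3, 3, 3) 0]) s 8 (I 0)"
    using assms by (intro runs_block) (auto simp: I_def)
  fix s' assume s': "I 0 s'"
  show "runs (Seq (For 4 0 (block [COp Plus (2, 3) (2, 3) (3, 3)]))
      (block [COp Divide (2, 3) (1, 3) (2, 3), COp Plus (2, 3) (4, 3) (2, 3)])) s' (4 + 3 * n)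
      (\<lambda>s'. prepared n \<mu> s s' \<and> cf s' 0 = cf s 0 \<and> cf s' 6 0 = 1)"
  proof (rule runs_Seq [where R = "I n" and T = "2 + 3 * n" and T' = 2])
    show "runs (For 4 0 (block [COp Plus (2, 3) (2, 3) (3, 3)])) s' (2 + 3 * n) (I n)"
      by (rule runs_For [where I = I and M = n and T = 1]; (rule runs_block)?)
        (use s' in \<open>auto simp: I_def\<close>)
    fix s'' assume "I n s''"
    then show "runs (block [COp Divide (2, 3) (1, 3) (2, 3), COp Plus (2, 3) (4, 3) (2, 3)]) s'' 2
        (\<lambda>s'. prepared n \<mu> s s' \<and> cf s' 0 = cf s 0 \<and> cf s' 6 0 = 1)"
      by (intro runs_block) (auto simp: I_def prepared_def)
  qed simp
qed simp

text \<open>Array 6 starts at the total mass 1 and becomes the next tail sum by subtracting a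
  coefficient just before that coefficient is overwritten. Array 7 keeps the previous value of
  \<open>prox\<close>, so each tail sum is evaluated once; adding the 0 of array 5 serves as a copy.
  After the loop array 7 holds \<open>h 0\<close>, and array 8 collects the weights
  \<open>1 - h 1\<close> and \<open>h 0\<close> of both ends.\<close>

definition weights_prog :: "arith \<Rightarrow> program" where
  "weights_prog f = Seq (clamp_prog f 7 6) (Seq (block [COp Minus (8, 3) (4, 3) (7, 3)])
     (Seq (For 4 1 (Seq (block [COp Minus (6, 3) (6, 3) (0, 4)])
         (Seq (clamp_prog f 9 6) (block [COp Minus (0, 4) (7, 3) (9, 3), COp Plus (7, 3) (9, 3) (5, 3)]))))
       (block [COp Plus (8, 3) (8, 3) (7, 3)])))"

lemma runs_weights_prog:
  assumes f: "f = Plus \<or> f = Minus" and s: "prepared n \<mu> s0 s" "cf s 0 = c" "cf s 6 0 = 1"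
    and m: "reg s0 1 = m" and total: "tail_sum m c 0 = 1"
  defines "h \<equiv> prox (sgn_of f) n \<mu>"
  shows "runs (weights_prog f) s (10 + 11 * m) (\<lambda>s'. prepared n \<mu> s0 s' \<and>
    (\<forall>i<m. cf s' 0 i = h (tail_sum m c i) - h (tail_sum m c (Suc i))) \<and> cf s' 8 0 = 1 - h 1 + h 0)"
  unfolding weights_prog_def
proof (rule runs_Seq [where R = "\<lambda>s'. prepared n \<mu> s0 s' \<and> cf s' 0 = c \<and> cf s' 6 0 = 1 \<and> cf s' 7 0 = h 1"
      and T = 6 and T' = "4 + 11 * m"])
  show "runs (clamp_prog f 7 6) s 6 (\<lambda>s'. prepared n \<mu> s0 s' \<and> cf s' 0 = c \<and> cf s' 6 0 = 1 \<and> cf s' 7 0 = h 1)"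
    by (rule runs_clamp_prog [OF f]) (use s in \<open>auto simp: prepared_def h_def\<close>)
  define I where "I k s' \<longleftrightarrow> prepared n \<mu> s0 s' \<and> cf s' 6 0 = tail_sum m c k \<and> cf s' 7 0 = h (tail_sum m c k) \<and>
    cf s' 8 0 = 1 - h 1 \<and> (\<forall>i<m. cf s' 0 i = (if i < k then h (tail_sum m c i) - h (tail_sum m c (Suc i)) else c i))"
    for k and s' :: "'a state"
  fix s1 :: "'a state"
  assume s1: "prepared n \<mu> s0 s1 \<and> cf s1 0 = c \<and> cf s1 6 0 = 1 \<and> cf s1 7 0 = h 1"
  show "runs (Seq (block [COp Minus (8, 3) (4, 3) (7, 3)])
     (Seq (For 4 1 (Seq (block [COp Minus (6, 3) (6, 3) (0, 4)])
         (Seq (clamp_prog f 9 6) (block [COp Minus (0, 4) (7, 3) (9, 3), COp Plus (7, 3) (9, 3) (5, 3)]))))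
       (block [COp Plus (8, 3) (8, 3) (7, 3)]))) s1 (4 + 11 * m) (\<lambda>s'. prepared n \<mu> s0 s' \<and>
    (\<forall>i<m. cf s' 0 i = h (tail_sum m c i) - h (tail_sum m c (Suc i))) \<and> cf s' 8 0 = 1 - h 1 + h 0)"
  proof (rule runs_Seq [where R = "I 0" and T = 1 and T' = "3 + 11 * m"])
    show "runs (block [COp Minus (8, 3) (4, 3) (7, 3)]) s1 1 (I 0)"
      using s1 total by (intro runs_block) (auto simp: I_def prepared_def)
    fix s2 assume s2: "I 0 s2"
    show "runs (Seq (For 4 1 (Seq (block [COp Minus (6, 3) (6, 3) (0, 4)])
         (Seq (clamp_prog f 9 6) (block [COp Minus (0, 4) (7, 3) (9, 3), COp Plus (7, 3) (9, 3) (5, 3)]))))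
       (block [COp Plus (8, 3) (8, 3) (7, 3)])) s2 (3 + 11 * m) (\<lambda>s'. prepared n \<mu> s0 s' \<and>
      (\<forall>i<m. cf s' 0 i = h (tail_sum m c i) - h (tail_sum m c (Suc i))) \<and> cf s' 8 0 = 1 - h 1 + h 0)"
    proof (rule runs_Seq [where R = "I m" and T = "2 + 11 * m" and T' = 1])
      show "runs (For 4 1 (Seq (block [COp Minus (6, 3) (6, 3) (0, 4)])
         (Seq (clamp_prog f 9 6) (block [COp Minus (0, 4) (7, 3) (9, 3), COp Plus (7, 3) (9, 3) (5, 3)]))))
         s2 (2 + 11 * m) (I m)"
      proof (rule runs_For [where I = I and M = m and T = 9])
        fix k s3 assume k: "k < m" "I k s3" "reg s3 4 = k" "reg s3 2 = 1" "reg s3 1 = m"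
        have tail: "tail_sum m c k = c k + tail_sum m c (Suc k)"
          by (rule tail_sum_simps(2) [OF k(1)])
        define J where "J s' \<longleftrightarrow> prepared n \<mu> s0 s' \<and> reg s' 4 = k \<and> cf s' 6 0 = tail_sum m c (Suc k) \<and>
          cf s' 7 0 = h (tail_sum m c k) \<and> cf s' 8 0 = 1 - h 1 \<and>
          (\<forall>i<m. cf s' 0 i = (if i < k then h (tail_sum m c i) - h (tail_sum m c (Suc i)) else c i))"
          for s' :: "'a state"
        show "runs (Seq (block [COp Minus (6, 3) (6, 3) (0, 4)])
         (Seq (clamp_prog f 9 6) (block [COp Minus (0, 4) (7, 3) (9, 3), COp Plus (7, 3) (9, 3) (5, 3)])))
         s3 9 (\<lambda>s''. reg s'' 4 = k \<and> reg s'' 2 = 1 \<and> reg s'' 1 = m \<and>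
           I (Suc k) (s''\<lparr>reg := (reg s'')(4 := Suc k)\<rparr>))"
        proof (rule runs_Seq [where R = J and T = 1 and T' = 8])
          show "runs (block [COp Minus (6, 3) (6, 3) (0, 4)]) s3 1 J"
            using k tail by (intro runs_block) (auto simp: I_def J_def prepared_def)
          fix s4 assume s4: "J s4"
          show "runs (Seq (clamp_prog f 9 6) (block [COp Minus (0, 4) (7, 3) (9, 3), COp Plus (7, 3) (9, 3) (5, 3)]))
            s4 8 (\<lambda>s''. reg s'' 4 = k \<and> reg s'' 2 = 1 \<and> reg s'' 1 = m \<and>
              I (Suc k) (s''\<lparr>reg := (reg s'')(4 := Suc k)\<rparr>))"
          proof (rule runs_Seq [where R = "\<lambda>s'. J s' \<and> cf s' 9 0 = h (tail_sum m c (Suc k))" and T = 6 and T' = 2])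
            show "runs (clamp_prog f 9 6) s4 6 (\<lambda>s'. J s' \<and> cf s' 9 0 = h (tail_sum m c (Suc k)))"
              by (rule runs_clamp_prog [OF f]) (use s4 in \<open>auto simp: J_def prepared_def h_def\<close>)
            fix s5 assume s5: "J s5 \<and> cf s5 9 0 = h (tail_sum m c (Suc k))"
            show "runs (block [COp Minus (0, 4) (7, 3) (9, 3), COp Plus (7, 3) (9, 3) (5, 3)]) s5 2
              (\<lambda>s''. reg s'' 4 = k \<and> reg s'' 2 = 1 \<and> reg s'' 1 = m \<and>
                I (Suc k) (s''\<lparr>reg := (reg s'')(4 := Suc k)\<rparr>))"
              by (rule runs_block) (use s5 m in \<open>auto simp: I_def J_def prepared_def less_Suc_eq\<close>)
          qed simp
        qed simp
      qed (use s2 m in \<open>auto simp: I_def prepared_def\<close>)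
      fix s3 assume "I m s3"
      then show "runs (block [COp Plus (8, 3) (8, 3) (7, 3)]) s3 1 (\<lambda>s'. prepared n \<mu> s0 s' \<and>
        (\<forall>i<m. cf s' 0 i = h (tail_sum m c i) - h (tail_sum m c (Suc i))) \<and> cf s' 8 0 = 1 - h 1 + h 0)"
        by (intro runs_block) (auto simp: I_def prepared_def tail_sum_simps(1))
    qed simp
  qed simp
qed simp


section \<open>Testing for the whole space\<close>

text \<open>Triangulation of the matrix in slice 0 of field array 1: register 4 holds the column \<open>c\<close>,
  register 5 the row \<open>r\<close> to be cleared.\<close>

definition pivot_prog :: program where
  "pivot_prog = Branch (FEq (1, 3, 4, 4) (2, 3, 3, 3))
     (For 6 0 (block [FOp Plus (1, 3, 4, 6) (1, 3, 4, 6) (1, 3, 5, 6)])) (block [])"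

definition clear_prog :: program where
  "clear_prog = Seq (block [FOp Divide (3, 3, 3, 3) (1, 3, 5, 4) (1, 3, 4, 4)])
     (For 6 0 (block [FOp Times (4, 3, 3, 3) (3, 3, 3, 3) (1, 3, 4, 6),
        FOp Minus (1, 3, 5, 6) (1, 3, 5, 6) (4, 3, 3, 3)]))"

definition triangulate_prog :: program where
  "triangulate_prog = For 4 0 (For 5 0 (Branch (RLess 4 5) (Seq pivot_prog clear_prog) (block [])))"

definition diagonal_prog :: program where
  "diagonal_prog = Seq (block [RConst 10 1])
     (For 4 0 (Branch (FEq (1, 3, 4, 4) (2, 3, 3, 3)) (block [RConst 10 0]) (block [])))"

fun test_prog :: "representation \<Rightarrow> program" where
  "test_prog Image = Seq (For 4 0 (For 5 0 (block [FOp Plus (1, 3, 4, 5) (0, 7, 4, 5) (2, 3, 3, 3)])))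
     (Seq triangulate_prog diagonal_prog)"
| "test_prog Kernel = Seq (block [RConst 10 1])
     (For 4 0 (For 5 0 (Branch (FEq (0, 7, 4, 5) (2, 3, 3, 3)) (block []) (block [RConst 10 0]))))"

definition work :: "'k::field state \<Rightarrow> nat \<Rightarrow> (nat \<Rightarrow> nat \<Rightarrow> 'k) \<Rightarrow> 'k state \<Rightarrow> bool" where
  "work s n A s' \<longleftrightarrow> (\<forall>q. q \<notin> {4, 5, 6} \<longrightarrow> reg s' q = reg s q) \<and> cf s' = cf s \<and>
     fld s' 0 = fld s 0 \<and> fld s' 2 = fld s 2 \<and> (\<forall>i<n. \<forall>j<n. fld s' 1 0 i j = A i j)"

text \<open>The cell \<open>fld s 2 0 0 0\<close> is the zero against which entries are compared,
  and which is added in order to copy.\<close>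

locale ready =
  fixes s :: "'k::field state" and n :: nat
  assumes regs: "reg s 0 = n" "reg s 2 = 1" "reg s 3 = 0" and zero: "fld s 2 0 0 0 = 0"
begin

lemma work_regs:
  assumes "work s n A s'"
  shows "reg s' 0 = n" "reg s' 2 = 1" "reg s' 3 = 0" "fld s' 2 0 0 0 = 0"
    "i < n \<Longrightarrow> j < n \<Longrightarrow> fld s' 1 0 i j = A i j"
  using assms regs zero by (simp_all add: work_def)

lemma runs_pivot_prog:
  assumes w: "work s n A s'" and cr: "reg s' 4 = c" "reg s' 5 = r" "c < n" "r < n" "c \<noteq> r"
  shows "runs pivot_prog s' (3 + 3 * n) (\<lambda>s''. work s n (make_pivot c r A) s'' \<and> reg s'' 4 = c \<and> reg s'' 5 = r)"
  unfolding pivot_prog_def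
proof (rule runs_Branch [where T = "2 + 3 * n"])
  note w' = work_regs [OF w]
  assume "holds (FEq (1, 3, 4, 4) (2, 3, 3, 3)) s'"
  then have 0: "A c c = 0"
    using w' cr by simp
  define I where "I k t \<longleftrightarrow> work s n (\<lambda>i j. if i = c \<and> j < k then A c j + A r j else A i j) t \<and>
    reg t 4 = c \<and> reg t 5 = r" for k and t :: "'k state"
  show "runs (For 6 0 (block [FOp Plus (1, 3, 4, 6) (1, 3, 4, 6) (1, 3, 5, 6)])) s' (2 + 3 * n)
      (\<lambda>s''. work s n (make_pivot c r A) s'' \<and> reg s'' 4 = c \<and> reg s'' 5 = r)"
  proof (rule runs_For [where I = I and M = n and T = 1])
    fix k t assume t: "k < n" "I k t" "reg t 6 = k" "reg t 2 = 1" "reg t 0 = n"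
    then have "reg t 3 = 0" "reg t 4 = c" "reg t 5 = r" "fld t 1 0 c k = A c k" "fld t 1 0 r k = A r k"
      using work_regs [of _ t] cr by (auto simp: I_def)
    then show "runs (block [FOp Plus (1, 3, 4, 6) (1, 3, 4, 6) (1, 3, 5, 6)]) t 1 (\<lambda>t'. reg t' 6 = k \<and>
        reg t' 2 = 1 \<and> reg t' 0 = n \<and> I (Suc k) (t'\<lparr>reg := (reg t')(6 := Suc k)\<rparr>))"
      by (intro runs_block) (use t in \<open>auto simp: I_def work_def less_Suc_eq fun_eq_iff\<close>)
  next
    fix t assume "I n t"
    then show "work s n (make_pivot c r A) t \<and> reg t 4 = c \<and> reg t 5 = r"
      using 0 by (auto simp: I_def work_def make_pivot_def add_row_def)
  qed (use w w' cr in \<open>auto simp: I_def work_def\<close>)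
next
  assume "\<not> holds (FEq (1, 3, 4, 4) (2, 3, 3, 3)) s'"
  then have "A c c \<noteq> 0"
    using work_regs [OF w] cr by simp
  then show "runs (block []) s' (2 + 3 * n) (\<lambda>s''. work s n (make_pivot c r A) s'' \<and> reg s'' 4 = c \<and> reg s'' 5 = r)"
    by (intro runs_block) (use w cr in \<open>auto simp: make_pivot_def\<close>)
qed simp

lemma runs_clear_prog:
  assumes w: "work s n B s'" and cr: "reg s' 4 = c" "reg s' 5 = r" "c < n" "r < n" "c \<noteq> r"
  shows "runs clear_prog s' (3 + 4 * n)
    (\<lambda>s''. work s n (add_row (- (B r c / B c c)) r c B) s'' \<and> reg s'' 4 = c \<and> reg s'' 5 = r)"
  unfolding clear_prog_def
proof (rule runs_Seq [where T = 1 and T' = "2 + 4 * n"])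
  note w' = work_regs [OF w]
  \<comment> \<open>The factor is computed before the loop and kept in array 3, since the loop
    overwrites the entry (r, c) on its way.\<close>
  define f where "f = B r c / B c c"
  define I where "I k t \<longleftrightarrow> work s n (\<lambda>i j. if i = r \<and> j < k then B r j - f * B c j else B i j) t \<and>
    reg t 4 = c \<and> reg t 5 = r \<and> fld t 3 0 0 0 = f" for k and t :: "'k state"
  show "runs (block [FOp Divide (3, 3, 3, 3) (1, 3, 5, 4) (1, 3, 4, 4)]) s' 1 (I 0)"
    by (rule runs_block) (use w w' cr in \<open>auto simp: I_def work_def f_def fun_eq_iff\<close>)
  fix s1 assume s1: "I 0 s1"
  show "runs (For 6 0 (block [FOp Times (4, 3, 3, 3) (3, 3, 3, 3) (1, 3, 4, 6),
        FOp Minus (1, 3, 5, 6) (1, 3, 5, 6) (4, 3, 3, 3)])) s1 (2 + 4 * n)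
     (\<lambda>s''. work s n (add_row (- (B r c / B c c)) r c B) s'' \<and> reg s'' 4 = c \<and> reg s'' 5 = r)"
  proof (rule runs_For [where I = I and M = n and T = 2])
    fix k t assume t: "k < n" "I k t" "reg t 6 = k" "reg t 2 = 1" "reg t 0 = n"
    then have "reg t 3 = 0" "reg t 4 = c" "reg t 5 = r" "fld t 1 0 c k = B c k" "fld t 1 0 r k = B r k"
      using work_regs [of _ t] cr by (auto simp: I_def)
    then show "runs (block [FOp Times (4, 3, 3, 3) (3, 3, 3, 3) (1, 3, 4, 6),
        FOp Minus (1, 3, 5, 6) (1, 3, 5, 6) (4, 3, 3, 3)]) t 2 (\<lambda>t'. reg t' 6 = k \<and>
        reg t' 2 = 1 \<and> reg t' 0 = n \<and> I (Suc k) (t'\<lparr>reg := (reg t')(6 := Suc k)\<rparr>))"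
      by (intro runs_block) (use t in \<open>auto simp: I_def work_def less_Suc_eq fun_eq_iff\<close>)
  next
    fix t assume "I n t"
    then show "work s n (add_row (- (B r c / B c c)) r c B) t \<and> reg t 4 = c \<and> reg t 5 = r"
      by (auto simp: I_def work_def add_row_def f_def)
  next
    show "I 0 (s1\<lparr>reg := (reg s1)(6 := 0)\<rparr>)"
      using s1 by (auto simp: I_def work_def)
  qed (use s1 work_regs [of _ s1] in \<open>auto simp: I_def\<close>)
qed simp

lemma runs_clear_step:
  assumes w: "work s n A s'" and cr: "reg s' 4 = c" "reg s' 5 = r" "c < n" "r < n"
  shows "runs (Branch (RLess 4 5) (Seq pivot_prog clear_prog) (block [])) s' (7 + 7 * n)
    (\<lambda>s''. work s n (clear_step c r A) s'' \<and> reg s'' 4 = c \<and> reg s'' 5 = r)"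
proof (rule runs_Branch [where T = "6 + 7 * n"])
  assume "holds (RLess 4 5) s'"
  then have "c < r"
    using cr by simp
  then have step: "clear_step c r A
      = add_row (- (make_pivot c r A r c / make_pivot c r A c c)) r c (make_pivot c r A)"
    by (simp add: clear_step_def)
  show "runs (Seq pivot_prog clear_prog) s' (6 + 7 * n)
      (\<lambda>s''. work s n (clear_step c r A) s'' \<and> reg s'' 4 = c \<and> reg s'' 5 = r)"
    unfolding step
    by (rule runs_Seq [OF runs_pivot_prog [OF w cr] runs_clear_prog]) (use \<open>c < r\<close> cr in auto)
next
  assume "\<not> holds (RLess 4 5) s'"
  then have "\<not> c < r"
    using cr by simp
  then show "runs (block []) s' (6 + 7 * n) (\<lambda>s''. work s n (clear_step c r A) s'' \<and> reg s'' 4 = c \<and> reg s'' 5 = r)"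
    by (intro runs_block) (use w cr in \<open>auto simp: clear_step_def\<close>)
qed simp

lemma runs_triangulate_prog:
  assumes w: "work s n A\<^sub>0 s'"
  shows "runs triangulate_prog s' (2 + n * (2 + n * (9 + 7 * n) + 2))
    (\<lambda>s''. \<exists>A. work s n A s'' \<and> cleared n n 0 A \<and> det (matrix_of n A) = det (matrix_of n A\<^sub>0))"
  unfolding triangulate_prog_def
proof -
  define I where "I c r t \<longleftrightarrow> (\<exists>A. work s n A t \<and> cleared n c r A \<and> det (matrix_of n A) = det (matrix_of n A\<^sub>0))"
    for c r and t :: "'k state"
  have I_regs: "reg t 0 = n" "reg t 2 = 1" if "I c r t" for c r t
    using that work_regs by (auto simp: I_def)
  have I_upd: "I c r (t\<lparr>reg := (reg t)(q := k)\<rparr>)" if "I c r t" "q \<in> {4, 5, 6}" for c r t q k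
    using that unfolding I_def work_def by (elim exE, intro exI) auto
  have "runs (For 4 0 (For 5 0 (Branch (RLess 4 5) (Seq pivot_prog clear_prog) (block [])))) s'
    (2 + n * (2 + n * (9 + 7 * n) + 2)) (I n 0)"
  proof (rule runs_For [where I = "\<lambda>c. I c 0" and M = n and T = "2 + n * (9 + 7 * n)"])
    fix c t assume t: "c < n" "I c 0 t" "reg t 4 = c" "reg t 2 = 1" "reg t 0 = n"
    show "runs (For 5 0 (Branch (RLess 4 5) (Seq pivot_prog clear_prog) (block []))) t (2 + n * (9 + 7 * n))
      (\<lambda>t'. reg t' 4 = c \<and> reg t' 2 = 1 \<and> reg t' 0 = n \<and> I (Suc c) 0 (t'\<lparr>reg := (reg t')(4 := Suc c)\<rparr>))"
    proof (rule runs_For [where I = "\<lambda>r t. I c r t \<and> reg t 4 = c" and M = n and T = "7 + 7 * n"])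
      fix r u assume u: "r < n" "I c r u \<and> reg u 4 = c" "reg u 5 = r" "reg u 2 = 1" "reg u 0 = n"
      then obtain A where A: "work s n A u" "cleared n c r A" "det (matrix_of n A) = det (matrix_of n A\<^sub>0)"
        by (auto simp: I_def)
      have "runs (Branch (RLess 4 5) (Seq pivot_prog clear_prog) (block [])) u (7 + 7 * n)
          (\<lambda>u'. work s n (clear_step c r A) u' \<and> reg u' 4 = c \<and> reg u' 5 = r)"
        by (rule runs_clear_step [OF A(1)]) (use u t in auto)
      moreover have "reg u' 5 = r \<and> reg u' 2 = 1 \<and> reg u' 0 = n \<and>
          I c (Suc r) (u'\<lparr>reg := (reg u')(5 := Suc r)\<rparr>) \<and> reg (u'\<lparr>reg := (reg u')(5 := Suc r)\<rparr>) 4 = c"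
        if "work s n (clear_step c r A) u' \<and> reg u' 4 = c \<and> reg u' 5 = r" for u'
      proof -
        have "I c (Suc r) u'"
          unfolding I_def using that A(3) cleared_step [OF A(2) t(1) u(1)] det_clear_step [OF t(1) u(1), of A]
          by auto
        then show ?thesis
          using I_regs I_upd that by auto
      qed
      ultimately show "runs (Branch (RLess 4 5) (Seq pivot_prog clear_prog) (block [])) u (7 + 7 * n)
          (\<lambda>u'. reg u' 5 = r \<and> reg u' 2 = 1 \<and> reg u' 0 = n \<and>
          I c (Suc r) (u'\<lparr>reg := (reg u')(5 := Suc r)\<rparr>) \<and> reg (u'\<lparr>reg := (reg u')(5 := Suc r)\<rparr>) 4 = c)"
        unfolding runs_def by blast
    next
      fix u assume u: "I c n u \<and> reg u 4 = c" "reg u 2 = 1" "reg u 0 = n"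
      then have "I (Suc c) 0 u"
        unfolding I_def using cleared_next_column by blast
      then show "reg u 4 = c \<and> reg u 2 = 1 \<and> reg u 0 = n \<and> I (Suc c) 0 (u\<lparr>reg := (reg u)(4 := Suc c)\<rparr>)"
        using u I_upd by auto
    qed (use t I_upd in auto)
  next
    have "I 0 0 s'"
      unfolding I_def using w by (auto simp: cleared_def)
    then show "I 0 0 (s'\<lparr>reg := (reg s')(4 := 0)\<rparr>)"
      by (rule I_upd) simp
  qed (use w work_regs in auto)
  then show "runs (For 4 0 (For 5 0 (Branch (RLess 4 5) (Seq pivot_prog clear_prog) (block [])))) s'
      (2 + n * (2 + n * (9 + 7 * n) + 2))
      (\<lambda>s''. \<exists>A. work s n A s'' \<and> cleared n n 0 A \<and> det (matrix_of n A) = det (matrix_of n A\<^sub>0))"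
    by (simp only: I_def [abs_def])
qed

definition tested :: "bool \<Rightarrow> 'k state \<Rightarrow> bool" where
  "tested b s' \<longleftrightarrow> (\<forall>q. q \<notin> {4, 5, 6, 10} \<longrightarrow> reg s' q = reg s q) \<and> cf s' = cf s \<and>
     fld s' 0 = fld s 0 \<and> fld s' 2 = fld s 2 \<and> reg s' 10 = of_bool b"

lemma runs_diagonal_prog:
  assumes w: "work s n A s'"
  shows "runs diagonal_prog s' (3 + 4 * n) (tested (\<forall>i<n. A i i \<noteq> 0))"
  unfolding diagonal_prog_def
proof (rule runs_Seq [where T = 1 and T' = "2 + 4 * n"])
  define I where "I k t \<longleftrightarrow> tested (\<forall>i<k. A i i \<noteq> 0) t \<and> (\<forall>i<n. \<forall>j<n. fld t 1 0 i j = A i j)"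
    for k and t :: "'k state"
  show "runs (block [RConst 10 1]) s' 1 (I 0)"
    by (rule runs_block) (use w in \<open>auto simp: I_def tested_def work_def\<close>)
  fix s1 assume s1: "I 0 s1"
  have I_regs: "reg t 0 = n" "reg t 2 = 1" "reg t 3 = 0" "fld t 2 0 0 0 = 0" if "I k t" for k t
    using that regs zero by (simp_all add: I_def tested_def)
  show "runs (For 4 0 (Branch (FEq (1, 3, 4, 4) (2, 3, 3, 3)) (block [RConst 10 0]) (block []))) s1 (2 + 4 * n)
      (tested (\<forall>i<n. A i i \<noteq> 0))"
  proof (rule runs_For [where I = I and M = n and T = 2])
    fix k t assume t: "k < n" "I k t" "reg t 4 = k" "reg t 2 = 1" "reg t 0 = n"
    then have "fld t 1 0 k k = A k k"
      by (simp add: I_def)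
    then show "runs (Branch (FEq (1, 3, 4, 4) (2, 3, 3, 3)) (block [RConst 10 0]) (block [])) t 2
      (\<lambda>t'. reg t' 4 = k \<and> reg t' 2 = 1 \<and> reg t' 0 = n \<and> I (Suc k) (t'\<lparr>reg := (reg t')(4 := Suc k)\<rparr>))"
      by (intro runs_Branch [where T = 1] runs_block)
        (use t I_regs [OF t(2)] in \<open>auto simp: I_def tested_def less_Suc_eq\<close>)
  qed (use s1 I_regs [OF s1] in \<open>auto simp: I_def tested_def\<close>)
qed simp

text \<open>Elimination works on a copy in array 1, because the stored matrices are still needed for
  the output; for kernels it is enough to look for a nonzero entry. The constant is generous, so
  that the time bound follows by comparing coefficients of polynomials in n.\<close>

lemma runs_test_prog:
  "runs (test_prog rep) s (2000 * (n + 1) ^ 3)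
    (tested (represented_subspace rep (matrix_of n (fld s 0 (reg s 7))) = carrier_vec n))"
proof (cases rep)
  case Image
  let ?A = "fld s 0 (reg s 7)"
  have "runs (Seq (For 4 0 (For 5 0 (block [FOp Plus (1, 3, 4, 5) (0, 7, 4, 5) (2, 3, 3, 3)])))
      (Seq triangulate_prog diagonal_prog)) s (2000 * (n + 1) ^ 3) (tested (det (matrix_of n ?A) \<noteq> 0))"
  proof (rule runs_Seq [where R = "work s n ?A" and T = "2 + n * (2 + n * 3 + 2)"
      and T' = "(2 + n * (2 + n * (9 + 7 * n) + 2)) + (3 + 4 * n)"])
    show "runs (For 4 0 (For 5 0 (block [FOp Plus (1, 3, 4, 5) (0, 7, 4, 5) (2, 3, 3, 3)]))) s
        (2 + n * (2 + n * 3 + 2)) (work s n ?A)"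
      by (rule runs_fill [where a = 1 and r = 3 and n = n and G = ?A])
        (use regs zero in \<open>auto simp: work_def fun_eq_iff\<close>)
    fix s1 assume s1: "work s n ?A s1"
    show "runs (Seq triangulate_prog diagonal_prog) s1
        ((2 + n * (2 + n * (9 + 7 * n) + 2)) + (3 + 4 * n)) (tested (det (matrix_of n ?A) \<noteq> 0))"
    proof (rule runs_Seq [OF runs_triangulate_prog [OF s1] _ order_refl])
      fix s2 assume "\<exists>A. work s n A s2 \<and> cleared n n 0 A \<and> det (matrix_of n A) = det (matrix_of n ?A)"
      then obtain A where A: "work s n A s2" "cleared n n 0 A" "det (matrix_of n A) = det (matrix_of n ?A)"
        by blast
      show "runs diagonal_prog s2 (3 + 4 * n) (tested (det (matrix_of n ?A) \<noteq> 0))"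
        using runs_diagonal_prog [OF A(1)] det_cleared [OF A(2)] A(3) by simp
    qed
  next
    show "2 + n * (2 + n * 3 + 2) + ((2 + n * (2 + n * (9 + 7 * n) + 2)) + (3 + 4 * n)) \<le> 2000 * (n + 1) ^ 3"
      by (simp add: power3_eq_cube algebra_simps)
  qed
  then show ?thesis
    using represented_Image_full [of "matrix_of n ?A" n] Image by simp
next
  case Kernel
  define I where "I k l t \<longleftrightarrow> tested (\<forall>i<n. \<forall>j<n. (i < k \<or> i = k \<and> j < l) \<longrightarrow> fld s 0 (reg s 7) i j = 0) t"
    for k l and t :: "'k state"
  have I_regs: "reg t 0 = n" "reg t 2 = 1" "reg t 3 = 0" "reg t 7 = reg s 7" "fld t 2 0 0 0 = 0" "fld t 0 = fld s 0"
    if "I k l t" for k l t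
    using that regs zero by (simp_all add: I_def tested_def)
  have I_upd: "I k l (t\<lparr>reg := (reg t)(q := v)\<rparr>)" if "I k l t" "q \<in> {4, 5}" for k l t q v
    using that by (auto simp: I_def tested_def)
  have "runs (Seq (block [RConst 10 1])
     (For 4 0 (For 5 0 (Branch (FEq (0, 7, 4, 5) (2, 3, 3, 3)) (block []) (block [RConst 10 0]))))) s
     (2000 * (n + 1) ^ 3) (I n 0)"
  proof (rule runs_Seq [where R = "I 0 0" and T = 1 and T' = "2 + n * (2 + n * 4 + 2)"])
    show "runs (block [RConst 10 1]) s 1 (I 0 0)"
      by (rule runs_block) (auto simp: I_def tested_def)
    fix s1 assume s1: "I 0 0 s1"
    show "runs (For 4 0 (For 5 0 (Branch (FEq (0, 7, 4, 5) (2, 3, 3, 3)) (block []) (block [RConst 10 0])))) s1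
        (2 + n * (2 + n * 4 + 2)) (I n 0)"
    proof (rule runs_For [where I = "\<lambda>k. I k 0" and M = n and T = "2 + n * 4"])
      fix k t assume t: "k < n" "I k 0 t" "reg t 4 = k" "reg t 2 = 1" "reg t 0 = n"
      show "runs (For 5 0 (Branch (FEq (0, 7, 4, 5) (2, 3, 3, 3)) (block []) (block [RConst 10 0]))) t
          (2 + n * 4) (\<lambda>t'. reg t' 4 = k \<and> reg t' 2 = 1 \<and> reg t' 0 = n \<and>
            I (Suc k) 0 (t'\<lparr>reg := (reg t')(4 := Suc k)\<rparr>))"
      proof (rule runs_For [where I = "\<lambda>l t. I k l t \<and> reg t 4 = k" and M = n and T = 2])
        fix l u assume u: "l < n" "I k l u \<and> reg u 4 = k" "reg u 5 = l" "reg u 2 = 1" "reg u 0 = n"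
        then have Iu: "I k l u"
          by simp
        have I_Suc: "I k (Suc l) u'" if "tested ((\<forall>i<n. \<forall>j<n. (i < k \<or> i = k \<and> j < l) \<longrightarrow> fld s 0 (reg s 7) i j = 0)
            \<and> fld s 0 (reg s 7) k l = 0) u'" for u'
        proof -
          have "(\<forall>i<n. \<forall>j<n. (i < k \<or> i = k \<and> j < Suc l) \<longrightarrow> fld s 0 (reg s 7) i j = 0) \<longleftrightarrow>
            (\<forall>i<n. \<forall>j<n. (i < k \<or> i = k \<and> j < l) \<longrightarrow> fld s 0 (reg s 7) i j = 0) \<and> fld s 0 (reg s 7) k l = 0"
            using t(1) u(1) less_Suc_eq by blast
          with that show ?thesis
            by (simp add: I_def)
        qed
        let ?u = "u\<lparr>reg := (reg u)(10 := 0)\<rparr>"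
        have stay: "I k (Suc l) u" if "fld s 0 (reg s 7) k l = 0"
          by (rule I_Suc) (use that Iu in \<open>simp add: I_def\<close>)
        have change: "I k (Suc l) ?u" if "fld s 0 (reg s 7) k l \<noteq> 0"
          by (rule I_Suc) (use that Iu in \<open>simp add: I_def tested_def\<close>)
        show "runs (Branch (FEq (0, 7, 4, 5) (2, 3, 3, 3)) (block []) (block [RConst 10 0])) u 2
          (\<lambda>u'. reg u' 5 = l \<and> reg u' 2 = 1 \<and> reg u' 0 = n \<and>
            I k (Suc l) (u'\<lparr>reg := (reg u')(5 := Suc l)\<rparr>) \<and> reg (u'\<lparr>reg := (reg u')(5 := Suc l)\<rparr>) 4 = k)"
        proof (rule runs_Branch [where T = 1]; (rule runs_block)?)
          assume "holds (FEq (0, 7, 4, 5) (2, 3, 3, 3)) u"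
          then have "fld s 0 (reg s 7) k l = 0"
            using u I_regs [OF Iu] by simp
          from I_upd [OF stay [OF this], of 5 "Suc l"] u
          show "reg (fold step [] u) 5 = l \<and> reg (fold step [] u) 2 = 1 \<and> reg (fold step [] u) 0 = n \<and>
            I k (Suc l) (fold step [] u\<lparr>reg := (reg (fold step [] u))(5 := Suc l)\<rparr>) \<and>
            reg (fold step [] u\<lparr>reg := (reg (fold step [] u))(5 := Suc l)\<rparr>) 4 = k"
            by simp
        next
          assume "\<not> holds (FEq (0, 7, 4, 5) (2, 3, 3, 3)) u"
          then have "fld s 0 (reg s 7) k l \<noteq> 0"
            using u I_regs [OF Iu] by simp
          from I_upd [OF change [OF this], of 5 "Suc l"] u
          show "reg (fold step [RConst 10 0] u) 5 = l \<and> reg (fold step [RConst 10 0] u) 2 = 1 \<and>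
            reg (fold step [RConst 10 0] u) 0 = n \<and>
            I k (Suc l) (fold step [RConst 10 0] u\<lparr>reg := (reg (fold step [RConst 10 0] u))(5 := Suc l)\<rparr>) \<and>
            reg (fold step [RConst 10 0] u\<lparr>reg := (reg (fold step [RConst 10 0] u))(5 := Suc l)\<rparr>) 4 = k"
            by simp
        qed simp_all
      next
        fix u assume u: "I k n u \<and> reg u 4 = k" "reg u 2 = 1" "reg u 0 = n"
        have "(\<forall>i<n. \<forall>j<n. (i < k \<or> i = k \<and> j < n) \<longrightarrow> fld s 0 (reg s 7) i j = 0) \<longleftrightarrow>
            (\<forall>i<n. \<forall>j<n. (i < Suc k \<or> i = Suc k \<and> j < 0) \<longrightarrow> fld s 0 (reg s 7) i j = 0)"
          using less_Suc_eq by auto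
        then have "I (Suc k) 0 u"
          using u(1) by (simp add: I_def)
        then show "reg u 4 = k \<and> reg u 2 = 1 \<and> reg u 0 = n \<and> I (Suc k) 0 (u\<lparr>reg := (reg u)(4 := Suc k)\<rparr>)"
          using u I_upd by auto
      qed (use t I_upd in auto)
    qed (use s1 I_regs [OF s1] I_upd in auto)
  next
    show "1 + (2 + n * (2 + n * 4 + 2)) \<le> 2000 * (n + 1) ^ 3"
      by (simp add: power3_eq_cube algebra_simps)
  qed
  moreover have "(\<forall>i<n. \<forall>j<n. (i < n \<or> i = n \<and> j < 0) \<longrightarrow> fld s 0 (reg s 7) i j = 0) \<longleftrightarrow>
      represented_subspace Kernel (matrix_of n (fld s 0 (reg s 7))) = carrier_vec n"
    using represented_Kernel_full [of "matrix_of n (fld s 0 (reg s 7))" n] by auto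
  ultimately show ?thesis
    by (simp add: Kernel I_def [abs_def])
qed

end


section \<open>Insertion into the chain\<close>

text \<open>The shift proceeds from the highest slot downwards, slot m - k receiving slot m - k - 1,
  so that nothing is overwritten before it has been copied.\<close>

definition shift_prog :: program where
  "shift_prog = For 4 9 (Seq (block [RSub 11 1 4, RSub 12 11 2, COp Plus (0, 11) (0, 12) (5, 3)])
     (For 5 0 (For 6 0 (block [FOp Plus (0, 11, 5, 6) (0, 12, 5, 6) (2, 3, 3, 3)]))))"

definition insert_prog :: "representation \<Rightarrow> program" where
  "insert_prog rep = Seq shift_prog
     (Seq (For 4 0 (For 5 0 (block [FConst (0, 8, 4, 5) 0])))
       (Seq (if rep = Image then For 4 0 (block [FConst (0, 8, 4, 4) 1]) else block [])
         (block [COp Plus (0, 8) (8, 3) (5, 3), RAdd 1 1 2])))"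

definition inserted :: "nat \<Rightarrow> 'a \<Rightarrow> (nat \<Rightarrow> 'a) \<Rightarrow> nat \<Rightarrow> 'a" where
  "inserted q w c i = (if i < q then c i else if i = q then w else c (i - 1))"

context ready
begin

definition shifted :: "nat \<Rightarrow> nat \<Rightarrow> 'k state \<Rightarrow> bool" where
  "shifted m k t \<longleftrightarrow> (\<forall>q. q \<notin> {4, 5, 6, 11, 12} \<longrightarrow> reg t q = reg s q) \<and>
    (\<forall>a. a \<noteq> 0 \<longrightarrow> cf t a = cf s a) \<and> fld t 2 = fld s 2 \<and>
    (\<forall>i. cf t 0 i = (if m - k < i \<and> i \<le> m then cf s 0 (i - 1) else cf s 0 i)) \<and>
    (\<forall>i j l. j < n \<longrightarrow> l < n \<longrightarrow> fld t 0 i j l = (if m - k < i \<and> i \<le> m then fld s 0 (i - 1) j l else fld s 0 i j l))"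

lemma shifted_regs:
  assumes "shifted m k t" "reg s 8 = q" "q \<le> m" "reg s 1 = m" "reg s 9 = m - q" "cf s 5 0 = 0"
  shows "reg t 0 = n" "reg t 1 = m" "reg t 2 = 1" "reg t 3 = 0" "reg t 8 = q" "reg t 9 = m - q"
    "fld t 2 0 0 0 = 0" "cf t 5 0 = 0" "cf t 8 = cf s 8"
  using assms regs zero by (simp_all add: shifted_def)

lemma runs_shift_prog:
  assumes q: "reg s 8 = q" "q \<le> m" and m: "reg s 1 = m" "reg s 9 = m - q" and c5: "cf s 5 0 = 0"
  shows "runs shift_prog s (2 + (m - q) * (3 + (2 + n * (2 + n * 3 + 2)) + 2)) (shifted m (m - q))"
  unfolding shift_prog_def
proof -
  let ?T = "2 + n * (2 + n * 3 + 2)"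
  show "runs (For 4 9 (Seq (block [RSub 11 1 4, RSub 12 11 2, COp Plus (0, 11) (0, 12) (5, 3)])
        (For 5 0 (For 6 0 (block [FOp Plus (0, 11, 5, 6) (0, 12, 5, 6) (2, 3, 3, 3)]))))) s
      (2 + (m - q) * (3 + ?T + 2)) (shifted m (m - q))"
  proof (rule runs_For [where I = "shifted m" and M = "m - q" and T = "3 + ?T"])
    fix k t assume t: "k < m - q" "shifted m k t" "reg t 4 = k" "reg t 2 = 1" "reg t 9 = m - q"
    define J where "J u \<longleftrightarrow> (\<forall>q. q \<notin> {4, 5, 6, 11, 12} \<longrightarrow> reg u q = reg s q) \<and> reg u 4 = k \<and>
      reg u 11 = m - k \<and> reg u 12 = m - Suc k \<and> (\<forall>a. a \<noteq> 0 \<longrightarrow> cf u a = cf s a) \<and>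
      (\<forall>i. cf u 0 i = (if m - Suc k < i \<and> i \<le> m then cf s 0 (i - 1) else cf s 0 i)) \<and> fld u = fld t"
      for u :: "'k state"
    show "runs (Seq (block [RSub 11 1 4, RSub 12 11 2, COp Plus (0, 11) (0, 12) (5, 3)])
        (For 5 0 (For 6 0 (block [FOp Plus (0, 11, 5, 6) (0, 12, 5, 6) (2, 3, 3, 3)])))) t (3 + ?T)
        (\<lambda>t'. reg t' 4 = k \<and> reg t' 2 = 1 \<and> reg t' 9 = m - q \<and> shifted m (Suc k) (t'\<lparr>reg := (reg t')(4 := Suc k)\<rparr>))"
    proof (rule runs_Seq [where R = J and T = 3 and T' = ?T])
      \<comment> \<open>After k rounds slot m - k - 1 is still untouched, so the value copied is the
        original one.\<close>
      have cf_shift: "(if i = m - k then cf t 0 (m - Suc k) else cf t 0 i)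
          = (if m - Suc k < i \<and> i \<le> m then cf s 0 (i - 1) else cf s 0 i)" for i
        using t(1,2) by (auto simp: shifted_def)
      show "runs (block [RSub 11 1 4, RSub 12 11 2, COp Plus (0, 11) (0, 12) (5, 3)]) t 3 J"
      proof (rule runs_block)
        have "\<And>q. q \<notin> {4, 5, 6, 11, 12} \<Longrightarrow> reg t q = reg s q" "\<And>a. a \<noteq> 0 \<Longrightarrow> cf t a = cf s a"
          using t(2) by (auto simp: shifted_def)
        then show "J (fold step [RSub 11 1 4, RSub 12 11 2, COp Plus (0, 11) (0, 12) (5, 3)] t)"
          using t(3) m c5 regs cf_shift by (simp add: J_def)
      qed simp
      fix u assume u: "J u"
      have fu: "fld u = fld t" and ru: "reg u 0 = n" "reg u 2 = 1" "reg u 3 = 0" "reg u 11 = m - k" "reg u 12 = m - Suc k"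
        using u regs by (auto simp: J_def)
      show "runs (For 5 0 (For 6 0 (block [FOp Plus (0, 11, 5, 6) (0, 12, 5, 6) (2, 3, 3, 3)]))) u ?T
        (\<lambda>t'. reg t' 4 = k \<and> reg t' 2 = 1 \<and> reg t' 9 = m - q \<and> shifted m (Suc k) (t'\<lparr>reg := (reg t')(4 := Suc k)\<rparr>))"
      proof (rule runs_fill [where a = 0 and r = 11 and n = n and G = "fld t 0 (m - Suc k)"])
        fix v :: "'k state" and i j assume v: "i < n" "j < n" "\<And>q. q \<noteq> 5 \<Longrightarrow> q \<noteq> 6 \<Longrightarrow> reg v q = reg u q" "reg v 5 = i" "reg v 6 = j"
          "cf v = cf u" "\<And>b p i' j'. b \<noteq> 0 \<or> p \<noteq> reg u 11 \<Longrightarrow> fld v b p i' j' = fld u b p i' j'"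
        have "fld v 0 (m - Suc k) i j = fld t 0 (m - Suc k) i j"
          using v(7) [of 0 "m - Suc k" i j] ru fu t(1) by simp
        moreover have "fld v 2 0 0 0 = 0"
          using v(7) [of 2 0 0 0] fu shifted_regs [OF t(2) q m c5] by simp
        ultimately show "step (FOp Plus (0, 11, 5, 6) (0, 12, 5, 6) (2, 3, 3, 3)) v
            = put_fld (0, 11, 5, 6) (fld t 0 (m - Suc k) i j) v"
          using v ru by simp
      next
        fix v :: "'k state" assume v: "\<And>q. q \<noteq> 5 \<Longrightarrow> q \<noteq> 6 \<Longrightarrow> reg v q = reg u q" "cf v = cf u"
          "\<And>b p i j. fld v b p i j = (if b = 0 \<and> p = reg u 11 \<and> i < n \<and> j < n then fld t 0 (m - Suc k) i j else fld u b p i j)"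
        have "fld v 0 p i j = (if m - Suc k < p \<and> p \<le> m then fld s 0 (p - 1) i j else fld s 0 p i j)"
          if "i < n" "j < n" for p i j
        proof -
          have "fld v 0 p i j = (if p = m - k then fld t 0 (m - Suc k) i j else fld t 0 p i j)"
            using that ru fu by (simp add: v(3))
          also have "\<dots> = (if m - Suc k < p \<and> p \<le> m then fld s 0 (p - 1) i j else fld s 0 p i j)"
            using t(1,2) that by (auto simp: shifted_def)
          finally show ?thesis .
        qed
        moreover have "fld v 2 = fld s 2"
          using v(3) fu t(2) by (simp add: fun_eq_iff shifted_def)
        ultimately show "reg v 4 = k \<and> reg v 2 = 1 \<and> reg v 9 = m - q \<and> shifted m (Suc k) (v\<lparr>reg := (reg v)(4 := Suc k)\<rparr>)"
          using v(1,2) u ru m by (simp add: shifted_def J_def)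
      qed (use ru in auto)
    qed simp
  qed (use regs m in \<open>auto simp: shifted_def\<close>)
qed

lemma runs_insert_prog:
  assumes q: "reg s 8 = q" "q \<le> m" and m: "reg s 1 = m" "reg s 9 = m - q" and c5: "cf s 5 0 = 0"
  shows "runs (insert_prog rep) s (2000 * (n + 1) ^ 2 * (m + 1)) (\<lambda>s'. reg s' 0 = n \<and> reg s' 1 = Suc m \<and>
    (\<forall>i\<le>m. cf s' 0 i = inserted q (cf s 8 0) (cf s 0) i) \<and>
    (\<forall>i\<le>m. \<forall>j<n. \<forall>k<n. fld s' 0 i j k = inserted q (full_entry rep) (fld s 0) i j k))"
  unfolding insert_prog_def
proof (rule runs_Seq [OF runs_shift_prog [OF q m c5],
      where T' = "(2 + n * (2 + n * 3 + 2)) + ((2 + 3 * n) + 2)"])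
  fix t assume t: "shifted m (m - q) t"
  note t' = shifted_regs [OF t q m c5]
  define filled where "filled G u \<longleftrightarrow> reg u 0 = n \<and> reg u 1 = m \<and> reg u 2 = 1 \<and> reg u 3 = 0 \<and> reg u 8 = q \<and> cf u = cf t \<and>
    (\<forall>i\<le>m. \<forall>j<n. \<forall>k<n. fld u 0 i j k = inserted q G (fld s 0) i j k)" for G and u :: "'k state"
  show "runs (Seq (For 4 0 (For 5 0 (block [FConst (0, 8, 4, 5) 0])))
       (Seq (if rep = Image then For 4 0 (block [FConst (0, 8, 4, 4) 1]) else block [])
         (block [COp Plus (0, 8) (8, 3) (5, 3), RAdd 1 1 2]))) t ((2 + n * (2 + n * 3 + 2)) + ((2 + 3 * n) + 2))
    (\<lambda>s'. reg s' 0 = n \<and> reg s' 1 = Suc m \<and>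
      (\<forall>i\<le>m. cf s' 0 i = inserted q (cf s 8 0) (cf s 0) i) \<and>
      (\<forall>i\<le>m. \<forall>j<n. \<forall>k<n. fld s' 0 i j k = inserted q (full_entry rep) (fld s 0) i j k))"
  proof (rule runs_Seq [where R = "filled (\<lambda>_ _. 0)"])
    show "runs (For 4 0 (For 5 0 (block [FConst (0, 8, 4, 5) 0]))) t (2 + n * (2 + n * 3 + 2)) (filled (\<lambda>_ _. 0))"
    proof (rule runs_fill [where a = 0 and r = 8 and n = n and G = "\<lambda>_ _. 0"])
      fix u :: "'k state" assume u: "\<And>q. q \<noteq> 4 \<Longrightarrow> q \<noteq> 5 \<Longrightarrow> reg u q = reg t q" "cf u = cf t"
        "\<And>b p i j. fld u b p i j = (if b = 0 \<and> p = reg t 8 \<and> i < n \<and> j < n then 0 else fld t b p i j)"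
      have "fld u 0 i j k = inserted q (\<lambda>_ _. 0) (fld s 0) i j k" if "i \<le> m" "j < n" "k < n" for i j k
        using that t q(2) unfolding u(3) t'(5) by (simp add: shifted_def inserted_def)
      then show "filled (\<lambda>_ _. 0) u"
        using u t' by (simp add: filled_def)
    qed (use t' in auto)
    fix u assume u: "filled (\<lambda>_ _. 0) u"
    show "runs (Seq (if rep = Image then For 4 0 (block [FConst (0, 8, 4, 4) 1]) else block [])
         (block [COp Plus (0, 8) (8, 3) (5, 3), RAdd 1 1 2])) u ((2 + 3 * n) + 2)
      (\<lambda>s'. reg s' 0 = n \<and> reg s' 1 = Suc m \<and>
        (\<forall>i\<le>m. cf s' 0 i = inserted q (cf s 8 0) (cf s 0) i) \<and>
        (\<forall>i\<le>m. \<forall>j<n. \<forall>k<n. fld s' 0 i j k = inserted q (full_entry rep) (fld s 0) i j k))"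
    proof (rule runs_Seq [where R = "filled (full_entry rep)"])
      show "runs (if rep = Image then For 4 0 (block [FConst (0, 8, 4, 4) 1]) else block []) u (2 + 3 * n)
          (filled (full_entry rep))"
      proof (cases "rep = Image")
        case True
        have "runs (For 4 0 (block [FConst (0, 8, 4, 4) 1])) u (2 + 3 * n) (filled (full_entry rep))"
        proof (rule runs_For [where I = "\<lambda>k. filled (\<lambda>i j. of_bool (i = j \<and> i < k))" and M = n and T = 1])
          fix v assume v: "filled (\<lambda>i j. of_bool (i = j \<and> i < n)) v"
          have "inserted q (\<lambda>i j. of_bool (i = j \<and> i < n)) (fld s 0) i j k = inserted q (full_entry rep) (fld s 0) i j k"
            if "j < n" for i j k
            using that True by (simp add: inserted_def full_entry_def)
          with v show "filled (full_entry rep) v"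
            by (simp add: filled_def)
        next
          fix k v assume k: "k < n" "filled (\<lambda>i j. of_bool (i = j \<and> i < k)) v" "reg v 4 = k" "reg v 2 = 1" "reg v 0 = n"
          then show "runs (block [FConst (0, 8, 4, 4) 1]) v 1 (\<lambda>v'. reg v' 4 = k \<and> reg v' 2 = 1 \<and> reg v' 0 = n \<and>
              filled (\<lambda>i j. of_bool (i = j \<and> i < Suc k)) (v'\<lparr>reg := (reg v')(4 := Suc k)\<rparr>))"
            by (intro runs_block) (auto simp: filled_def inserted_def less_Suc_eq)
        qed (use u in \<open>auto simp: filled_def\<close>)
        with True show ?thesis
          by simp
      next
        case False
        then have "full_entry rep = (\<lambda>_ _. 0 :: 'k)"
          by (simp add: full_entry_def fun_eq_iff)
        with False u show ?thesis
          by (simp only: if_False) (rule runs_block; simp)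
      qed
      fix v assume v: "filled (full_entry rep) v"
      have c8: "cf t 8 0 = cf s 8 0"
        using t' by simp
      have "(if i = q then cf s 8 0 else cf t 0 i) = inserted q (cf s 8 0) (cf s 0) i" if "i \<le> m" for i
        using that t q(2) by (simp add: shifted_def inserted_def)
      then show "runs (block [COp Plus (0, 8) (8, 3) (5, 3), RAdd 1 1 2]) v 2
        (\<lambda>s'. reg s' 0 = n \<and> reg s' 1 = Suc m \<and>
          (\<forall>i\<le>m. cf s' 0 i = inserted q (cf s 8 0) (cf s 0) i) \<and>
          (\<forall>i\<le>m. \<forall>j<n. \<forall>k<n. fld s' 0 i j k = inserted q (full_entry rep) (fld s 0) i j k))"
        by (intro runs_block) (use v t' c8 in \<open>simp_all add: filled_def\<close>)
    qed simp
  qed simp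
next
  have "(m - q) * (3 + (2 + n * (2 + n * 3 + 2)) + 2) \<le> m * (3 + (2 + n * (2 + n * 3 + 2)) + 2)"
    by (intro mult_right_mono) simp_all
  moreover have "2 + m * (3 + (2 + n * (2 + n * 3 + 2)) + 2) + ((2 + n * (2 + n * 3 + 2)) + ((2 + 3 * n) + 2))
      \<le> 2000 * (n + 1) ^ 2 * (m + 1)"
    by (simp add: power2_eq_square algebra_simps)
  ultimately show "2 + (m - q) * (3 + (2 + n * (2 + n * 3 + 2)) + 2) + ((2 + n * (2 + n * 3 + 2)) + ((2 + 3 * n) + 2))
      \<le> 2000 * (n + 1) ^ 2 * (m + 1)"
    by linarith
qed

end


section \<open>The algorithm\<close>

text \<open>\<open>Plus\<close> is the program for the inclusion order, where the new element \<open>K\<^sup>n\<close> is the top of the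
  chain, and \<open>Minus\<close> the one for the reverse order, where it is the bottom.\<close>

definition slot_prog :: "arith \<Rightarrow> program" where
  "slot_prog f = block ((if f = Plus then [RSub 7 1 2, RAdd 8 1 3] else [RConst 7 0, RConst 8 0]) @ [RSub 9 1 8])"

definition resolvent_prog :: "representation \<Rightarrow> arith \<Rightarrow> program" where
  "resolvent_prog rep f = Seq init_prog (Seq (weights_prog f) (Seq (slot_prog f) (Seq (test_prog rep)
     (Branch (RLess 3 10) (block [COp Plus (0, 7) (0, 7) (8, 3)]) (insert_prog rep)))))"

text \<open>A description of memory alone; its meaning for points is given in
  \<open>stores_resolvent\<close>. The slot for K^n is created even if its weight \<open>w\<close>
  is 0, which the storage format permits.\<close>

definition resolvent_state ::
  "representation \<Rightarrow> arith \<Rightarrow> (nat \<Rightarrow> real) \<Rightarrow> real \<Rightarrow> 'k::field state \<Rightarrow> 'k state \<Rightarrow> bool" where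
  "resolvent_state rep f d w s s' \<longleftrightarrow> (let n = reg s 0; m = reg s 1; e = (if f = Plus then m - 1 else 0);
       q = (if f = Plus then m else 0) in
     reg s' 0 = n \<and>
     (if represented_subspace rep (matrix_of n (fld s 0 e)) = carrier_vec n
      then reg s' 1 = m \<and> fld s' 0 = fld s 0 \<and> (\<forall>i<m. cf s' 0 i = d i + (if i = e then w else 0))
      else reg s' 1 = Suc m \<and> (\<forall>i\<le>m. cf s' 0 i = inserted q w d i) \<and>
        (\<forall>i\<le>m. \<forall>j<n. \<forall>k<n. fld s' 0 i j k = inserted q (full_entry rep) (fld s 0) i j k)))"

text \<open>Chains in a lattice of rank n have at most n + 1 elements; the bound on \<open>m\<close>
  turns a running time in n and m into a polynomial in n.\<close>

lemma runs_resolvent_prog: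
  assumes f: "f = Plus \<or> f = Minus" and s: "reg s 0 = n" "reg s 1 = m" "cf s 1 0 = \<mu>" "cf s 0 = c"
    and m: "1 \<le> m" "m \<le> Suc n" and total: "tail_sum m c 0 = 1"
  defines "h \<equiv> prox (sgn_of f) n \<mu>"
  shows "runs (resolvent_prog rep f) s (10000 * (n + 2) ^ 3) (resolvent_state rep f
    (\<lambda>i. h (tail_sum m c i) - h (tail_sum m c (Suc i))) (1 - h 1 + h 0) s)"
proof -
  define d where "d i = h (tail_sum m c i) - h (tail_sum m c (Suc i))" for i
  define w where "w = 1 - h 1 + h 0"
  define e where "e = (if f = Plus then m - 1 else 0)"
  define q where "q = (if f = Plus then m else 0)"
  define T1 where "T1 = 2000 * (n + 1) ^ 3"
  define T2 where "T2 = 1 + 2000 * (n + 1) ^ 2 * (m + 1)"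
  define R2 where "R2 t \<longleftrightarrow> prepared n \<mu> s t \<and> (\<forall>i<m. cf t 0 i = d i) \<and> cf t 8 0 = w" for t :: "'a state"
  define R3 where "R3 t \<longleftrightarrow> R2 t \<and> reg t 7 = e \<and> reg t 8 = q \<and> reg t 9 = m - q" for t :: "'a state"
  define full where "full \<longleftrightarrow> represented_subspace rep (matrix_of n (fld s 0 e)) = carrier_vec n"
  let ?Q = "resolvent_state rep f d w s"
  have last: "runs (Seq (test_prog rep) (Branch (RLess 3 10) (block [COp Plus (0, 7) (0, 7) (8, 3)]) (insert_prog rep)))
      t (T1 + T2) ?Q" if t: "R3 t" for t
  proof -
    have t': "prepared n \<mu> s t" "\<And>i. i < m \<Longrightarrow> cf t 0 i = d i" "cf t 8 0 = w" "reg t 7 = e" "reg t 8 = q" "reg t 9 = m - q"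
      using t by (auto simp: R3_def R2_def)
    then have tr: "reg t 0 = n" "reg t 1 = m" "reg t 2 = 1" "reg t 3 = 0" "cf t 5 0 = 0" "fld t 0 = fld s 0" "fld t 2 0 0 0 = 0"
      using s by (auto simp: prepared_def)
    interpret t: ready t n
      by standard (use tr in auto)
    have test: "runs (test_prog rep) t T1 (t.tested full)"
      using t.runs_test_prog [of rep] by (simp add: T1_def full_def tr t')
    show ?thesis
    proof (rule runs_Seq [OF test _ order_refl])
      fix u assume u: "t.tested full u"
      have u': "reg u 0 = n" "reg u 1 = m" "reg u 2 = 1" "reg u 3 = 0" "reg u 7 = e" "reg u 8 = q" "reg u 9 = m - q"
        "reg u 10 = of_bool full" "cf u = cf t" "fld u 0 = fld s 0" "fld u 2 0 0 0 = 0"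
        using u tr t' by (auto simp: t.tested_def)
      interpret u: ready u n
        by standard (use u' in auto)
      show "runs (Branch (RLess 3 10) (block [COp Plus (0, 7) (0, 7) (8, 3)]) (insert_prog rep)) u T2 ?Q"
        unfolding T2_def
      proof (rule runs_Branch [where T = "2000 * (n + 1) ^ 2 * (m + 1)"])
        assume "holds (RLess 3 10) u"
        then have full
          using u' by (simp split: if_splits)
        show "runs (block [COp Plus (0, 7) (0, 7) (8, 3)]) u (2000 * (n + 1) ^ 2 * (m + 1)) ?Q"
        proof (rule runs_block)
          have "represented_subspace rep (matrix_of n (fld s 0 e)) = carrier_vec n"
            using \<open>full\<close> by (simp add: full_def)
          then show "?Q (fold step [COp Plus (0, 7) (0, 7) (8, 3)] u)"
            unfolding resolvent_state_def Let_def s e_def [symmetric]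
            using u' t' by simp
        qed (simp add: Suc_le_eq)
      next
        assume "\<not> holds (RLess 3 10) u"
        then have "\<not> full"
          using u' by simp
        then have nfull: "represented_subspace rep (matrix_of n (fld s 0 e)) \<noteq> carrier_vec n"
          by (simp add: full_def)
        have qm: "q \<le> m"
          by (simp add: q_def)
        have "inserted q w (cf t 0) i = inserted q w d i" if "i \<le> m" for i
          using that qm t'(2) by (simp add: inserted_def)
        then have "?Q u'" if "reg u' 0 = n \<and> reg u' 1 = Suc m \<and>
            (\<forall>i\<le>m. cf u' 0 i = inserted q (cf u 8 0) (cf u 0) i) \<and>
            (\<forall>i\<le>m. \<forall>j<n. \<forall>k<n. fld u' 0 i j k = inserted q (full_entry rep) (fld u 0) i j k)" for u'
          unfolding resolvent_state_def Let_def s e_def [symmetric] q_def [symmetric]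
          using that nfull u' t' by simp
        moreover have "cf u 5 0 = 0"
          using u' tr by simp
        ultimately show "runs (insert_prog rep) u (2000 * (n + 1) ^ 2 * (m + 1)) ?Q"
          using u.runs_insert_prog [OF u'(6) qm u'(2,7), of rep] unfolding runs_def by blast
      qed simp
    qed
  qed
  have "runs (resolvent_prog rep f) s (10000 * (n + 2) ^ 3) ?Q"
    unfolding resolvent_prog_def
  proof (rule runs_Seq [OF runs_init_prog [OF s(1,3)], where T' = "(10 + 11 * m) + (3 + (T1 + T2))"])
    fix t1 assume t1: "prepared n \<mu> s t1 \<and> cf t1 0 = cf s 0 \<and> cf t1 6 0 = 1"
    have weights: "runs (weights_prog f) t1 (10 + 11 * m) R2"
      using runs_weights_prog [OF f _ _ _ s(2) total, of n \<mu> t1] t1 s(4)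
      unfolding R2_def d_def w_def h_def by auto
    show "runs (Seq (weights_prog f) (Seq (slot_prog f) (Seq (test_prog rep)
      (Branch (RLess 3 10) (block [COp Plus (0, 7) (0, 7) (8, 3)]) (insert_prog rep))))) t1
      ((10 + 11 * m) + (3 + (T1 + T2))) ?Q"
    proof (rule runs_Seq [OF weights _ order_refl])
      fix t2 assume t2: "R2 t2"
      have "runs (slot_prog f) t2 3 R3"
        unfolding slot_prog_def
        by (rule runs_block) (use t2 s f in \<open>auto simp: R3_def R2_def prepared_def e_def q_def\<close>)
      then show "runs (Seq (slot_prog f) (Seq (test_prog rep)
        (Branch (RLess 3 10) (block [COp Plus (0, 7) (0, 7) (8, 3)]) (insert_prog rep)))) t2 (3 + (T1 + T2)) ?Q"
        by (rule runs_Seq) (use last in auto)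
    qed
  next
    have "2000 * (n + 1) ^ 2 * (m + 1) \<le> 2000 * (n + 1) ^ 2 * (n + 2)"
      using m by (intro mult_left_mono) auto
    moreover have "11 * m \<le> 11 * (n + 1)"
      using m by simp
    ultimately have "12 + 3 * n + (10 + 11 * m + (3 + (T1 + T2)))
        \<le> 12 + 3 * n + (10 + 11 * (n + 1) + (3 + (2000 * (n + 1) ^ 3 + (1 + 2000 * (n + 1) ^ 2 * (n + 2)))))"
      unfolding T1_def T2_def by (intro add_mono order_refl)
    also have "\<dots> \<le> 10000 * (n + 2) ^ 3"
      by (simp add: power2_eq_square power3_eq_cube algebra_simps)
    finally show "12 + 3 * n + (10 + 11 * m + (3 + (T1 + T2))) \<le> 10000 * (n + 2) ^ 3" .
  qed
  then show ?thesis
    unfolding d_def w_def .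
qed

section \<open>From memory contents to points of the complex\<close>

lemma length_stored_chain [simp]: "length (stored_chain rep s) = reg s 1"
  by (simp add: stored_chain_def)

lemma stored_chain_nth:
  "i < reg s 1 \<Longrightarrow> stored_chain rep s ! i = represented_subspace rep (matrix_of (reg s 0) (fld s 0 i))"
  by (simp add: stored_chain_def)

lemma square_mat_cong:
  "(\<And>i j. i < n \<Longrightarrow> j < n \<Longrightarrow> A i j = B i j) \<Longrightarrow> matrix_of n A = matrix_of n B"
  by (rule eq_matI) auto

text \<open>Under inclusion this removes the weight \<open>1 - h 1\<close> of the bottom {0}; the
  quotient is at least 1 because 4n is.\<close>

lemma prox_one:
  assumes "0 < \<mu>" "1 \<le> n"
  shows "prox 1 n \<mu> 1 = 1"
proof -
  have "\<mu> / (4 * real n) \<le> \<mu> / 1"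
    using assms by (intro divide_left_mono) auto
  moreover have "0 \<le> \<mu> / (4 * real n)"
    using assms by simp
  ultimately have "1 \<le> (1 + 1 * \<mu>) / (1 + \<mu> / (4 * real n))"
    by (subst le_divide_eq_1_pos) auto
  then show ?thesis
    unfolding prox_def by linarith
qed

text \<open>Under reverse inclusion this removes the weight \<open>h 0\<close> of the top
  {0}.\<close>

lemma prox_zero:
  assumes "0 < \<mu>"
  shows "prox (- 1) n \<mu> 0 = 0"
proof -
  have "(0 + - 1 * \<mu>) / (1 + \<mu> / (4 * real n)) \<le> 0"
    using assms by (intro divide_nonpos_nonneg) auto
  then show ?thesis
    unfolding prox_def by linarith
qed

context ranked_order
begin

text \<open>In a strictly increasing list the top can only be the last element, so testing a single
  slot decides whether it occurs at all.\<close>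

lemma lattice_chain_snoc:
  assumes "lattice_chain N ps" "ps \<noteq> []" "last ps \<noteq> tp"
  shows "lattice_chain N (ps @ [tp])"
proof -
  have ps: "set ps \<subseteq> carrier N" "sorted_wrt (\<lambda>p q. p \<sqsubset> q) ps"
    using assms by (auto simp: lattice_chain_def)
  have "p \<noteq> tp" if p: "p \<in> set ps" for p
  proof
    assume "p = tp"
    obtain i where i: "i < length ps" "p = ps ! i"
      using p by (auto simp: in_set_conv_nth)
    show False
    proof (cases "i = length ps - 1")
      case True
      then show False
        using i assms(2,3) \<open>p = tp\<close> by (simp add: last_conv_nth)
    next
      case False
      then have "rk (ps ! i) < rk (last ps)"
        using sorted_wrt_nth_less [OF lattice_chain_set(3) [OF assms(1)], of i "length ps - 1"] i assms(2)
        by (simp add: last_conv_nth)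
      then show False
        using rk_le [OF subsetD [OF ps(1) last_in_set [OF assms(2)]]] i \<open>p = tp\<close> tp(2) by simp
    qed
  qed
  then show ?thesis
    using ps tp by (auto simp: lattice_chain_def sorted_wrt_append lless_iff)
qed

lemma lattice_chain_Cons:
  assumes "lattice_chain N ps" "ps \<noteq> []" "hd ps \<noteq> bt"
  shows "lattice_chain N (bt # ps)"
proof -
  have ps: "set ps \<subseteq> carrier N" "sorted_wrt (\<lambda>p q. p \<sqsubset> q) ps"
    using assms by (auto simp: lattice_chain_def)
  have "p \<noteq> bt" if p: "p \<in> set ps" for p
  proof
    assume "p = bt"
    obtain i where i: "i < length ps" "p = ps ! i"
      using p by (auto simp: in_set_conv_nth)
    show False
    proof (cases "i = 0")
      case True
      then show False
        using i assms(2,3) \<open>p = bt\<close> by (simp add: hd_conv_nth)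
    next
      case False
      then have "rk (ps ! 0) < rk (ps ! i)"
        using sorted_wrt_nth_less [OF lattice_chain_set(3) [OF assms(1)], of 0 i] i by simp
      then show False
        using i \<open>p = bt\<close> bt(2) by simp
    qed
  qed
  then show ?thesis
    using ps bt by (auto simp: lattice_chain_def lless_iff)
qed

text \<open>Existence and uniqueness are claimed for every point, stored or not; so the point is
  first written along a list of its own support.\<close>

lemma unique_proximal_minimizer:
  assumes n: "1 \<le> n" and \<mu>: "0 < \<mu>" and x: "x \<in> K"
    and g: "\<And>y. y \<in> K \<Longrightarrow> g y = C - \<epsilon> * (\<Sum>j = 1..n. coord rk y j)
      + 1 / (8 * real n) * (oc_dist N (vertex bt) y)\<^sup>2"
  shows "\<exists>!z. proximal_minimizer N g \<mu> x z"
proof -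
  obtain ps where ps: "lattice_chain N ps" "set ps = supp x"
    using obtain_list [OF K_D(3) [OF x]] .
  have "x p = (\<Sum>i<length ps. x (ps ! i) * vertex (ps ! i) p)" for p
  proof -
    have "(\<Sum>i<length ps. x (ps ! i) * vertex (ps ! i) p) = (\<Sum>q\<in>set ps. x q * vertex q p)"
      by (rule sum.reindex_bij_betw [OF bij_betw_nth]) (use lattice_chain_set(2) [OF ps(1)] in auto)
    also have "\<dots> = (\<Sum>q\<in>set ps. if q = p then x p else 0)"
      by (rule sum.cong) (auto simp: vertex_def)
    also have "\<dots> = (if p \<in> set ps then x p else 0)"
      by simp
    also have "\<dots> = x p"
      unfolding ps(2) by (simp add: supp_def)
    finally show ?thesis ..
  qed
  then have "x = (\<lambda>p. \<Sum>i<length ps. x (ps ! i) * vertex (ps ! i) p)"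
    by blast
  from prox_point_minimizer [OF n \<mu> g ps(1) x this] show ?thesis
    by simp
qed

end

text \<open>Common to both orders: it only matters which end is K^n, and that the sign belonging to
  \<open>f\<close> makes the weight of the other end vanish.\<close>

lemma stores_resolvent:
  fixes N :: "'k::field vec set gorder"
  assumes "ranked_order N n rk mr bt tp"
    and n: "1 \<le> n" and \<mu>: "0 < \<mu>" and x: "x \<in> orthoscheme_complex N"
    and g: "\<And>y. y \<in> orthoscheme_complex N \<Longrightarrow> g y = C - sgn_of f * (\<Sum>j = 1..n. coord rk y j)
      + 1 / (8 * real n) * (oc_dist N (vertex bt) y)\<^sup>2"
    and f: "f = Plus \<and> tp = carrier_vec n \<or> f = Minus \<and> bt = carrier_vec n"
    and st: "stores_point rep n N s x" "cf s 1 0 = \<mu>"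
  shows "\<exists>t s'. exec (resolvent_prog rep f) s t s' \<and> t \<le> 10000 * (n + 2) ^ 3 \<and>
    stores_point rep n N s' (resolvent N g \<mu> x)"
proof -
  interpret ranked_order N n rk mr bt tp
    by fact
  define ps where "ps = stored_chain rep s"
  define m where "m = reg s 1"
  define c where "c = cf s 0"
  have s: "reg s 0 = n" "lattice_chain N ps" "length ps = m"
    "x = (\<lambda>p. \<Sum>i<length ps. c i * vertex (ps ! i) p)"
    using st by (auto simp: stores_point_def ps_def m_def c_def)
  have ps_nth: "ps ! i = represented_subspace rep (matrix_of n (fld s 0 i))" if "i < m" for i
    using that s(1) by (simp add: ps_def m_def stored_chain_nth)
  have total: "tail_sum m c 0 = 1"
    using chain_total [OF s(2) x s(4)] s(3) by simp
  have m: "1 \<le> m" "m \<le> Suc n"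
  proof -
    show "1 \<le> m"
      using total by (cases m) (auto simp: tail_sum_def)
    show "m \<le> Suc n"
      using is_chain_finite(2) [OF lattice_chain_set(1) [OF s(2)]] distinct_card [OF lattice_chain_set(2) [OF s(2)]] s(3)
      by simp
  qed
  define h where "h = prox (sgn_of f) n \<mu>"
  define d where "d i = h (tail_sum m c i) - h (tail_sum m c (Suc i))" for i
  define w where "w = 1 - h 1 + h 0"
  define z where "z = prox_point h c ps"
  have z: "resolvent N g \<mu> x = z"
    unfolding resolvent_def z_def h_def
    using prox_point_minimizer [OF n \<mu> g s(2) x s(4)] by (intro the_equality) blast+
  \<comment> \<open>One of \<open>1 - h 1\<close> and \<open>h 0\<close> is 0, so \<open>w\<close>
    is exactly the weight due to the end K^n.\<close>
  have zp: "z p = (\<Sum>i<m. d i * vertex (ps ! i) p) + w * vertex (carrier_vec n) p" for p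
  proof (cases "f = Plus")
    case True
    then have "h 1 = 1" "tp = carrier_vec n"
      using f prox_one [OF \<mu> n] by (auto simp: h_def sgn_of_def)
    then show ?thesis
      unfolding z_def prox_point_def by (simp add: d_def w_def s(3))
  next
    case False
    then have "h 0 = 0" "bt = carrier_vec n"
      using f prox_zero [OF \<mu>] by (auto simp: h_def sgn_of_def)
    then show ?thesis
      unfolding z_def prox_point_def by (simp add: d_def w_def s(3))
  qed
  define e where "e = (if f = Plus then m - 1 else 0)"
  define q where "q = (if f = Plus then m else 0)"
  have e: "e < m"
    using m by (simp add: e_def)
  have f': "f = Plus \<or> f = Minus"
    using f by blast
  obtain t s' where ex: "exec (resolvent_prog rep f) s t s'" "t \<le> 10000 * (n + 2) ^ 3"
    and s': "resolvent_state rep f d w s s'"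
    using runs_resolvent_prog [OF f' s(1) m_def [symmetric] st(2) c_def [symmetric] m total, of rep]
    unfolding runs_def h_def d_def w_def by blast
  note s' = s' [unfolded resolvent_state_def Let_def s(1) m_def [symmetric] e_def [symmetric] q_def [symmetric]]
  have "stores_point rep n N s' z"
  proof (cases "represented_subspace rep (matrix_of n (fld s 0 e)) = carrier_vec n")
    case True
    with s' have r: "reg s' 0 = n" "reg s' 1 = m" "fld s' 0 = fld s 0" "\<And>i. i < m \<Longrightarrow> cf s' 0 i = d i + (if i = e then w else 0)"
      by simp_all
    have ps': "stored_chain rep s' = ps"
      by (rule nth_equalityI) (use r s ps_nth in \<open>auto simp: stored_chain_nth\<close>)
    have "(\<Sum>i<m. cf s' 0 i * vertex (ps ! i) p)
        = (\<Sum>i<m. d i * vertex (ps ! i) p + (if i = e then w * vertex (ps ! e) p else 0))" for p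
      by (rule sum.cong) (use r in \<open>auto simp: algebra_simps\<close>)
    then have "z p = (\<Sum>i<m. cf s' 0 i * vertex (ps ! i) p)" for p
      unfolding zp using e ps_nth [OF e] True by (simp add: sum.distrib)
    then show ?thesis
      unfolding stores_point_def ps' r(2) using s(2) r(1) by auto
  next
    case False
    with s' have r: "reg s' 0 = n" "reg s' 1 = Suc m" "\<And>i. i \<le> m \<Longrightarrow> cf s' 0 i = inserted q w d i"
      "\<And>i j k. i \<le> m \<Longrightarrow> j < n \<Longrightarrow> k < n \<Longrightarrow> fld s' 0 i j k = inserted q (full_entry rep) (fld s 0) i j k"
      by simp_all
    have nth: "stored_chain rep s' ! i = inserted q (carrier_vec n) ((!) ps) i" if i: "i \<le> m" for i
    proof -
      have "stored_chain rep s' ! i = represented_subspace rep (matrix_of n (inserted q (full_entry rep) (fld s 0) i))"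
        using i r square_mat_cong [of n "fld s' 0 i"] by (simp add: stored_chain_nth)
      then show ?thesis
        using i represented_full_entry [of rep n] ps_nth m by (auto simp: inserted_def q_def)
    qed
    have ne: "ps ! e \<noteq> carrier_vec n"
      unfolding ps_nth [OF e] by (rule False)
    have ps_ne: "ps \<noteq> []"
      using e s(3) by force
    show ?thesis
    proof (cases "f = Plus")
      case True
      then have q: "q = m" "e = m - 1" "tp = carrier_vec n"
        using f by (auto simp: q_def e_def)
      have ps': "stored_chain rep s' = ps @ [carrier_vec n]"
        by (rule nth_equalityI) (use r s nth q in \<open>auto simp: inserted_def nth_append less_Suc_eq\<close>)
      have "lattice_chain N (ps @ [carrier_vec n])"
        using lattice_chain_snoc [OF s(2) ps_ne] ne ps_ne q s(3) by (simp add: last_conv_nth)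
      moreover have "z p = (\<Sum>i<Suc m. cf s' 0 i * vertex ((ps @ [carrier_vec n]) ! i) p)" for p
        unfolding zp sum.lessThan_Suc using r(3) q s(3) by (simp add: inserted_def nth_append)
      ultimately show ?thesis
        unfolding stores_point_def ps' r(2) using r(1) by blast
    next
      case False
      then have q: "q = 0" "e = 0" "bt = carrier_vec n"
        using f by (auto simp: q_def e_def)
      have ps': "stored_chain rep s' = carrier_vec n # ps"
        by (rule nth_equalityI) (use r s nth q in \<open>auto simp: inserted_def nth_Cons split: nat.split\<close>)
      have "lattice_chain N (carrier_vec n # ps)"
        using lattice_chain_Cons [OF s(2) ps_ne] ne ps_ne q by (simp add: hd_conv_nth)
      moreover have "z p = (\<Sum>i<Suc m. cf s' 0 i * vertex ((carrier_vec n # ps) ! i) p)" for p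
        unfolding zp sum.lessThan_Suc_shift using r(3) q by (simp add: inserted_def)
      ultimately show ?thesis
        unfolding stores_point_def ps' r(2) using r(1) by blast
    qed
  qed
  with ex show ?thesis
    unfolding z by blast
qed

text \<open>An element p is counted in the coordinates 1 to \<open>r p\<close>. So the sum of the
  coordinates is the Lovasz extension of r.\<close>

lemma sum_coord:
  assumes "\<And>p. p \<in> supp x \<Longrightarrow> r p \<le> n"
  shows "(\<Sum>j = 1..n. coord r x j) = (\<Sum>p\<in>supp x. x p * real (r p))"
proof -
  \<comment> \<open>The additional factor, always 1 in this range, makes
    \<open>sum_of_bool_le_min\<close> applicable with second argument n.\<close>
  have "(\<Sum>j = 1..n. coord r x j) = (\<Sum>p\<in>supp x. \<Sum>j = 1..n. x p * (of_bool (j \<le> r p) * of_bool (j \<le> n)))"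
    unfolding coord_def by (subst sum.swap) (intro sum.cong refl, auto)
  also have "\<dots> = (\<Sum>p\<in>supp x. x p * real (r p))"
    by (intro sum.cong refl) (simp only: sum_distrib_left [symmetric] sum_of_bool_le_min assms min.absorb1)
  finally show ?thesis .
qed

lemma resolvent_in_polynomial_timeI:
  fixes N :: "nat \<Rightarrow> 'k::field vec set gorder"
  assumes "\<And>n x \<mu>. \<lbrakk>1 \<le> n; 0 < \<mu>; x \<in> orthoscheme_complex (N n)\<rbrakk> \<Longrightarrow> \<exists>!z. proximal_minimizer (N n) (f n) \<mu> x z"
    and "\<And>n x \<mu> s. \<lbrakk>1 \<le> n; 0 < \<mu>; x \<in> orthoscheme_complex (N n); stores_point rep n (N n) s x; cf s 1 0 = \<mu>\<rbrakk> \<Longrightarrow>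
      \<exists>t s'. exec P s t s' \<and> t \<le> 10000 * (n + 2) ^ 3 \<and> stores_point rep n (N n) s' (resolvent (N n) (f n) \<mu> x)"
  shows "resolvent_in_polynomial_time rep N f"
proof -
  have poly: "poly ([:10000:] * [:2, 1:] ^ 3) n = 10000 * (n + 2 :: nat) ^ 3" for n
    by (simp add: add.commute)
  show ?thesis
    unfolding resolvent_in_polynomial_time_def
    by (rule exI [of _ P], rule exI [of _ "[:10000:] * [:2, 1:] ^ 3"], unfold poly) (use assms in blast)
qed

section \<open>The two resolvents\<close>

context vec_space
begin

lemma resolvent_subspace_lattice:
  assumes n: "1 \<le> n" and \<mu>: "0 < \<mu>" and x: "x \<in> orthoscheme_complex (subspace_lattice n :: 'a vec set gorder)"
  defines "g \<equiv> \<lambda>x. - lovasz_extension (\<lambda>W. real (subspace_dim n W)) x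
    + 1 / (8 * real n) * (oc_dist (subspace_lattice n) (vertex \<bottom>\<^bsub>subspace_lattice n\<^esub>) x)\<^sup>2"
  shows "\<exists>!z. proximal_minimizer (subspace_lattice n) g \<mu> x z"
    and "\<lbrakk>stores_point rep n (subspace_lattice n) s x; cf s 1 0 = \<mu>\<rbrakk> \<Longrightarrow>
      \<exists>t s'. exec (resolvent_prog rep Plus) s t s' \<and> t \<le> 10000 * (n + 2) ^ 3 \<and>
        stores_point rep n (subspace_lattice n) s' (resolvent (subspace_lattice n) g \<mu> x)"
proof -
  interpret L: ranked_order "subspace_lattice n :: 'a vec set gorder" n "subspace_dim n"
    "\<lambda>Q W. subspace_dim n (W \<inter> Q)" "{0\<^sub>v n}" "carrier_vec n"
    by (rule ranked_order_subspace_lattice)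
  have g: "g y = 0 - sgn_of Plus * (\<Sum>j = 1..n. coord (subspace_dim n) y j)
      + 1 / (8 * real n) * (oc_dist (subspace_lattice n) (vertex {0\<^sub>v n}) y)\<^sup>2" if y: "y \<in> L.K" for y
  proof -
    have "(\<Sum>j = 1..n. coord (subspace_dim n) y j) = lovasz_extension (\<lambda>W. real (subspace_dim n W)) y"
      unfolding lovasz_extension_def by (rule sum_coord) (use L.K_D(4) [OF y] L.rk_le in auto)
    then show ?thesis
      by (simp add: g_def bottom_subspace_lattice sgn_of_def)
  qed
  show "\<exists>!z. proximal_minimizer (subspace_lattice n) g \<mu> x z"
    by (rule L.unique_proximal_minimizer [OF n \<mu> x g])
  show "\<exists>t s'. exec (resolvent_prog rep Plus) s t s' \<and> t \<le> 10000 * (n + 2) ^ 3 \<and>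
      stores_point rep n (subspace_lattice n) s' (resolvent (subspace_lattice n) g \<mu> x)"
    if "stores_point rep n (subspace_lattice n) s x" "cf s 1 0 = \<mu>"
    by (rule stores_resolvent [OF L.ranked_order_axioms n \<mu> x g _ that]) simp_all
qed

text \<open>The dimension is n minus the rank and the coefficients sum to 1, so the dimension term
  becomes - n plus the sum of the coordinates: \<open>C\<close> is - n and \<epsilon> is -
  1.\<close>

lemma resolvent_subspace_lattice_rev:
  assumes n: "1 \<le> n" and \<mu>: "0 < \<mu>" and x: "x \<in> orthoscheme_complex (subspace_lattice_rev n :: 'a vec set gorder)"
  defines "g \<equiv> \<lambda>x. - lovasz_extension (\<lambda>W. real (subspace_dim n W)) x
    + 1 / (8 * real n) * (oc_dist (subspace_lattice_rev n) (vertex \<bottom>\<^bsub>subspace_lattice_rev n\<^esub>) x)\<^sup>2"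
  shows "\<exists>!z. proximal_minimizer (subspace_lattice_rev n) g \<mu> x z"
    and "\<lbrakk>stores_point rep n (subspace_lattice_rev n) s x; cf s 1 0 = \<mu>\<rbrakk> \<Longrightarrow>
      \<exists>t s'. exec (resolvent_prog rep Minus) s t s' \<and> t \<le> 10000 * (n + 2) ^ 3 \<and>
        stores_point rep n (subspace_lattice_rev n) s' (resolvent (subspace_lattice_rev n) g \<mu> x)"
proof -
  interpret M: ranked_order "subspace_lattice_rev n :: 'a vec set gorder" n "\<lambda>W. n - subspace_dim n W"
    "\<lambda>Q W. n + subspace_dim n (W \<inter> Q) - subspace_dim n W - subspace_dim n Q" "carrier_vec n" "{0\<^sub>v n}"
    by (rule ranked_order_subspace_lattice_rev)
  have g: "g y = - real n - sgn_of Minus * (\<Sum>j = 1..n. coord (\<lambda>W. n - subspace_dim n W) y j)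
      + 1 / (8 * real n) * (oc_dist (subspace_lattice_rev n) (vertex (carrier_vec n)) y)\<^sup>2" if y: "y \<in> M.K" for y
  proof -
    have "(\<Sum>j = 1..n. coord (\<lambda>W. n - subspace_dim n W) y j) = (\<Sum>p\<in>supp y. y p * real (n - subspace_dim n p))"
      by (rule sum_coord) simp
    also have "\<dots> = (\<Sum>p\<in>supp y. real n * y p - y p * real (subspace_dim n p))"
      by (rule sum.cong) (use M.K_D(4) [OF y] subspace_dim_le in \<open>auto simp: of_nat_diff algebra_simps\<close>)
    also have "\<dots> = real n - lovasz_extension (\<lambda>W. real (subspace_dim n W)) y"
      by (simp add: sum_subtractf sum_distrib_left [symmetric] M.K_D(5) [OF y] lovasz_extension_def)
    finally show ?thesis
      by (simp add: g_def bottom_subspace_lattice_rev sgn_of_def)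
  qed
  show "\<exists>!z. proximal_minimizer (subspace_lattice_rev n) g \<mu> x z"
    by (rule M.unique_proximal_minimizer [OF n \<mu> x g])
  show "\<exists>t s'. exec (resolvent_prog rep Minus) s t s' \<and> t \<le> 10000 * (n + 2) ^ 3 \<and>
      stores_point rep n (subspace_lattice_rev n) s' (resolvent (subspace_lattice_rev n) g \<mu> x)"
    if "stores_point rep n (subspace_lattice_rev n) s x" "cf s 1 0 = \<mu>"
    by (rule stores_resolvent [OF M.ranked_order_axioms n \<mu> x g _ that]) simp_all
qed

end

theorem theorem3p5:
  fixes rep :: representation
  shows "resolvent_in_polynomial_time rep (subspace_lattice :: nat \<Rightarrow> 'k::field vec set gorder)
           (\<lambda>n x. - lovasz_extension (\<lambda>W. real (subspace_dim n W)) x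
              + 1 / (8 * real n) * (oc_dist (subspace_lattice n) (vertex \<bottom>\<^bsub>subspace_lattice n\<^esub>) x)\<^sup>2)
       \<and> resolvent_in_polynomial_time rep (subspace_lattice_rev :: nat \<Rightarrow> 'k vec set gorder)
           (\<lambda>n y. - lovasz_extension (\<lambda>W. real (subspace_dim n W)) y
              + 1 / (8 * real n) * (oc_dist (subspace_lattice_rev n) (vertex \<bottom>\<^bsub>subspace_lattice_rev n\<^esub>) y)\<^sup>2)"
  by (intro conjI resolvent_in_polynomial_timeI [where P = "resolvent_prog rep Plus"]
      resolvent_in_polynomial_timeI [where P = "resolvent_prog rep Minus"];
      rule vec_space.resolvent_subspace_lattice vec_space.resolvent_subspace_lattice_rev; assumption)

end
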